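(* Let $V_i\colon\mathcal{H}_i\to\overline{\mathbb{R}}$ and $S_i\colon\mathcal{H}_i\to\overline{\mathbb{R}}$ be the trapezoidal and Euler merits over the partitions $\mathcal{P}_i$, let $H\colon\mathcal{H}\to\overline{\mathbb{R}}$ be the continuous-discrete MAP merit and $H_{\mathrm e}\colon\mathcal{H}\to\overline{\mathbb{R}}$ the energy merit (all defined in the context). Then: (1) the maximization problems of $V_i$ over $\mathcal{H}_i$ (discretized MAP state path estimation with the trapezoidal scheme) hypo-converge, as $i\to\infty$, to the maximization of $H$ over $\mathcal{H}$ (continuous-discrete MAP state path estimation); (2) the maximization problems of $S_i$ over $\mathcal{H}_i$ (discretized MAP state path estimation with the Euler scheme) hypo-converge, as $i\to\infty$, to the maximization of $H_{\mathrm e}$ over $\mathcal{H}$ (minimum energy estimation).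
   Context: Let $T>0$, $\mathcal{T}=[0,T]$, $\overline{\mathbb{R}}=\mathbb{R}\cup\{-\infty,\infty\}$, $\ln 0=-\infty$, and let $\|\cdot\|$ be the Euclidean norm on $\mathbb{R}^n$. Data. The drift $f\colon\mathbb{R}\times\mathbb{R}^n\to\mathbb{R}^n$ is jointly continuous and of class $C^2_b$ in its second argument $x$ uniformly over the first argument $t$ (i.e. $f$ and its first and second $x$-derivatives are continuous in $x$ and bounded uniformly in $t$). $G\in\mathbb{R}^{n\times n}$ has full rank, $Q:=(GG^{\top})^{-1}$ and $\|x\|_Q:=\sqrt{x^{\top}Qx}$. $\nabla_x f$ is the Jacobian matrix of $f$ in $x$ and $\operatorname{div} f=\operatorname{tr}\nabla_x f$. $\nu\colon\mathbb{R}^n\to[0,\infty)$ is a bounded continuous probability density (of the initial state). $\mathcal{T}_{\mathrm m}\subset\mathcal{T}$ is a finite set of measurement times; for each $t\in\mathcal{T}_{\mathrm m}$, $y_t$ is a fixed measured value in $\mathbb{R}^{m_t}$ and $\psi_t(y\mid x)$ is the conditional density of the measurement given the state, which is bounded and continuous in $x$. The state process $X$ solves $dX_t=f(t,X_t)\,dt+G\,dW_t$ on $\mathcal{T}$ with $W$ an $n$-dimensional Wiener process, $X_0\sim\nu$ independent of $W$, and $\mathrm{E}[\psi_t(y_t\mid X_t)]>0$ for each $t\in\mathcal{T}_{\mathrm m}$. Space. $\mathcal{H}$ is the space of absolutely continuous $\phi\colon\mathcal{T}\to\mathbb{R}^n$ with $\dot\phi\in L^2(\mathcal{T})$, with inner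 product $\langle a,b\rangle_{\mathcal{H}}=a(0)^{\top}b(0)+\int_0^T\dot a(t)^{\top}\dot b(t)\,dt$ and the associated norm. Continuous-discrete merits. For $\phi\in\mathcal{H}$, $$J(\phi)=-\tfrac12\int_0^T\big[\|\dot\phi(t)-f(t,\phi(t))\|_Q^2+\operatorname{div}f(t,\phi(t))\big]dt,\qquad J_{\mathrm e}(\phi)=-\tfrac12\int_0^T\|\dot\phi(t)-f(t,\phi(t))\|_Q^2\,dt,$$ $$H(\phi)=J(\phi)+\ln\nu(\phi(0))+\sum_{t\in\mathcal{T}_{\mathrm m}}\ln\psi_t(y_t\mid\phi(t)),\qquad H_{\mathrm e}(\phi)=J_{\mathrm e}(\phi)+\ln\nu(\phi(0))+\sum_{t\in\mathcal{T}_{\mathrm m}}\ln\psi_t(y_t\mid\phi(t)).$$ Partitions. $\{\mathcal{P}_i\}_{i=1}^\infty$ is a sequence of ordered partitions $\mathcal{P}_i=\{0=t_{0i}<t_{1i}<\dots<t_{N_i i}=T\}$ with $\mathcal{T}_{\mathrm m}\subset\mathcal{P}_i$. Let $\delta_{ki}=t_{k+1,i}-t_{ki}$ and $\bar\delta_i=\max_{0\le k<N_i}\delta_{ki}$. It is assumed that $\mathcal{P}_i\subset\mathcal{P}_{i+1}$, $\lim_{i\to\infty}\bar\delta_i=0$, and $\bar\delta_iN_i<c_3$ for all $i$, for some constant $c_3>0$. The partitions are assumed fine enough that the trapezoidal scheme is a contraction, i.e. $\tfrac12\bar\delta_i\sup_{t\in\mathcal{T},x\in\mathbb{R}^n}\|\nabla_xf(t,x)\|<1$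 (operator norm). $\mathcal{H}_i\subset\mathcal{H}$ is the space of continuous piecewise linear functions $\mathcal{T}\to\mathbb{R}^n$ with breaks along $\mathcal{P}_i$. Discretized merits. For $\phi\in\mathcal{H}_i$ write $x_k=\phi(t_{ki})$, $\Delta x_k=x_{k+1}-x_k$, and $$R_i(\phi)=-\tfrac12\sum_{k=0}^{N_i-1}\delta_{ki}\Big\|\tfrac{\Delta x_k}{\delta_{ki}}-f(t_{ki},x_k)\Big\|_Q^2,$$ $$U_i(\phi)=\sum_{k=0}^{N_i-1}\ln\det\!\big(\mathrm{I}-\tfrac12\nabla_xf(t_{k+1,i},x_{k+1})\delta_{ki}\big)-\tfrac12\sum_{k=0}^{N_i-1}\delta_{ki}\Big\|\tfrac{\Delta x_k}{\delta_{ki}}-\tfrac12\big[f(t_{ki},x_k)+f(t_{k+1,i},x_{k+1})\big]\Big\|_Q^2,$$ $$S_i(\phi)=R_i(\phi)+\ln\nu(\phi(0))+\sum_{t\in\mathcal{T}_{\mathrm m}}\ln\psi_t(y_t\mid\phi(t)),\qquad V_i(\phi)=U_i(\phi)+\ln\nu(\phi(0))+\sum_{t\in\mathcal{T}_{\mathrm m}}\ln\psi_t(y_t\mid\phi(t)).$$ Hypo-convergence. For $F_i\colon\mathcal{H}_i\to\overline{\mathbb{R}}$ and $F\colon\mathcal{H}\to\overline{\mathbb{R}}$, the problems of maximizing $F_i$ over $\mathcal{H}_i$ hypo-converge to the problem of maximizing $F$ over $\mathcal{H}$ if the hypographs $\{(\phi,r)\in\mathcal{H}_i\times\mathbb{R}: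 r\le F_i(\phi)\}$ converge, in the Painlevé–Kuratowski sense in $\mathcal{H}\times\mathbb{R}$, to $\{(\phi,r)\in\mathcal{H}\times\mathbb{R}: r\le F(\phi)\}$; that is, every point of the hypograph of $F$ is the limit of a sequence of points of the hypographs of $F_i$, and every cluster point of any sequence of points of the hypographs of $F_i$ lies in the hypograph of $F$. *)

theory Defs
  imports "HOL-Probability.Probability"
begin

section \<open>The path space\<close>

definition abs_continuous_on :: "real set \<Rightarrow> (real \<Rightarrow> 'a::real_normed_vector) \<Rightarrow> bool" where
  "abs_continuous_on S u \<longleftrightarrow>
     (\<forall>\<epsilon>>0. \<exists>\<delta>>0. \<forall>(m::nat) a b.
        (\<forall>k<m. a k \<le> b k \<and> {a k..b k} \<subseteq> S) \<and>
        disjoint_family_on (\<lambda>k. {a k<..<b k}) {..<m} \<and>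
        (\<Sum>k<m. b k - a k) < \<delta>
        \<longrightarrow> (\<Sum>k<m. norm (u (b k) - u (a k))) < \<epsilon>)"

text \<open>An absolutely continuous path is differentiable almost everywhere on \<open>{0..T}\<close>; on the
  remaining null set \<open>path_deriv\<close> is an unspecified value, which no integral below can see.\<close>

definition path_deriv :: "real \<Rightarrow> (real \<Rightarrow> 'a::real_normed_vector) \<Rightarrow> real \<Rightarrow> 'a" where
  "path_deriv T \<phi> t = vector_derivative \<phi> (at t within {0..T})"

text \<open>Paths on \<open>{0..T}\<close> are represented by \<open>extensional\<close> functions, so that equal paths are
  equal functions.\<close>

definition H_space :: "real \<Rightarrow> (real \<Rightarrow> 'a::euclidean_space) set" where
  "H_space T = {\<phi> \<in> extensional {0..T}.
     abs_continuous_on {0..T} \<phi> \<and>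
     set_borel_measurable lebesgue {0..T} (path_deriv T \<phi>) \<and>
     set_integrable lebesgue {0..T} (\<lambda>t. (norm (path_deriv T \<phi> t))\<^sup>2)}"

definition H_inner :: "real \<Rightarrow> (real \<Rightarrow> 'a::euclidean_space) \<Rightarrow> (real \<Rightarrow> 'a) \<Rightarrow> real" where
  "H_inner T a b = a 0 \<bullet> b 0 + (LINT t:{0..T}|lebesgue. path_deriv T a t \<bullet> path_deriv T b t)"

definition H_norm :: "real \<Rightarrow> (real \<Rightarrow> 'a::euclidean_space) \<Rightarrow> real" where
  "H_norm T a = sqrt (H_inner T a a)"


section \<open>Hypo-convergence\<close>

text \<open>Painleve-Kuratowski convergence of subsets \<open>C i\<close> of a space \<open>Z\<close> with metric \<open>d\<close>. In the
  second clause \<open>r\<close> picks a subsequence, so \<open>p\<close> ranges over all cluster points.\<close>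

definition PK_converges ::
  "'z set \<Rightarrow> ('z \<Rightarrow> 'z \<Rightarrow> real) \<Rightarrow> (nat \<Rightarrow> 'z set) \<Rightarrow> 'z set \<Rightarrow> bool" where
  "PK_converges Z d C L \<longleftrightarrow>
     (\<forall>p\<in>L. \<exists>q. (\<forall>i. q i \<in> C i) \<and> (\<lambda>i. d (q i) p) \<longlonglongrightarrow> 0) \<and>
     (\<forall>q r. \<forall>p\<in>Z. strict_mono r \<and> (\<forall>j. q j \<in> C (r j)) \<and> (\<lambda>j. d (q j) p) \<longlonglongrightarrow> 0 \<longrightarrow> p \<in> L)"

definition hypograph :: "'z set \<Rightarrow> ('z \<Rightarrow> ereal) \<Rightarrow> ('z \<times> real) set" where
  "hypograph A F = {(\<phi>, r). \<phi> \<in> A \<and> ereal r \<le> F \<phi>}"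

definition HR_dist ::
  "real \<Rightarrow> (real \<Rightarrow> 'a::euclidean_space) \<times> real \<Rightarrow> (real \<Rightarrow> 'a) \<times> real \<Rightarrow> real" where
  "HR_dist T p q = sqrt ((H_norm T (\<lambda>t. fst p t - fst q t))\<^sup>2 + (snd p - snd q)\<^sup>2)"

definition hypo_converges ::
  "real \<Rightarrow> (nat \<Rightarrow> (real \<Rightarrow> 'a::euclidean_space) set) \<Rightarrow> (nat \<Rightarrow> (real \<Rightarrow> 'a) \<Rightarrow> ereal)
     \<Rightarrow> ((real \<Rightarrow> 'a) \<Rightarrow> ereal) \<Rightarrow> bool" where
  "hypo_converges T A F\<^sub>i F \<longleftrightarrow>
     PK_converges (H_space T \<times> UNIV) (HR_dist T)
       (\<lambda>i. hypograph (A i) (F\<^sub>i i)) (hypograph (H_space T) F)"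


section \<open>Data of the model\<close>

text \<open>Twice continuously differentiable in \<open>x\<close>, with \<open>f\<close> and both derivatives bounded uniformly
  in \<open>t\<close>. Continuity of \<open>f t\<close> and \<open>f' t\<close> follows from differentiability.\<close>

definition C2b_uniform :: "(real \<Rightarrow> 'a::real_normed_vector \<Rightarrow> 'b::real_normed_vector) \<Rightarrow> bool" where
  "C2b_uniform f \<longleftrightarrow>
     (\<exists>(f' :: real \<Rightarrow> 'a \<Rightarrow> 'a \<Rightarrow>\<^sub>L 'b) (f'' :: real \<Rightarrow> 'a \<Rightarrow> 'a \<Rightarrow>\<^sub>L 'a \<Rightarrow>\<^sub>L 'b) B.
        \<forall>t. (\<forall>x. (f t has_derivative blinfun_apply (f' t x)) (at x)) \<and>
            (\<forall>x. (f' t has_derivative blinfun_apply (f'' t x)) (at x)) \<and>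
            continuous_on UNIV (f'' t) \<and>
            (\<forall>x. norm (f t x) \<le> B \<and> norm (f' t x) \<le> B \<and> norm (f'' t x) \<le> B))"

definition Jac :: "(real \<Rightarrow> real^'n \<Rightarrow> real^'n) \<Rightarrow> real \<Rightarrow> real^'n \<Rightarrow> real^'n^'n" where
  "Jac f t x = jacobian (f t) (at x)"

definition divg :: "(real \<Rightarrow> real^'n \<Rightarrow> real^'n) \<Rightarrow> real \<Rightarrow> real^'n \<Rightarrow> real" where
  "divg f t x = trace (Jac f t x)"

definition Qmat :: "real^'n^'n \<Rightarrow> real^'n^'n" where
  "Qmat G = matrix_inv (G ** transpose G)"

definition Qnorm :: "real^'n^'n \<Rightarrow> real^'n \<Rightarrow> real" where
  "Qnorm G x = sqrt (x \<bullet> (Qmat G *v x))"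

definition prob_density :: "'a measure \<Rightarrow> ('a \<Rightarrow> real) \<Rightarrow> bool" where
  "prob_density M p \<longleftrightarrow> p \<in> borel_measurable M \<and> (\<forall>x\<in>space M. 0 \<le> p x) \<and>
     (\<integral>\<^sup>+x. ennreal (p x) \<partial>M) = 1"

text \<open>The space of vectors of \<open>m\<close> reals, for \<open>m\<close> a value and not a type: the dimension of a
  measurement depends on the time at which it is taken.\<close>

definition lborel_nat :: "nat \<Rightarrow> (nat \<Rightarrow> real) measure" where
  "lborel_nat m = (\<Pi>\<^sub>M j\<in>{..<m}. lborel)"

text \<open>Standard \<open>n\<close>-dimensional Wiener process on \<open>{0..T}\<close>.\<close>

definition wiener_process :: "'w measure \<Rightarrow> real \<Rightarrow> (real \<Rightarrow> 'w \<Rightarrow> real^'n) \<Rightarrow> bool" where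
  "wiener_process M T W \<longleftrightarrow>
     (\<forall>t\<in>{0..T}. W t \<in> borel_measurable M) \<and>
     (AE \<omega> in M. W 0 \<omega> = 0) \<and>
     (AE \<omega> in M. continuous_on {0..T} (\<lambda>t. W t \<omega>)) \<and>
     (\<forall>s t. 0 \<le> s \<and> s < t \<and> t \<le> T \<longrightarrow>
        distributed M lborel (\<lambda>\<omega>. W t \<omega> - W s \<omega>)
          (\<lambda>x. ennreal (\<Prod>i\<in>UNIV. normal_density 0 (sqrt (t - s)) (x $ i)))) \<and>
     (\<forall>\<tau>::nat \<Rightarrow> real. mono \<tau> \<and> range \<tau> \<subseteq> {0..T} \<longrightarrow>
        prob_space.indep_vars M (\<lambda>_. borel) (\<lambda>j \<omega>. W (\<tau> (Suc j)) \<omega> - W (\<tau> j) \<omega>) UNIV)"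

text \<open>Solution of \<open>dX = f(t, X) dt + G dW\<close> with \<open>X 0\<close> of density \<open>\<nu>\<close> and independent of \<open>W\<close>. As
  \<open>G\<close> is constant, the stochastic integral of \<open>G\<close> up to time \<open>t\<close> is \<open>G *v W t\<close>, and the equation
  can be read path by path.\<close>

definition sde_solution ::
  "'w measure \<Rightarrow> real \<Rightarrow> (real \<Rightarrow> real^'n \<Rightarrow> real^'n) \<Rightarrow> real^'n^'n \<Rightarrow> (real^'n \<Rightarrow> real)
     \<Rightarrow> (real \<Rightarrow> 'w \<Rightarrow> real^'n) \<Rightarrow> (real \<Rightarrow> 'w \<Rightarrow> real^'n) \<Rightarrow> bool" where
  "sde_solution M T f G \<nu> W X \<longleftrightarrow>
     distributed M lborel (X 0) (\<lambda>x. ennreal (\<nu> x)) \<and>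
     prob_space.indep_set M
       (sets (vimage_algebra (space M) (X 0) borel))
       (sets (vimage_algebra (space M) (\<lambda>\<omega>. \<lambda>t\<in>{0..T}. W t \<omega>) (\<Pi>\<^sub>M t\<in>{0..T}. borel))) \<and>
     (\<forall>t\<in>{0..T}. X t \<in> borel_measurable M) \<and>
     (AE \<omega> in M. continuous_on {0..T} (\<lambda>t. X t \<omega>) \<and>
        (\<forall>t\<in>{0..T}. X t \<omega> = X 0 \<omega> + (LINT s:{0..t}|lebesgue. f s (X s \<omega>)) + G *v W t \<omega>))"


section \<open>Continuous-discrete merits\<close>

text \<open>Logarithm of a nonnegative real, with the convention \<open>eln 0 = -\<infinity>\<close>.\<close>

definition eln :: "real \<Rightarrow> ereal" where
  "eln x = (if 0 < x then ereal (ln x) else -\<infinity>)"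

definition J_merit ::
  "real \<Rightarrow> (real \<Rightarrow> real^'n \<Rightarrow> real^'n) \<Rightarrow> real^'n^'n \<Rightarrow> (real \<Rightarrow> real^'n) \<Rightarrow> real" where
  "J_merit T f G \<phi> = - (1/2) * (LINT t:{0..T}|lebesgue.
     (Qnorm G (path_deriv T \<phi> t - f t (\<phi> t)))\<^sup>2 + divg f t (\<phi> t))"

definition Je_merit ::
  "real \<Rightarrow> (real \<Rightarrow> real^'n \<Rightarrow> real^'n) \<Rightarrow> real^'n^'n \<Rightarrow> (real \<Rightarrow> real^'n) \<Rightarrow> real" where
  "Je_merit T f G \<phi> = - (1/2) * (LINT t:{0..T}|lebesgue.
     (Qnorm G (path_deriv T \<phi> t - f t (\<phi> t)))\<^sup>2)"

text \<open>The part common to all merits: log-density of the initial state and log-likelihood of the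
  measured values \<open>y\<close> at the times \<open>Tm\<close>.\<close>

definition data_merit ::
  "(real^'n \<Rightarrow> real) \<Rightarrow> real set \<Rightarrow> (real \<Rightarrow> (nat \<Rightarrow> real) \<Rightarrow> real^'n \<Rightarrow> real)
     \<Rightarrow> (real \<Rightarrow> nat \<Rightarrow> real) \<Rightarrow> (real \<Rightarrow> real^'n) \<Rightarrow> ereal" where
  "data_merit \<nu> Tm \<psi> y \<phi> = eln (\<nu> (\<phi> 0)) + (\<Sum>t\<in>Tm. eln (\<psi> t (y t) (\<phi> t)))"

definition H_merit where
  "H_merit T f G \<nu> Tm \<psi> y \<phi> = ereal (J_merit T f G \<phi>) + data_merit \<nu> Tm \<psi> y \<phi>"

definition He_merit where
  "He_merit T f G \<nu> Tm \<psi> y \<phi> = ereal (Je_merit T f G \<phi>) + data_merit \<nu> Tm \<psi> y \<phi>"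


section \<open>Partitions and discretized merits\<close>

definition is_partition :: "real \<Rightarrow> nat \<Rightarrow> (nat \<Rightarrow> real) \<Rightarrow> bool" where
  "is_partition T N \<tau> \<longleftrightarrow> \<tau> 0 = 0 \<and> \<tau> N = T \<and> (\<forall>k<N. \<tau> k < \<tau> (Suc k))"

definition part_points :: "nat \<Rightarrow> (nat \<Rightarrow> real) \<Rightarrow> real set" where
  "part_points N \<tau> = \<tau> ` {..N}"

definition step :: "(nat \<Rightarrow> real) \<Rightarrow> nat \<Rightarrow> real" where
  "step \<tau> k = \<tau> (Suc k) - \<tau> k"

definition mesh :: "nat \<Rightarrow> (nat \<Rightarrow> real) \<Rightarrow> real" where
  "mesh N \<tau> = Max (step \<tau> ` {..<N})"

definition pl_space :: "real \<Rightarrow> nat \<Rightarrow> (nat \<Rightarrow> real) \<Rightarrow> (real \<Rightarrow> 'a::euclidean_space) set" where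
  "pl_space T N \<tau> = {\<phi> \<in> extensional {0..T}.
     continuous_on {0..T} \<phi> \<and>
     (\<forall>k<N. \<exists>a b. \<forall>t\<in>{\<tau> k..\<tau> (Suc k)}. \<phi> t = a + t *\<^sub>R b)}"

definition R_merit ::
  "(real \<Rightarrow> real^'n \<Rightarrow> real^'n) \<Rightarrow> real^'n^'n \<Rightarrow> nat \<Rightarrow> (nat \<Rightarrow> real) \<Rightarrow> (real \<Rightarrow> real^'n) \<Rightarrow> real" where
  "R_merit f G N \<tau> \<phi> = - (1/2) * (\<Sum>k<N. step \<tau> k *
     (Qnorm G ((1 / step \<tau> k) *\<^sub>R (\<phi> (\<tau> (Suc k)) - \<phi> (\<tau> k)) - f (\<tau> k) (\<phi> (\<tau> k))))\<^sup>2)"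

text \<open>The determinants are positive on partitions fine enough for the trapezoidal scheme to be a
  contraction, so that the real logarithm is the right one.\<close>

definition U_merit ::
  "(real \<Rightarrow> real^'n \<Rightarrow> real^'n) \<Rightarrow> real^'n^'n \<Rightarrow> nat \<Rightarrow> (nat \<Rightarrow> real) \<Rightarrow> (real \<Rightarrow> real^'n) \<Rightarrow> real" where
  "U_merit f G N \<tau> \<phi> =
     (\<Sum>k<N. ln (det (mat 1 - (1/2 * step \<tau> k) *\<^sub>R Jac f (\<tau> (Suc k)) (\<phi> (\<tau> (Suc k)))))) -
     (1/2) * (\<Sum>k<N. step \<tau> k *
       (Qnorm G ((1 / step \<tau> k) *\<^sub>R (\<phi> (\<tau> (Suc k)) - \<phi> (\<tau> k)) -
          (1/2) *\<^sub>R (f (\<tau> k) (\<phi> (\<tau> k)) + f (\<tau> (Suc k)) (\<phi> (\<tau> (Suc k))))))\<^sup>2)"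

definition S_merit where
  "S_merit f G \<nu> Tm \<psi> y N \<tau> \<phi> = ereal (R_merit f G N \<tau> \<phi>) + data_merit \<nu> Tm \<psi> y \<phi>"

definition V_merit where
  "V_merit f G \<nu> Tm \<psi> y N \<tau> \<phi> = ereal (U_merit f G N \<tau> \<phi>) + data_merit \<nu> Tm \<psi> y \<phi>"

end

theory Submission
  imports Defs
begin

text \<open>If piecewise linear paths \<open>\<phi>\<^sub>i\<close> on the partitions converge to \<open>\<phi>\<close> in the Sobolev norm, they
  converge uniformly and their slopes converge to the derivative of \<open>\<phi>\<close> in \<open>L\<^sup>2\<close>. The quadratic parts
  of the discrete merits are integrals of step functions, hence converge. For the trapezoidal
  scheme \<open>ln det (I - \<delta>/2 A) = - \<delta>/2 tr A + O(\<delta>\<^sup>2)\<close> uniformly in bounded \<open>A\<close>, so that the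
  log-determinants add up to a Riemann sum of \<open>- div f / 2\<close>; the Euler scheme lacks this term. The
  discrete merits thus converge along every convergent sequence of paths, which yields the cluster
  point half of hypo-convergence. The other half only needs a recovery sequence on which the data
  term stays finite: the nodal interpolants, which agree with \<open>\<phi>\<close> at time \<open>0\<close> and at all measurement
  times, and converge to \<open>\<phi>\<close> because their slopes are averages of the derivative.

  For the last step, and to recover a path from its pointwise derivative, one needs Lebesgue's
  theorem that an absolutely continuous function is differentiable almost everywhere and is the
  integral of its derivative. By Vitali's covering theorem a point set of positive measure on which
  the slopes of arbitrarily short intervals oscillate between \<open>p < q\<close> is covered, up to small measure,
  by disjoint intervals of slope below \<open>p\<close>, and again by subintervals of these of slope above \<open>q\<close>;
  by absolute continuity the increments over the remaining gaps are negligible, a contradiction.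
  The integral formula follows by choosing a gauge which, on the exceptional null set, is an open
  set of small measure.\<close>

section \<open>Absolutely continuous functions of a real variable\<close>

text \<open>Slopes are taken over intervals that contain the point in their interior, in place of
  difference quotients at the point. Such intervals are what a Vitali covering consists of, and the
  points straddled by intervals with a given property form an open set, so that all exceptional sets
  are visibly Borel. Continuity converts these slopes back into the derivative at the end. The error
  of the log-determinant expansion must be uniform in the matrix: a bound of \<open>C\<close> times
  the squared step in each cell sums to \<open>C * T\<close> times the mesh, because the steps add
  up to \<open>T\<close>. Only the data term can take the value \<open>-\<infinity>\<close>. It is
  therefore separated from the real-valued part, and its logarithms are merged into one, whose limit
  is that of a product of nonnegative numbers. The real-valued part is treated along arbitrary
  subsequences of the partitions, since a cluster point of hypographs may arise along any of
  them.\<close>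

lemma abs_continuous_on_subset:
  assumes ac: "abs_continuous_on S u" and sub: "S' \<subseteq> S"
  shows "abs_continuous_on S' u"
  unfolding abs_continuous_on_def
proof (intro allI impI)
  fix e :: real assume "e > 0"
  obtain d where d: "d > 0" and d': "\<forall>(m::nat) a b.
      (\<forall>k<m. a k \<le> b k \<and> {a k..b k} \<subseteq> S) \<and>
      disjoint_family_on (\<lambda>k. {a k<..<b k}) {..<m} \<and>
      (\<Sum>k<m. b k - a k) < d
      \<longrightarrow> (\<Sum>k<m. norm (u (b k) - u (a k))) < e"
    using ac[unfolded abs_continuous_on_def, rule_format, OF \<open>e > 0\<close>] by (elim exE conjE) (rule that)
  show "\<exists>d>0. \<forall>(m::nat) a b.
      (\<forall>k<m. a k \<le> b k \<and> {a k..b k} \<subseteq> S') \<and>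
      disjoint_family_on (\<lambda>k. {a k<..<b k}) {..<m} \<and>
      (\<Sum>k<m. b k - a k) < d
      \<longrightarrow> (\<Sum>k<m. norm (u (b k) - u (a k))) < e"
  proof (intro exI[of _ d] conjI d allI impI)
    fix m :: nat and a b :: "nat \<Rightarrow> real"
    assume A: "(\<forall>k<m. a k \<le> b k \<and> {a k..b k} \<subseteq> S') \<and>
      disjoint_family_on (\<lambda>k. {a k<..<b k}) {..<m} \<and> (\<Sum>k<m. b k - a k) < d"
    then have "\<forall>k<m. a k \<le> b k \<and> {a k..b k} \<subseteq> S" using sub by (meson subset_trans)
    with A d' show "(\<Sum>k<m. norm (u (b k) - u (a k))) < e" by blast
  qed
qed

section \<open>Increments over finite divisions and Vitali coverings\<close>

lemma division_of_real_intervalD: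
  fixes K :: "real set"
  assumes "p division_of X" "K \<in> p"
  shows "Inf K \<le> Sup K" "K = {Inf K..Sup K}"
proof -
  obtain l r where "K = {l..r}" "K \<noteq> {}"
    using division_ofD(3,4)[OF assms] by (metis cbox_interval)
  then show "Inf K \<le> Sup K" "K = {Inf K..Sup K}" by auto
qed

lemma sum_increments_division:
  fixes u :: "real \<Rightarrow> 'a::real_normed_vector"
  assumes p: "p division_of {a..b}" and ab: "a \<le> b"
  shows "(\<Sum>K\<in>p. u (Sup K) - u (Inf K)) = u b - u a"
proof -
  \<comment> \<open>Telescoping is taken from tagged divisions. Tagging each interval with its left
    end makes the tag a function of the interval, so that the sum can be reindexed.\<close>
  let ?P = "(\<lambda>K. (Inf K, K)) ` p"
  have inK: "Inf K \<in> K" if "K \<in> p" for K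
    using division_of_real_intervalD[OF p that] by (metis atLeastAtMost_iff order_refl)
  have "?P tagged_division_of {a..b}"
  proof (rule tagged_division_ofI)
    show "finite ?P" using division_ofD(1)[OF p] by simp
    fix x K assume "(x, K) \<in> ?P"
    then have K: "K \<in> p" "x = Inf K" by auto
    show "x \<in> K" "K \<subseteq> {a..b}" "\<exists>a b. K = cbox a b"
      using inK[OF K(1)] K division_ofD(2,4)[OF p K(1)] by simp_all
    fix y L assume "(y, L) \<in> ?P" "(x, K) \<noteq> (y, L)"
    then have "L \<in> p" "K \<noteq> L" using K by auto
    then show "interior K \<inter> interior L = {}"
      using division_ofD(5)[OF p K(1)] by simp
  next
    show "\<Union> {K. \<exists>x. (x, K) \<in> ?P} = {a..b}"
      using division_ofD(6)[OF p] by (simp add: image_iff)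
  qed
  from additive_tagged_division_1[OF ab this, of u] show ?thesis
    by (simp add: sum.reindex inj_on_def)
qed

text \<open>Vitali coverings and gauge integrals both present their intervals as divisions, so the
  indexed families of the definition are traded for these. The total length becomes the measure of
  the union because members of a division overlap only in null sets.\<close>

lemma abs_continuous_on_division:
  assumes ac: "abs_continuous_on S u" and e: "e > 0"
  obtains d where "d > 0"
    "\<And>p X. \<lbrakk>p division_of X; X \<subseteq> S; measure lebesgue X < d\<rbrakk>
       \<Longrightarrow> (\<Sum>K\<in>p. norm (u (Sup K) - u (Inf K))) < e"
proof -
  obtain d where d: "d > 0" and ac': "\<forall>(m::nat) a b.
        (\<forall>k<m. a k \<le> b k \<and> {a k..b k} \<subseteq> S) \<and>
        disjoint_family_on (\<lambda>k. {a k<..<b k}) {..<m} \<and>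
        (\<Sum>k<m. b k - a k) < d
        \<longrightarrow> (\<Sum>k<m. norm (u (b k) - u (a k))) < e"
    using ac[unfolded abs_continuous_on_def, rule_format, OF e] by (elim exE conjE) (rule that)
  show ?thesis
  proof (rule that[OF d])
    fix p X
    assume p: "p division_of X" and X: "X \<subseteq> S" and small: "measure lebesgue X < d"
    obtain h where h: "bij_betw h {0..<card p} p"
      using ex_bij_betw_nat_finite[OF division_ofD(1)[OF p]] by blast
    then have h: "bij_betw h {..<card p} p"
      by (simp add: atLeast0LessThan)
    have hp: "h k \<in> p" if "k < card p" for k
      using h that by (auto simp: bij_betw_def)
    note K = division_of_real_intervalD[OF p]
    have "(\<Sum>k<card p. norm (u (Sup (h k)) - u (Inf (h k)))) < e"
    proof (rule ac'[rule_format], intro conjI)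
      show "\<forall>k<card p. Inf (h k) \<le> Sup (h k) \<and> {Inf (h k)..Sup (h k)} \<subseteq> S"
        using K[OF hp] division_ofD(2)[OF p hp] X by (metis subset_trans)
      show "disjoint_family_on (\<lambda>k. {Inf (h k)<..<Sup (h k)}) {..<card p}"
      proof (unfold disjoint_family_on_def, intro ballI impI)
        fix i j assume ij: "i \<in> {..<card p}" "j \<in> {..<card p}" "i \<noteq> j"
        then have "h i \<noteq> h j"
          using h by (auto simp: bij_betw_def inj_on_def)
        then have "interior (h i) \<inter> interior (h j) = {}"
          using division_ofD(5)[OF p hp hp] ij by auto
        moreover have "interior (h i) = {Inf (h i)<..<Sup (h i)}"
            "interior (h j) = {Inf (h j)<..<Sup (h j)}"
          using K(2)[OF hp] ij by (metis interior_atLeastAtMost_real lessThan_iff)+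
        ultimately show "{Inf (h i)<..<Sup (h i)} \<inter> {Inf (h j)<..<Sup (h j)} = {}" by simp
      qed
      have "(\<Sum>k<card p. Sup (h k) - Inf (h k)) = (\<Sum>K\<in>p. Sup K - Inf K)"
        by (rule sum.reindex_bij_betw[OF h])
      also have "\<dots> = (\<Sum>K\<in>p. measure lebesgue K)"
      proof (rule sum.cong[OF refl])
        fix L assume "L \<in> p"
        have "measure lebesgue {Inf L..Sup L} = Sup L - Inf L"
          using K(1)[OF \<open>L \<in> p\<close>] by simp
        then show "Sup L - Inf L = measure lebesgue L"
          using K(2)[OF \<open>L \<in> p\<close>] by simp
      qed
      also have "\<dots> = measure lebesgue X"
        by (rule content_division[OF p])
      finally show "(\<Sum>k<card p. Sup (h k) - Inf (h k)) < d"
        using small by simp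
    qed
    then show "(\<Sum>K\<in>p. norm (u (Sup K) - u (Inf K))) < e"
      by (simp add: sum.reindex_bij_betw[OF h, of "\<lambda>K. norm (u (Sup K) - u (Inf K))"])
  qed
qed

text \<open>A countable disjoint Vitali subfamily exhausts \<open>E\<close> up to a null set. As its
  union lies in \<open>U\<close>, of finite measure, finitely many members already leave out less
  than \<open>e\<close>. The members are disjoint as closed sets, which is more than a division
  requires.\<close>

lemma Vitali_finite_division:
  fixes E U :: "real set"
  assumes E: "E \<in> sets lebesgue" and U: "U \<in> lmeasurable" and e: "e > 0"
    and V: "\<And>x d. \<lbrakk>x \<in> E; d > 0\<rbrakk> \<Longrightarrow> \<exists>l r. l < x \<and> x < r \<and> r - l < d \<and> P l r"
    and sub: "\<And>l r. P l r \<Longrightarrow> {l..r} \<subseteq> U"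
  obtains D where "D division_of \<Union>D" "\<Union>D \<subseteq> U" "pairwise disjnt D"
    "\<And>K. K \<in> D \<Longrightarrow> \<exists>l r. l < r \<and> P l r \<and> K = {l..r}"
    "measure lebesgue (E - \<Union>D) < e"
proof -
  define Q where "Q = {(l,r). l < r \<and> P l r}"
  define c where "c = (\<lambda>(l,r). (l + r) / 2 :: real)"
  define s where "s = (\<lambda>(l,r). (r - l) / 2 :: real)"
  \<comment> \<open>The covering theorem speaks of closed balls: each interval is the ball about its
    midpoint.\<close>
  have cb: "cball (c i) (s i) = {fst i..snd i}" for i
    unfolding c_def s_def cball_eq_atLeastAtMost by (auto simp: field_simps split: prod.split)
  have s: "0 < s i" if "i \<in> Q" for i
    using that by (auto simp: Q_def s_def)
  have cov: "\<exists>i. i \<in> Q \<and> x \<in> cball (c i) (s i) \<and> s i < d" if x: "x \<in> E" and d: "0 < d" for x d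
  proof -
    obtain l r where "l < x" "x < r" "r - l < d" "P l r"
      using V[OF x d] by blast
    then show ?thesis
      unfolding cb by (intro exI[of _ "(l, r)"]) (auto simp: Q_def s_def)
  qed
  obtain C where C: "countable C" "C \<subseteq> Q"
     "pairwise (\<lambda>i j. disjnt (cball (c i) (s i)) (cball (c j) (s j))) C"
     "negligible (E - (\<Union>i \<in> C. cball (c i) (s i)))"
    using Vitali_covering_theorem_cballs[of Q s E c, OF s cov] by blast
  define \<D> where "\<D> = (\<lambda>i. {fst i..snd i}) ` C"
  have neg: "negligible (E - \<Union>\<D>)"
    using C(4) by (simp add: cb \<D>_def)
  have \<D>P: "\<exists>l r. l < r \<and> P l r \<and> K = {l..r}" if "K \<in> \<D>" for K
    using that C(2) by (force simp: \<D>_def Q_def)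
  have \<D>U: "\<Union>\<D> \<subseteq> U"
    using \<D>P sub by blast
  have cnt: "countable \<D>" by (simp add: \<D>_def C)
  have bor: "K \<in> lmeasurable" if "K \<in> \<D>" for K
    using \<D>P[OF that] by auto
  have disj: "K \<inter> L = {}" if KL: "K \<in> \<D>" "L \<in> \<D>" "K \<noteq> L" for K L
  proof -
    obtain i j where ij: "i \<in> C" "j \<in> C" "K = cball (c i) (s i)" "L = cball (c j) (s j)"
      using KL(1,2) by (auto simp: \<D>_def cb)
    with KL(3) have "i \<noteq> j" by auto
    with C(3) ij show ?thesis unfolding pairwise_def disjnt_def by auto
  qed
  have U\<D>: "\<Union>\<D> \<in> lmeasurable"
    using U \<D>U bor cnt by (meson fmeasurableI2 fmeasurableD sets.countable_Union subsetI)
  \<comment> \<open>This uniform bound lets finite subunions approximate the measure of the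
    countable union.\<close>
  have bnd: "measure lebesgue (\<Union>D') \<le> measure lebesgue U" if "D' \<subseteq> \<D>" "finite D'" for D'
    using that \<D>U U bor by (intro measure_mono_fmeasurable) (auto intro!: sets.finite_Union)
  obtain D where D: "D \<subseteq> \<D>" "finite D" "measure lebesgue (\<Union>\<D>) - e < measure lebesgue (\<Union>D)"
    using measure_countable_Union_approachable[OF cnt e bor bnd] by metis
  have UD: "\<Union>D \<in> lmeasurable"
    using D bor by (intro fmeasurable.finite_Union) auto
  show ?thesis
  proof (rule that)
    show "D division_of \<Union>D"
    proof (rule division_ofI)
      show "finite D" by fact
      fix K assume "K \<in> D"
      then obtain l r where lr: "l < r" "K = {l..r}" using \<D>P D(1) by blast
      then show "K \<noteq> {}" "\<exists>a b. K = cbox a b" by (auto intro: cbox_interval[symmetric])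
      show "K \<subseteq> \<Union>D" using \<open>K \<in> D\<close> by blast
      fix L assume "L \<in> D" "K \<noteq> L"
      then have "K \<inter> L = {}" using disj D(1) \<open>K \<in> D\<close> by auto
      then show "interior K \<inter> interior L = {}"
        using interior_subset by blast
    qed auto
    show "\<Union>D \<subseteq> U" using D(1) \<D>U by auto
    show "pairwise disjnt D" using disj D(1) by (auto simp: pairwise_def disjnt_def)
    show "\<exists>l r. l < r \<and> P l r \<and> K = {l..r}" if "K \<in> D" for K
      using \<D>P that D(1) by auto
    have "measure lebesgue (E - \<Union>D) \<le> measure lebesgue ((E - \<Union>\<D>) \<union> (\<Union>\<D> - \<Union>D))"
      using neg U\<D> UD E
      by (intro measure_mono_fmeasurable) (auto simp: negligible_imp_measurable fmeasurable.Un fmeasurable.Diff)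
    also have "\<dots> = measure lebesgue (\<Union>\<D> - \<Union>D)"
      using neg U\<D> UD
      by (subst Un_commute, intro measure_Un_null_set) (auto simp: negligible_iff_null_sets)
    also have "\<dots> = measure lebesgue (\<Union>\<D>) - measure lebesgue (\<Union>D)"
      using D(1) by (intro measurable_measure_Diff U\<D> fmeasurableD[OF UD]) auto
    also have "\<dots> < e" using D(3) by simp
    finally show "measure lebesgue (E - \<Union>D) < e" .
  qed
qed

text \<open>Let \<open>A\<close> consist of low-slope and \<open>B\<close> of high-slope intervals.
  The increments over \<open>A\<close> are those over \<open>B\<close> plus those over the gaps, so
  \<open>q\<close> times the measure of \<open>B\<close> is at most \<open>p\<close> times the
  measure of \<open>A\<close> plus \<open>e\<close>. Both measures lie within \<open>e\<close> of
  that of \<open>E\<close>, and \<open>e\<close> tends to 0.\<close>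

lemma negligible_two_slopes:
  fixes u :: "real \<Rightarrow> real"
  assumes ac: "abs_continuous_on {a..b} u"
    and E: "E \<in> sets lebesgue" "E \<subseteq> {a<..<b}" and pq: "p < q"
    and lo: "\<And>x d. \<lbrakk>x \<in> E; d > 0\<rbrakk>
       \<Longrightarrow> \<exists>l r. l < x \<and> x < r \<and> r - l < d \<and> u r - u l < p * (r - l)"
    and hi: "\<And>x d. \<lbrakk>x \<in> E; d > 0\<rbrakk>
       \<Longrightarrow> \<exists>l r. l < x \<and> x < r \<and> r - l < d \<and> q * (r - l) < u r - u l"
  shows "negligible E"
proof -
  have Em: "E \<in> lmeasurable"
    using E by (metis bounded_Ioo bounded_set_imp_lmeasurable bounded_subset)
  have Km: "measure lebesgue {l..r} = r - l" if "l < r" for l r :: real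
    using that by simp
  have main: "(q - p) * measure lebesgue E \<le> e * (1 + \<bar>p\<bar> + \<bar>q\<bar>)" if e: "e > 0" for e
  proof -
    obtain d0 where d0: "d0 > 0" and
      small0: "\<And>P X. \<lbrakk>P division_of X; X \<subseteq> {a..b}; measure lebesgue X < d0\<rbrakk>
         \<Longrightarrow> (\<Sum>K\<in>P. norm (u (Sup K) - u (Inf K))) < e"
      using abs_continuous_on_division[OF ac e] by blast
    \<comment> \<open>\<open>d0\<close> controls the increments over the gaps, \<open>e\<close> the
      errors in measure. Three quarters of \<open>d\<close> are spent below: on \<open>U\<close> and
      on either covering.\<close>
    define d where "d = min d0 e"
    have d: "d > 0" "d \<le> d0" "d \<le> e" using d0 e by (auto simp: d_def)
    obtain O0 where O0: "open O0" "E \<subseteq> O0" "O0 - E \<in> lmeasurable"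
        "emeasure lebesgue (O0 - E) < ennreal (d/4)"
      using sets_lebesgue_outer_open[OF E(1), of "d/4"] d by auto
    \<comment> \<open>Open, so that short intervals about points of \<open>E\<close> stay inside,
      and barely larger than \<open>E\<close>, so that neither covering can be much larger than
      \<open>E\<close>.\<close>
    define U where "U = O0 \<inter> {a<..<b}"
    have oU: "open U" using O0(1) by (auto simp: U_def)
    have EU: "E \<subseteq> U" using O0(2) E(2) by (auto simp: U_def)
    have Um: "U \<in> lmeasurable"
      unfolding U_def by (rule bounded_set_imp_lmeasurable) (auto simp: O0(1) intro: bounded_subset[of "{a<..<b}"])
    have Uab: "U \<subseteq> {a..b}" by (auto simp: U_def)
    have "measure lebesgue (U - E) \<le> measure lebesgue (O0 - E)"
      using O0 Um Em by (intro measure_mono_fmeasurable) (auto simp: U_def)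
    also have "\<dots> < d/4"
      using O0(3,4) d by (simp add: emeasure_eq_measure2 ennreal_less_iff)
    finally have UE: "measure lebesgue U < measure lebesgue E + d/4"
      using measurable_measure_Diff[OF Um fmeasurableD[OF Em] EU] by simp
    obtain A where A: "A division_of \<Union>A" "\<Union>A \<subseteq> U" and disjA: "pairwise disjnt A" and A34:
        "\<And>K. K \<in> A \<Longrightarrow> \<exists>l r. l < r \<and> (u r - u l < p * (r - l) \<and> {l..r} \<subseteq> U) \<and> K = {l..r}"
        "measure lebesgue (E - \<Union>A) < d/4"
    proof (rule Vitali_finite_division[OF E(1) Um, of "d/4" "\<lambda>l r. u r - u l < p * (r - l) \<and> {l..r} \<subseteq> U"])
      fix x s :: real assume x: "x \<in> E" and s: "s > 0"
      obtain t where t: "t > 0" "ball x t \<subseteq> U"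
        using oU x EU by (meson openE subsetD)
      obtain l r where lr: "l < x" "x < r" "r - l < min s t" "u r - u l < p * (r - l)"
        using lo[OF x, of "min s t"] s t by auto
      moreover have "{l..r} \<subseteq> ball x t" using lr by (auto simp: dist_real_def)
      ultimately show "\<exists>l r. l < x \<and> x < r \<and> r - l < s \<and> u r - u l < p * (r - l) \<and> {l..r} \<subseteq> U"
        using t(2) by (intro exI[of _ l] exI[of _ r]) auto
    qed (use d in auto)
    note A = A A34
    \<comment> \<open>Only at an interior point of a member of \<open>A\<close> do all short enough
      straddling intervals stay inside that member. The end points lost here are finitely
      many.\<close>
    define E2 where "E2 = E \<inter> (\<Union>K\<in>A. interior K)"
    have E2m: "E2 \<in> lmeasurable"
    proof -
      have "(\<Union>K\<in>A. interior K) \<in> sets borel" by (intro borel_open open_UN ballI open_interior)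
      then show ?thesis unfolding E2_def by (intro fmeasurable_Int_fmeasurable[OF Em]) simp
    qed
    obtain B where B: "B division_of \<Union>B" "\<Union>B \<subseteq> U"
        "\<And>K. K \<in> B \<Longrightarrow> \<exists>l r. l < r \<and> (q * (r - l) < u r - u l \<and> (\<exists>I\<in>A. {l..r} \<subseteq> I)) \<and> K = {l..r}"
        "measure lebesgue (E2 - \<Union>B) < d/4"
    proof (rule Vitali_finite_division[OF fmeasurableD[OF E2m] Um, of "d/4" "\<lambda>l r. q * (r - l) < u r - u l \<and> (\<exists>I\<in>A. {l..r} \<subseteq> I)"])
      fix x s :: real assume x: "x \<in> E2" and s: "s > 0"
      then obtain I where I: "I \<in> A" "x \<in> interior I" and xE: "x \<in> E" by (auto simp: E2_def)
      obtain t where t: "t > 0" "ball x t \<subseteq> interior I"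
        using I(2) by (meson openE open_interior)
      obtain l r where lr: "l < x" "x < r" "r - l < min s t" "q * (r - l) < u r - u l"
        using hi[OF xE, of "min s t"] s t by auto
      moreover have "{l..r} \<subseteq> ball x t" using lr by (auto simp: dist_real_def)
      then have "{l..r} \<subseteq> I" using t(2) interior_subset by blast
      ultimately show "\<exists>l r. l < x \<and> x < r \<and> r - l < s \<and> q * (r - l) < u r - u l \<and> (\<exists>I\<in>A. {l..r} \<subseteq> I)"
        using I(1) by (intro exI[of _ l] exI[of _ r]) auto
    next
      fix l r assume "q * (r - l) < u r - u l \<and> (\<exists>I\<in>A. {l..r} \<subseteq> I)"
      then show "{l..r} \<subseteq> U" using A(2) by blast
    qed (use d in auto)
    have AU: "\<Union>A \<in> lmeasurable" and BU: "\<Union>B \<in> lmeasurable"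
      using A(1) B(1) lmeasurable_division by auto
    have mA: "measure lebesgue (\<Union>A) \<le> measure lebesgue E + d/4"
      using measure_mono_fmeasurable[OF A(2) fmeasurableD[OF AU] Um] UE by simp
    have "negligible (\<Union>A - (\<Union>K\<in>A. interior K))"
    proof (rule negligible_subset)
      show "negligible (\<Union>K\<in>A. {Inf K, Sup K})"
        using division_ofD(1)[OF A(1)] by (intro negligible_finite) auto
      show "\<Union>A - (\<Union>K\<in>A. interior K) \<subseteq> (\<Union>K\<in>A. {Inf K, Sup K})"
      proof
        fix x assume x: "x \<in> \<Union>A - (\<Union>K\<in>A. interior K)"
        then obtain K where K: "K \<in> A" "x \<in> K" "x \<notin> interior K" by auto
        from A(3)[OF K(1)] K(2,3) have "x \<in> {Inf K, Sup K}" by auto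
        then show "x \<in> (\<Union>K\<in>A. {Inf K, Sup K})" using K(1) by blast
      qed
    qed
    then have negA: "\<Union>A - (\<Union>K\<in>A. interior K) \<in> null_sets lebesgue"
      by (simp add: negligible_iff_null_sets)
    have "measure lebesgue E \<le> measure lebesgue (((E - \<Union>A) \<union> (E2 - \<Union>B)) \<union> \<Union>B \<union> (\<Union>A - (\<Union>K\<in>A. interior K)))"
      using Em AU BU E2m negA by (intro measure_mono_fmeasurable) 
        (auto simp: E2_def fmeasurable.Un fmeasurable.Diff null_setsD2 fmeasurableI_null_sets)
    also have "\<dots> = measure lebesgue ((E - \<Union>A) \<union> (E2 - \<Union>B) \<union> \<Union>B)"
      using Em AU BU E2m negA by (intro measure_Un_null_set) (auto intro!: fmeasurableD)
    also have "\<dots> \<le> measure lebesgue (E - \<Union>A) + measure lebesgue (E2 - \<Union>B) + measure lebesgue (\<Union>B)"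
      using Em AU BU E2m
      by (intro order_trans[OF measure_Un_le] add_mono order_refl) (auto intro!: fmeasurableD)
    finally have mB: "measure lebesgue E \<le> measure lebesgue (\<Union>B) + d/2"
      using A(4) B(4) by linarith
    have inA: "\<exists>I\<in>A. K \<subseteq> I" if "K \<in> B" for K using B(3)[OF that] by blast
    have BA: "\<Union>B \<subseteq> \<Union>A" using inA by blast
  
    \<comment> \<open>The members of \<open>B\<close> inside \<open>I\<close> are completed to a
      division of \<open>I\<close>; the added intervals are the gaps.\<close>
    have "\<exists>R. R division_of I \<and> {K\<in>B. K \<subseteq> I} \<subseteq> R" if I: "I \<in> A" for I
    proof -
      obtain l r where lr: "I = {l..r}" using A(3)[OF I] by blast
      let ?B = "{K\<in>B. K \<subseteq> I}"
      have "?B division_of \<Union>?B" using division_of_subset[OF B(1), of ?B] by auto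
      moreover have "\<Union>?B \<subseteq> cbox l r" using lr by auto
      ultimately obtain R where "?B \<subseteq> R" "R division_of cbox l r"
        by (rule partial_division_extend_interval)
      then show ?thesis using lr by auto
    qed
    then obtain R where R: "\<And>I. I \<in> A \<Longrightarrow> R I division_of I" "\<And>I. I \<in> A \<Longrightarrow> {K\<in>B. K \<subseteq> I} \<subseteq> R I"
      by metis
    define C where "C = (\<Union>I\<in>A. R I)"
    have CA: "C division_of \<Union>A"
    proof (rule division_ofI)
      show "finite C" using division_ofD(1)[OF A(1)] division_ofD(1)[OF R(1)] by (auto simp: C_def)
      fix K assume "K \<in> C"
      then obtain I where I: "I \<in> A" "K \<in> R I" by (auto simp: C_def)
      show "K \<subseteq> \<Union>A" "K \<noteq> {}" "\<exists>a b. K = cbox a b"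
        using division_ofD(2-4)[OF R(1)[OF I(1)] I(2)] I(1) by auto
      fix L assume "L \<in> C" and KL: "K \<noteq> L"
      then obtain J where J: "J \<in> A" "L \<in> R J" by (auto simp: C_def)
      show "interior K \<inter> interior L = {}"
      proof (cases "I = J")
        case True
        then show ?thesis using division_ofD(5)[OF R(1)[OF I(1)] I(2) _ KL] J by simp
      next
        case False
        then have "I \<inter> J = {}" using disjA I(1) J(1) by (auto simp: pairwise_def disjnt_def)
        then show ?thesis
          using division_ofD(2)[OF R(1)[OF I(1)] I(2)] division_ofD(2)[OF R(1)[OF J(1)] J(2)]
            interior_subset by blast
      qed
    next
      show "\<Union>C = \<Union>A" using division_ofD(6)[OF R(1)] unfolding C_def by blast
    qed
    have BC: "B \<subseteq> C"
    proof
      fix K assume "K \<in> B"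
      with inA obtain I where "I \<in> A" "K \<subseteq> I" by blast
      with R(2)[OF this(1)] \<open>K \<in> B\<close> show "K \<in> C" by (auto simp: C_def)
    qed
    have fC: "finite C" using division_ofD(1)[OF CA] .
    have rest: "(C - B) division_of \<Union>(C - B)"
      using division_of_subset[of C "C - B"] CA division_ofD(6)[OF CA] by auto
    have sC: "(\<Sum>K\<in>C. measure lebesgue K) = measure lebesgue (\<Union>A)"
      using content_division[OF CA] .
    have sB: "(\<Sum>K\<in>B. measure lebesgue K) = measure lebesgue (\<Union>B)"
      using content_division[OF B(1)] .
    have "measure lebesgue (\<Union>(C - B)) = (\<Sum>K\<in>C - B. measure lebesgue K)"
      using content_division[OF rest] by simp
    also have "\<dots> = measure lebesgue (\<Union>A) - measure lebesgue (\<Union>B)"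
      unfolding sC[symmetric] sB[symmetric] using sum_diff[OF fC BC] .
    \<comment> \<open>The union of \<open>A\<close> exceeds \<open>E\<close> in measure by at most
      \<open>d/4\<close>, and that of \<open>B\<close> falls short of it by at most
      \<open>d/2\<close>.\<close>
    also have "\<dots> < d0" using mA mB d by simp
    finally have "measure lebesgue (\<Union>(C - B)) < d0" .
    moreover have "\<Union>(C - B) \<subseteq> {a..b}" using division_ofD(2)[OF CA] A(2) Uab by blast
    ultimately have "(\<Sum>K\<in>C - B. norm (u (Sup K) - u (Inf K))) < e"
      by (intro small0[OF rest])
    then have gap: "\<bar>\<Sum>K\<in>C - B. u (Sup K) - u (Inf K)\<bar> < e"
      unfolding real_norm_def by (rule le_less_trans[OF sum_abs])
    have incA: "(\<Sum>K\<in>C. u (Sup K) - u (Inf K)) = (\<Sum>K\<in>A. u (Sup K) - u (Inf K))"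
    proof -
      have "(\<Sum>K\<in>C. u (Sup K) - u (Inf K)) = (\<Sum>I\<in>A. \<Sum>K\<in>R I. u (Sup K) - u (Inf K))"
        unfolding C_def
      proof (rule sum.UNION_disjoint)
        show "finite A" "\<forall>I\<in>A. finite (R I)"
          using division_ofD(1)[OF A(1)] division_ofD(1)[OF R(1)] by auto
        \<comment> \<open>A division may contain degenerate intervals, so disjoint interiors of
          \<open>I\<close> and \<open>J\<close> would not exclude a common member; disjointness as
          sets does.\<close>
        show "\<forall>I\<in>A. \<forall>J\<in>A. I \<noteq> J \<longrightarrow> R I \<inter> R J = {}"
        proof (intro ballI impI, rule ccontr)
          fix I J assume IJ: "I \<in> A" "J \<in> A" "I \<noteq> J" "R I \<inter> R J \<noteq> {}"
          then obtain K where "K \<in> R I" "K \<in> R J" by auto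
          then have "K \<subseteq> I \<inter> J" "K \<noteq> {}"
            using division_ofD(2,3)[OF R(1)] IJ by blast+
          moreover have "I \<inter> J = {}" using disjA IJ by (auto simp: pairwise_def disjnt_def)
          ultimately show False by simp
        qed
      qed
      also have "\<dots> = (\<Sum>I\<in>A. u (Sup I) - u (Inf I))"
      proof (rule sum.cong[OF refl])
        fix I assume I: "I \<in> A"
        then obtain l r where lr: "l < r" "I = {l..r}" using A(3) by blast
        then show "(\<Sum>K\<in>R I. u (Sup K) - u (Inf K)) = u (Sup I) - u (Inf I)"
          using sum_increments_division[of "R I" l r u] R(1)[OF I] by simp
      qed
      finally show ?thesis .
    qed
    have "(\<Sum>K\<in>A. u (Sup K) - u (Inf K)) \<le> (\<Sum>K\<in>A. p * measure lebesgue K)"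
      by (rule sum_mono) (use A(3) in force)
    also have "\<dots> = p * measure lebesgue (\<Union>A)"
      using content_division[OF A(1)] by (simp add: sum_distrib_left[symmetric])
    finally have upA: "(\<Sum>K\<in>A. u (Sup K) - u (Inf K)) \<le> p * measure lebesgue (\<Union>A)" .
    have "(\<Sum>K\<in>B. q * measure lebesgue K) \<le> (\<Sum>K\<in>B. u (Sup K) - u (Inf K))"
      by (rule sum_mono) (use B(3) in force)
    then have loB: "q * measure lebesgue (\<Union>B) \<le> (\<Sum>K\<in>B. u (Sup K) - u (Inf K))"
      using sB by (simp add: sum_distrib_left[symmetric])
    have "(\<Sum>K\<in>C. u (Sup K) - u (Inf K))
        = (\<Sum>K\<in>C - B. u (Sup K) - u (Inf K)) + (\<Sum>K\<in>B. u (Sup K) - u (Inf K))"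
      using sum.subset_diff[OF BC fC] .
    with gap incA upA loB have 1: "q * measure lebesgue (\<Union>B) \<le> p * measure lebesgue (\<Union>A) + e" by linarith
    have mBA: "measure lebesgue (\<Union>B) \<le> measure lebesgue (\<Union>A)"
      using measure_mono_fmeasurable[OF BA fmeasurableD[OF BU] AU] .
    have "\<bar>measure lebesgue (\<Union>A) - measure lebesgue E\<bar> \<le> e" "\<bar>measure lebesgue (\<Union>B) - measure lebesgue E\<bar> \<le> e"
      using mA mB mBA d by linarith+
    then have "\<bar>p * (measure lebesgue (\<Union>A) - measure lebesgue E)\<bar> \<le> \<bar>p\<bar> * e"
       "\<bar>q * (measure lebesgue (\<Union>B) - measure lebesgue E)\<bar> \<le> \<bar>q\<bar> * e"
      by (auto simp: abs_mult intro!: mult_left_mono)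
    with 1 show ?thesis by (simp add: algebra_simps)
  qed
  have "(q - p) * measure lebesgue E \<le> 0"
  proof (rule field_le_epsilon)
    fix e :: real assume "e > 0"
    moreover have "1 + \<bar>p\<bar> + \<bar>q\<bar> > 0" by simp
    ultimately have "e / (1 + \<bar>p\<bar> + \<bar>q\<bar>) > 0" "e / (1 + \<bar>p\<bar> + \<bar>q\<bar>) * (1 + \<bar>p\<bar> + \<bar>q\<bar>) = e"
      by (auto simp del: zero_less_divide_iff intro: divide_pos_pos)
    with main show "(q - p) * measure lebesgue E \<le> 0 + e" by (metis add_0)
  qed
  then have "measure lebesgue E = 0"
    using pq measure_nonneg[of lebesgue E] by (smt (verit) mult_pos_pos)
  then show ?thesis
    using Em negligible_iff_measure by blast
qed

text \<open>If a piece \<open>F\<close> of \<open>E\<close> had positive measure, disjoint intervals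
  with slopes above \<open>k\<close> in absolute value would cover more than half of it, and their
  increments would total more than \<open>k\<close> times half its measure. For large
  \<open>k\<close> this contradicts absolute continuity, which bounds the total by 1 on sets of
  measure below \<open>d0\<close>; hence the windows of length \<open>d0/2\<close>.\<close>

lemma negligible_unbounded_slopes:
  fixes u :: "real \<Rightarrow> real"
  assumes ac: "abs_continuous_on {a..b} u"
    and E: "E \<in> sets lebesgue" "E \<subseteq> {a<..<b}"
    and unb: "\<And>x d k. \<lbrakk>x \<in> E; d > 0\<rbrakk>
       \<Longrightarrow> \<exists>l r. l < x \<and> x < r \<and> r - l < d \<and> k * (r - l) < \<bar>u r - u l\<bar>"
  shows "negligible E"
proof -
  obtain d0 where d0: "d0 > 0" and
    small0: "\<And>P X. \<lbrakk>P division_of X; X \<subseteq> {a..b}; measure lebesgue X < d0\<rbrakk>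
       \<Longrightarrow> (\<Sum>K\<in>P. norm (u (Sup K) - u (Inf K))) < 1"
    using abs_continuous_on_division[OF ac zero_less_one] by blast
  have loc: "negligible (E \<inter> {c<..<c + d0/2})" for c
  proof (rule ccontr)
    define U where "U = {a<..<b} \<inter> {c<..<c + d0/2}"
    define F where "F = E \<inter> {c<..<c + d0/2}"
    have Um: "U \<in> lmeasurable"
      unfolding U_def by (intro bounded_set_imp_lmeasurable bounded_Int) auto
    have Fs: "F \<in> sets lebesgue" using E by (auto simp: F_def)
    have FU: "F \<subseteq> U" using E by (auto simp: F_def U_def)
    have Fm: "F \<in> lmeasurable" using fmeasurableI2[OF Um FU Fs] .
    have mU: "measure lebesgue U \<le> d0/2"
    proof -
      have "measure lebesgue U \<le> measure lebesgue {c<..<c + d0/2}"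
        using Um by (intro measure_mono_fmeasurable) (auto simp: U_def)
      then show ?thesis using d0 by simp
    qed
    assume "\<not> negligible (E \<inter> {c<..<c + d0/2})"
    then have m: "measure lebesgue F > 0"
      using Fm F_def by (metis negligible_iff_measure measure_nonneg order_less_le)
    \<comment> \<open>Makes \<open>k * (measure lebesgue F / 2)\<close> equal to 1, the bound on the
      increments.\<close>
    define k where "k = 2 / measure lebesgue F"
    have k: "k > 0" using m by (simp add: k_def)
    obtain D where D: "D division_of \<Union>D" "\<Union>D \<subseteq> U" "pairwise disjnt D" and
        DK: "\<And>K. K \<in> D \<Longrightarrow> \<exists>l r. l < r \<and> (k * (r - l) < \<bar>u r - u l\<bar> \<and> {l..r} \<subseteq> U) \<and> K = {l..r}"
        and mD: "measure lebesgue (F - \<Union>D) < measure lebesgue F / 2"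
    proof (rule Vitali_finite_division[OF Fs Um, of "measure lebesgue F / 2"
          "\<lambda>l r. k * (r - l) < \<bar>u r - u l\<bar> \<and> {l..r} \<subseteq> U"])
      fix x s :: real assume x: "x \<in> F" and s: "s > 0"
      have "open U" by (auto simp: U_def)
      then obtain t where t: "t > 0" "ball x t \<subseteq> U"
        using x FU by (meson openE subsetD)
      obtain l r where lr: "l < x" "x < r" "r - l < min s t" "k * (r - l) < \<bar>u r - u l\<bar>"
        using unb[of x "min s t" k] x s t by (auto simp: F_def)
      moreover have "{l..r} \<subseteq> ball x t" using lr by (auto simp: dist_real_def)
      ultimately show "\<exists>l r. l < x \<and> x < r \<and> r - l < s \<and> k * (r - l) < \<bar>u r - u l\<bar> \<and> {l..r} \<subseteq> U"
        using t(2) by (intro exI[of _ l] exI[of _ r]) auto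
    qed (use m in auto)
    have DU: "\<Union>D \<in> lmeasurable" using D(1) lmeasurable_division by auto
    have "measure lebesgue (\<Union>D) \<le> measure lebesgue U"
      using measure_mono_fmeasurable[OF D(2) fmeasurableD[OF DU] Um] .
    then have 1: "(\<Sum>K\<in>D. norm (u (Sup K) - u (Inf K))) < 1"
      using mU d0 D(2) by (intro small0[OF D(1)]) (auto simp: U_def)
    have "k * measure lebesgue (\<Union>D) = (\<Sum>K\<in>D. k * measure lebesgue K)"
      using content_division[OF D(1)] by (simp add: sum_distrib_left[symmetric])
    also have "\<dots> \<le> (\<Sum>K\<in>D. norm (u (Sup K) - u (Inf K)))"
      by (rule sum_mono) (use DK in force)
    finally have 2: "k * measure lebesgue (\<Union>D) < 1" using 1 by simp
    have "measure lebesgue F \<le> measure lebesgue ((F - \<Union>D) \<union> \<Union>D)"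
      using Fm DU by (intro measure_mono_fmeasurable) (auto simp: fmeasurable.Un fmeasurable.Diff)
    also have "\<dots> \<le> measure lebesgue (F - \<Union>D) + measure lebesgue (\<Union>D)"
      using Fm DU by (intro measure_Un_le) (auto intro!: fmeasurableD)
    finally have "measure lebesgue F / 2 < measure lebesgue (\<Union>D)" using mD by simp
    then have "k * (measure lebesgue F / 2) < k * measure lebesgue (\<Union>D)"
      using k by simp
    then show False using 2 m by (simp add: k_def)
  qed
  have "negligible (\<Union>c\<in>\<rat>. E \<inter> {c<..<c + d0/2})"
    by (intro negligible_countable_Union) (auto simp: loc countable_rat)
  moreover have "E \<subseteq> (\<Union>c\<in>\<rat>. E \<inter> {c<..<c + d0/2})"
  proof
    fix x assume "x \<in> E"
    obtain c where "c \<in> \<rat>" "x - d0/2 < c" "c < x" using Rats_dense_in_real[of "x - d0/2" x] d0 by auto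
    then show "x \<in> (\<Union>c\<in>\<rat>. E \<inter> {c<..<c + d0/2})" using \<open>x \<in> E\<close> by (intro UN_I[of c]) auto
  qed
  ultimately show ?thesis by (rule negligible_subset)
qed

section \<open>Differentiability almost everywhere and the fundamental theorem\<close>

lemma abs_continuous_on_imp_continuous_on:
  fixes u :: "real \<Rightarrow> 'a::real_normed_vector"
  assumes ac: "abs_continuous_on {a..b} u"
  shows "continuous_on {a..b} u"
  unfolding continuous_on_iff
proof (intro ballI allI impI)
  fix x e :: real assume x: "x \<in> {a..b}" and e: "e > 0"
  obtain d where d: "d > 0" and
    small: "\<And>P X. \<lbrakk>P division_of X; X \<subseteq> {a..b}; measure lebesgue X < d\<rbrakk>
       \<Longrightarrow> (\<Sum>K\<in>P. norm (u (Sup K) - u (Inf K))) < e"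
    using abs_continuous_on_division[OF ac e] by blast
  have *: "norm (u r - u l) < e" if "l \<in> {a..b}" "r \<in> {a..b}" "l \<le> r" "r - l < d" for l r
    using small[OF division_of_self[of l r]] that by auto
  show "\<exists>d>0. \<forall>y\<in>{a..b}. dist y x < d \<longrightarrow> dist (u y) (u x) < e"
  proof (intro exI[of _ d] conjI ballI impI d)
    fix y assume y: "y \<in> {a..b}" "dist y x < d"
    show "dist (u y) (u x) < e"
      using *[of x y] *[of y x] x y by (cases "x \<le> y") (auto simp: dist_norm norm_minus_commute)
  qed
qed

text \<open>Whatever \<open>P n\<close> is, the points that it straddles form a union of open
  intervals; the whole set is a countable intersection of such unions.\<close>

lemma borel_straddled_points:
  fixes P :: "nat \<Rightarrow> real \<Rightarrow> real \<Rightarrow> bool"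
  shows "{x. \<forall>n. \<exists>l r. l < x \<and> x < r \<and> P n l r} \<in> sets borel"
proof -
  have "{x. \<forall>n. \<exists>l r. l < x \<and> x < r \<and> P n l r} = (\<Inter>n. \<Union>(l,r)\<in>{(l,r). P n l r}. {l<..<r})"
    by (simp add: set_eq_iff) blast
  moreover have "(\<Union>(l,r)\<in>{(l,r). P n l r}. {l<..<r}) \<in> sets borel" for n
    by (intro borel_open open_UN) auto
  ultimately show ?thesis by auto
qed

text \<open>The product of the two one-sided filters is the filter of intervals that shrink to
  \<open>x\<close> with \<open>x\<close> strictly inside. Liminf and limsup of the slopes along it
  play the part of Dini derivatives.\<close>

lemma eventually_straddle:
  fixes x :: real
  shows "eventually P (at_left x \<times>\<^sub>F at_right x)
    \<longleftrightarrow> (\<exists>d>0. \<forall>l r. l < x \<longrightarrow> x < r \<longrightarrow> r - l < d \<longrightarrow> P (l, r))"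
proof
  assume "eventually P (at_left x \<times>\<^sub>F at_right x)"
  then obtain Pl Pr where *: "eventually Pl (at_left x)" "eventually Pr (at_right x)"
      "\<And>l r. Pl l \<Longrightarrow> Pr r \<Longrightarrow> P (l, r)"
    unfolding eventually_prod_filter by auto
  obtain c where c: "c < x" "\<And>y. c < y \<Longrightarrow> y < x \<Longrightarrow> Pl y"
    using *(1) unfolding eventually_at_left_field by auto
  obtain e where e: "e > x" "\<And>y. x < y \<Longrightarrow> y < e \<Longrightarrow> Pr y"
    using *(2) unfolding eventually_at_right_field by auto
  show "\<exists>d>0. \<forall>l r. l < x \<longrightarrow> x < r \<longrightarrow> r - l < d \<longrightarrow> P (l, r)"
    using c e by (intro exI[of _ "min (x - c) (e - x)"]) (auto intro!: *(3))
next
  assume "\<exists>d>0. \<forall>l r. l < x \<longrightarrow> x < r \<longrightarrow> r - l < d \<longrightarrow> P (l, r)"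
  then obtain d where d: "d > 0" "\<And>l r. l < x \<Longrightarrow> x < r \<Longrightarrow> r - l < d \<Longrightarrow> P (l, r)" by auto
  show "eventually P (at_left x \<times>\<^sub>F at_right x)"
    unfolding eventually_prod_filter
  proof (intro exI conjI allI impI)
    show "eventually (\<lambda>l. x - d/2 < l \<and> l < x) (at_left x)"
      using d by (auto simp: eventually_at_left_field intro!: exI[of _ "x - d/2"])
    show "eventually (\<lambda>r. x < r \<and> r < x + d/2) (at_right x)"
      using d by (auto simp: eventually_at_right_field intro!: exI[of _ "x + d/2"])
  qed (auto intro!: d(2))
qed

text \<open>One end of the interval is sent to \<open>x\<close> with the other end fixed: by
  continuity the slope becomes the difference quotient at \<open>x\<close>. Strict bounds turn into
  weak ones in this limit, hence the margin \<open>e/2\<close>.\<close>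

lemma tendsto_straddle_imp_has_derivative:
  fixes u :: "real \<Rightarrow> real"
  assumes lim: "((\<lambda>(l, r). (u r - u l) / (r - l)) \<longlongrightarrow> c) (at_left x \<times>\<^sub>F at_right x)"
    and cont: "isCont u x"
  shows "(u has_real_derivative c) (at x)"
  unfolding has_field_derivative_iff LIM_eq
proof (intro allI impI)
  fix e :: real assume e: "e > 0"
  then have "eventually (\<lambda>(l, r). dist ((u r - u l) / (r - l)) c < e/2) (at_left x \<times>\<^sub>F at_right x)"
    using tendstoD[OF lim, of "e/2"] by (simp add: case_prod_beta')
  then obtain d where d: "d > 0" and
    *: "\<And>l r. \<lbrakk>l < x; x < r; r - l < d\<rbrakk> \<Longrightarrow> dist ((u r - u l) / (r - l)) c < e/2"
    unfolding eventually_straddle by auto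
  have **: "dist ((u r - u l) / (r - l)) c < e/2" if "l < x" "x < r" "r - l < d" for l r
    using * that by blast
  have ul: "(u \<longlongrightarrow> u x) (at_left x)" "(u \<longlongrightarrow> u x) (at_right x)"
    using cont by (auto simp: isCont_def filterlim_split_at_real filterlim_at_split)
  show "\<exists>d>0. \<forall>y. y \<noteq> x \<and> norm (y - x) < d \<longrightarrow> norm ((u y - u x) / (y - x) - c) < e"
  proof (intro exI[of _ d] conjI d allI impI)
    fix y assume y: "y \<noteq> x \<and> norm (y - x) < d"
    have "norm ((u y - u x) / (y - x) - c) \<le> e/2"
    proof (cases "x < y")
      case True
      have "((\<lambda>l. norm ((u y - u l) / (y - l) - c)) \<longlongrightarrow> norm ((u y - u x) / (y - x) - c)) (at_left x)"
        using True by (intro tendsto_intros ul) auto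
      moreover have "eventually (\<lambda>l. norm ((u y - u l) / (y - l) - c) \<le> e/2) (at_left x)"
        unfolding eventually_at_left_field
        using y True **[of _ y] by (intro exI[of _ "y - d"]) (force simp: dist_norm)
      ultimately show ?thesis by (rule tendsto_upperbound) simp
    next
      case False
      then have yx: "y < x" using y by auto
      have "((\<lambda>r. norm ((u r - u y) / (r - y) - c)) \<longlongrightarrow> norm ((u x - u y) / (x - y) - c)) (at_right x)"
        using yx by (intro tendsto_intros ul) auto
      moreover have "eventually (\<lambda>r. norm ((u r - u y) / (r - y) - c) \<le> e/2) (at_right x)"
        unfolding eventually_at_right_field
        using y yx **[of y] by (intro exI[of _ "y + d"]) (force simp: dist_norm)
      ultimately have "norm ((u x - u y) / (x - y) - c) \<le> e/2" by (rule tendsto_upperbound) simp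
      moreover have "(u x - u y) / (x - y) = (u y - u x) / (y - x)"
        by (metis minus_diff_eq minus_divide_divide)
      ultimately show ?thesis by simp
    qed
    then show "norm ((u y - u x) / (y - x) - c) < e" using e by simp
  qed
qed

text \<open>\<open>I\<close> holds the points with unbounded slopes along shrinking intervals,
  \<open>E p q\<close> those at which slopes below \<open>p\<close> and slopes above
  \<open>q\<close> both recur. Off \<open>I\<close> and off the countably many \<open>E p q\<close>
  with rational \<open>p < q\<close>, liminf and limsup of the slopes are finite and equal, and
  their common value is the derivative.\<close>

lemma abs_continuous_on_imp_differentiable_real:
  fixes u :: "real \<Rightarrow> real"
  assumes ac: "abs_continuous_on {a..b} u"
  obtains Z where "negligible Z"
    "\<And>x. x \<in> {a<..<b} - Z \<Longrightarrow> \<exists>c. (u has_real_derivative c) (at x)"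
proof -
  define L where "L p n = (\<lambda>l r. r - l < inverse (real (Suc n)) \<and> u r - u l < p * (r - l))" for p n
  define R where "R q n = (\<lambda>l r. r - l < inverse (real (Suc n)) \<and> q * (r - l) < u r - u l)" for q n
  \<comment> \<open>One index bounds the length from above and the slope from below, so a point that
    satisfies this for every \<open>n\<close> has arbitrarily short intervals of arbitrarily large
    slope.\<close>
  define B where "B n = (\<lambda>l r. r - l < inverse (real (Suc n)) \<and> real n * (r - l) < \<bar>u r - u l\<bar>)" for n
  define E where "E p q = {a<..<b} \<inter> {x. \<forall>n. \<exists>l r. l < x \<and> x < r \<and> L p n l r}
      \<inter> {x. \<forall>n. \<exists>l r. l < x \<and> x < r \<and> R q n l r}" for p q
  define I where "I = {a<..<b} \<inter> {x. \<forall>n. \<exists>l r. l < x \<and> x < r \<and> B n l r}"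
  have small: "\<exists>n. inverse (real (Suc n)) < d" if "d > 0" for d
    using that reals_Archimedean by blast
  have Ebor: "E p q \<in> sets borel" for p q
    unfolding E_def by (intro sets.Int borel_straddled_points) auto
  have Ineg: "negligible I"
  proof (rule negligible_unbounded_slopes[OF ac])
    have "I \<in> sets borel" unfolding I_def by (intro sets.Int borel_straddled_points) auto
    then show "I \<in> sets lebesgue" by simp
    show "I \<subseteq> {a<..<b}" by (auto simp: I_def)
    fix x d k :: real assume x: "x \<in> I" and d: "d > 0"
    obtain n1 where n1: "inverse (real (Suc n1)) < d" using small[OF d] by blast
    obtain n2 where n2: "k < real n2" using reals_Archimedean2 by blast
    define n where "n = max n1 n2"
    have n: "inverse (real (Suc n)) < d" "k < real n"
    proof -
      have "inverse (real (Suc n)) \<le> inverse (real (Suc n1))"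
        by (intro le_imp_inverse_le) (auto simp: n_def)
      then show "inverse (real (Suc n)) < d" using n1 by (rule le_less_trans)
      show "k < real n" using n2 by (simp add: n_def)
    qed
    obtain l r where lr: "l < x" "x < r" "r - l < inverse (real (Suc n))" "real n * (r - l) < \<bar>u r - u l\<bar>"
      using x by (force simp: I_def B_def)
    have "k * (r - l) \<le> real n * (r - l)" using n lr by (intro mult_right_mono) auto
    from le_less_trans[OF this lr(4)] less_trans[OF lr(3) n(1)] lr(1,2)
    show "\<exists>l r. l < x \<and> x < r \<and> r - l < d \<and> k * (r - l) < \<bar>u r - u l\<bar>"
      by blast
  qed
  have Eneg: "negligible (E p q)" if pq: "p < q" for p q
  proof (rule negligible_two_slopes[OF ac _ _ pq])
    show "E p q \<in> sets lebesgue" using Ebor by simp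
    show "E p q \<subseteq> {a<..<b}" by (auto simp: E_def)
    fix x d :: real assume x: "x \<in> E p q" and d: "d > 0"
    obtain n where n: "inverse (real (Suc n)) < d" using small[OF d] by blast
    have "\<exists>l r. l < x \<and> x < r \<and> L p n l r" "\<exists>l r. l < x \<and> x < r \<and> R q n l r"
      using x by (auto simp: E_def)
    then show "\<exists>l r. l < x \<and> x < r \<and> r - l < d \<and> u r - u l < p * (r - l)"
        "\<exists>l r. l < x \<and> x < r \<and> r - l < d \<and> q * (r - l) < u r - u l"
      using n unfolding L_def R_def by (meson less_trans)+
  qed
  define Z where "Z = I \<union> (\<Union>(p,q)\<in>{(p,q)\<in>\<rat>\<times>\<rat>. p < q}. E p q)"
  show ?thesis
  proof (rule that)
    have "countable {(p,q)\<in>\<rat>\<times>\<rat>. p < (q::real)}"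
      by (rule countable_subset[of _ "\<rat>\<times>\<rat>"]) (auto simp: countable_rat)
    then show "negligible Z"
      unfolding Z_def by (intro negligible_Un Ineg negligible_countable_Union) (auto simp: Eneg)
    fix x assume x: "x \<in> {a<..<b} - Z"
    define F where "F = at_left x \<times>\<^sub>F at_right x"
    define s where "s = (\<lambda>(l, r). (u r - u l) / (r - l))"
    have F: "F \<noteq> bot" by (simp add: F_def prod_filter_eq_bot)
    have ev: "eventually P F" if "\<And>l r. l < x \<Longrightarrow> x < r \<Longrightarrow> r - l < inverse (real (Suc n)) \<Longrightarrow> P (l, r)" for P n
      unfolding F_def eventually_straddle using that by (intro exI[of _ "inverse (real (Suc n))"]) auto
    have le: "Liminf F (\<lambda>z. ereal (s z)) \<le> Limsup F (\<lambda>z. ereal (s z))" by (rule Liminf_le_Limsup[OF F])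
    have "\<exists>n. \<not> (\<exists>l r. l < x \<and> x < r \<and> B n l r)" using x by (auto simp: Z_def I_def)
    then obtain n where n: "\<And>l r. l < x \<Longrightarrow> x < r \<Longrightarrow> r - l < inverse (real (Suc n)) \<Longrightarrow> \<bar>u r - u l\<bar> \<le> real n * (r - l)"
      unfolding B_def by (meson not_le)
    have bnd: "- real n \<le> s (l, r)" "s (l, r) \<le> real n"
      if lr: "l < x" "x < r" "r - l < inverse (real (Suc n))" for l r
    proof -
      have "\<bar>u r - u l\<bar> \<le> real n * (r - l)" using n lr by auto
      then show "- real n \<le> s (l, r)" "s (l, r) \<le> real n"
        using lr unfolding s_def by (auto simp: pos_le_divide_eq pos_divide_le_eq abs_le_iff)
    qed
    have "ereal (- real n) \<le> Liminf F (\<lambda>z. ereal (s z))"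
      by (intro Liminf_bounded ev[of n]) (use bnd in auto)
    moreover have sup: "Limsup F (\<lambda>z. ereal (s z)) \<le> ereal (real n)"
      by (intro Limsup_bounded ev[of n]) (use bnd in auto)
    ultimately have "\<bar>Liminf F (\<lambda>z. ereal (s z))\<bar> \<noteq> \<infinity>"
      using le by (cases "Liminf F (\<lambda>z. ereal (s z))"; cases "Limsup F (\<lambda>z. ereal (s z))") auto
    then obtain c where c: "Liminf F (\<lambda>z. ereal (s z)) = ereal c" by auto
    have "\<not> Liminf F (\<lambda>z. ereal (s z)) < Limsup F (\<lambda>z. ereal (s z))"
    proof
      assume lt: "Liminf F (\<lambda>z. ereal (s z)) < Limsup F (\<lambda>z. ereal (s z))"
      \<comment> \<open>Two rationals strictly between liminf and limsup select a set
        \<open>E p q\<close>, which \<open>x\<close> avoids.\<close>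
      obtain p' where p': "Liminf F (\<lambda>z. ereal (s z)) < ereal (real_of_rat p')" "ereal (real_of_rat p') < Limsup F (\<lambda>z. ereal (s z))"
        using ereal_dense3[OF lt] by auto
      obtain q' where q': "ereal (real_of_rat p') < ereal (real_of_rat q')" "ereal (real_of_rat q') < Limsup F (\<lambda>z. ereal (s z))"
        using ereal_dense3[OF p'(2)] by auto
      define p q where "p = real_of_rat p'" and "q = real_of_rat q'"
      have pq: "p \<in> \<rat>" "q \<in> \<rat>" "p < q" using q' by (auto simp: p_def q_def)
      have "x \<notin> E p q" using x pq by (auto simp: Z_def)
      then obtain m where "\<not> (\<exists>l r. l < x \<and> x < r \<and> L p m l r) \<or> \<not> (\<exists>l r. l < x \<and> x < r \<and> R q m l r)"
        using x by (auto simp: E_def)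
      then show False
      proof
        assume "\<not> (\<exists>l r. l < x \<and> x < r \<and> L p m l r)"
        then have *: "p * (r - l) \<le> u r - u l" if "l < x" "x < r" "r - l < inverse (real (Suc m))" for l r
          unfolding L_def using that by (meson not_le)
        have "ereal p \<le> Liminf F (\<lambda>z. ereal (s z))"
          by (intro Liminf_bounded ev[of m]) (use * in \<open>auto simp: s_def pos_le_divide_eq\<close>)
        then show False using p' by (simp add: p_def)
      next
        assume "\<not> (\<exists>l r. l < x \<and> x < r \<and> R q m l r)"
        then have *: "u r - u l \<le> q * (r - l)" if "l < x" "x < r" "r - l < inverse (real (Suc m))" for l r
          unfolding R_def using that by (meson not_le)
        have "Limsup F (\<lambda>z. ereal (s z)) \<le> ereal q"
          by (intro Limsup_bounded ev[of m]) (use * in \<open>auto simp: s_def pos_divide_le_eq\<close>)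
        then show False using q' by (simp add: q_def)
      qed
    qed
    with le c have "Limsup F (\<lambda>z. ereal (s z)) = ereal c" by auto
    with c have "((\<lambda>z. ereal (s z)) \<longlongrightarrow> ereal c) F" by (intro Liminf_eq_Limsup F)
    then have "(s \<longlongrightarrow> c) F" by simp
    moreover have "isCont u x"
      using abs_continuous_on_imp_continuous_on[OF ac] x by (auto intro: continuous_on_interior)
    ultimately have "(u has_real_derivative c) (at x)"
      unfolding F_def s_def by (rule tendsto_straddle_imp_has_derivative)
    then show "\<exists>c. (u has_real_derivative c) (at x)" by blast
  qed
qed

text \<open>Coordinates inherit absolute continuity because their increments are bounded by those of
  the path, and the path is differentiable where all its coordinates are. The exceptional set is a
  finite union of null sets.\<close>

lemma abs_continuous_on_imp_differentiable:
  fixes u :: "real \<Rightarrow> 'a::euclidean_space"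
  assumes ac: "abs_continuous_on {a..b} u"
  obtains Z where "negligible Z"
    "\<And>x. x \<in> {a<..<b} - Z \<Longrightarrow> \<exists>c. (u has_vector_derivative c) (at x)"
proof -
  have "abs_continuous_on {a..b} (\<lambda>t. u t \<bullet> i)" if i: "i \<in> Basis" for i
    unfolding abs_continuous_on_def
  proof (intro allI impI)
    fix e :: real assume "e > 0"
    obtain d where d: "d > 0" and d': "\<forall>(m::nat) c d'.
        (\<forall>k<m. c k \<le> d' k \<and> {c k..d' k} \<subseteq> {a..b}) \<and>
        disjoint_family_on (\<lambda>k. {c k<..<d' k}) {..<m} \<and>
        (\<Sum>k<m. d' k - c k) < d
        \<longrightarrow> (\<Sum>k<m. norm (u (d' k) - u (c k))) < e"
      using ac[unfolded abs_continuous_on_def, rule_format, OF \<open>e > 0\<close>] by (elim exE conjE) (rule that)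
    show "\<exists>d>0. \<forall>(m::nat) c d'.
        (\<forall>k<m. c k \<le> d' k \<and> {c k..d' k} \<subseteq> {a..b}) \<and>
        disjoint_family_on (\<lambda>k. {c k<..<d' k}) {..<m} \<and>
        (\<Sum>k<m. d' k - c k) < d
        \<longrightarrow> (\<Sum>k<m. norm (u (d' k) \<bullet> i - u (c k) \<bullet> i)) < e"
    proof (intro exI[of _ d] conjI d allI impI)
      fix m and c d' :: "nat \<Rightarrow> real"
      assume "(\<forall>k<m. c k \<le> d' k \<and> {c k..d' k} \<subseteq> {a..b}) \<and>
        disjoint_family_on (\<lambda>k. {c k<..<d' k}) {..<m} \<and> (\<Sum>k<m. d' k - c k) < d"
      then have "(\<Sum>k<m. norm (u (d' k) - u (c k))) < e" using d' by blast
      moreover have "(\<Sum>k<m. norm (u (d' k) \<bullet> i - u (c k) \<bullet> i)) \<le> (\<Sum>k<m. norm (u (d' k) - u (c k)))"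
        using i by (intro sum_mono) (metis inner_diff_left Basis_le_norm real_norm_def)
      ultimately show "(\<Sum>k<m. norm (u (d' k) \<bullet> i - u (c k) \<bullet> i)) < e" by simp
    qed
  qed
  then have "\<exists>Z. negligible Z \<and> (\<forall>x\<in>{a<..<b} - Z. \<exists>c. ((\<lambda>t. u t \<bullet> i) has_real_derivative c) (at x))"
    if "i \<in> Basis" for i
    using abs_continuous_on_imp_differentiable_real that by metis
  then obtain Z where Z: "\<And>i. i \<in> Basis \<Longrightarrow> negligible (Z i)"
     "\<And>i x. i \<in> Basis \<Longrightarrow> x \<in> {a<..<b} - Z i \<Longrightarrow> \<exists>c. ((\<lambda>t. u t \<bullet> i) has_real_derivative c) (at x)"
    by metis
  show ?thesis
  proof (rule that[of "\<Union>i\<in>Basis. Z i"])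
    show "negligible (\<Union>i\<in>Basis. Z i)" using Z(1) by (intro negligible_Union) auto
    fix x assume x: "x \<in> {a<..<b} - (\<Union>i\<in>Basis. Z i)"
    then have "\<exists>c. ((\<lambda>t. u t \<bullet> i) has_real_derivative c) (at x)" if "i \<in> Basis" for i
      using Z(2)[OF that] that by auto
    then obtain c where c: "\<And>i. i \<in> Basis \<Longrightarrow> ((\<lambda>t. u t \<bullet> i) has_real_derivative c i) (at x)"
      by metis
    have "(u has_vector_derivative (\<Sum>i\<in>Basis. c i *\<^sub>R i)) (at x)"
      unfolding has_vector_derivative_def
    proof (subst has_derivative_componentwise_within, intro ballI)
      fix i :: 'a assume i: "i \<in> Basis"
      have "(\<lambda>h. (h *\<^sub>R (\<Sum>i\<in>Basis. c i *\<^sub>R i)) \<bullet> i) = (*) (c i)"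
        using i by (auto simp: inner_sum_left_Basis mult.commute)
      then show "((\<lambda>t. u t \<bullet> i) has_derivative (\<lambda>h. (h *\<^sub>R (\<Sum>i\<in>Basis. c i *\<^sub>R i)) \<bullet> i)) (at x)"
        using c[OF i] by (simp add: has_field_derivative_def)
    qed
    then show "\<exists>c. (u has_vector_derivative c) (at x)" by blast
  qed
qed

text \<open>Tags outside \<open>Z'\<close> use differentiability: each contributes an error of at
  most \<open>e1\<close> times the length of its interval. Tags in \<open>Z'\<close> contribute only
  increments of \<open>u\<close>, over intervals inside the small open set \<open>U\<close>, where
  absolute continuity controls them. Either group accounts for less than \<open>e/2\<close>.\<close>

lemma abs_continuous_on_fundamental_theorem:
  fixes u :: "real \<Rightarrow> 'a::euclidean_space"
  assumes ac: "abs_continuous_on {a..b} u" and ab: "a \<le> b" and Z: "negligible Z"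
    and der: "\<And>x. x \<in> {a<..<b} - Z \<Longrightarrow> (u has_vector_derivative g x) (at x)"
  shows "(g has_integral u b - u a) {a..b}"
proof -
  \<comment> \<open>The end points join the exceptional set because the derivative is given only in
    the open interval.\<close>
  define Z' where "Z' = Z \<union> {a, b}"
  \<comment> \<open>Setting the integrand to 0 on the null set \<open>Z'\<close> removes its Riemann
    terms there and preserves the integral.\<close>
  define g' where "g' x = (if x \<in> Z' then 0 else g x)" for x
  have Z': "negligible Z'" using Z by (simp add: Z'_def)
  have "(g' has_integral u b - u a) {a..b}"
    unfolding has_integral_real
  proof (intro allI impI)
    fix e :: real assume e: "e > 0"
    \<comment> \<open>The added 1 keeps the denominator positive for \<open>a = b\<close> and makes
      the bound \<open>e1 * (b - a) < e / 2\<close> strict.\<close>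
    define e1 where "e1 = e / (2 * (b - a + 1))"
    have e1: "e1 > 0" "e1 * (b - a) < e / 2"
      using e ab by (auto simp: e1_def field_simps)
    obtain d where d: "d > 0" and
      small: "\<And>P X. \<lbrakk>P division_of X; X \<subseteq> {a..b}; measure lebesgue X < d\<rbrakk>
         \<Longrightarrow> (\<Sum>K\<in>P. norm (u (Sup K) - u (Inf K))) < e / 2"
      using abs_continuous_on_division[OF ac, of "e/2"] e by (metis half_gt_zero)
    obtain U where U: "open U" "Z' \<subseteq> U" "U - Z' \<in> lmeasurable"
        "emeasure lebesgue (U - Z') < ennreal d"
      using sets_lebesgue_outer_open[OF negligible_imp_sets[OF Z'] d] by blast
    have UZ: "U = (U - Z') \<union> Z'" using U(2) by blast
    have Um: "U \<in> lmeasurable"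
      by (subst UZ) (intro fmeasurable.Un U(3) negligible_imp_measurable Z')
    have "measure lebesgue U = measure lebesgue (U - Z')"
      by (subst UZ, rule measure_Un_null_set) (use U(3) Z' in \<open>auto simp: negligible_iff_null_sets\<close>)
    also have "\<dots> < d"
      using U(3,4) d by (simp add: emeasure_eq_measure2 ennreal_less_iff)
    finally have mU: "measure lebesgue U < d" .
    have "\<exists>s>0. \<forall>y. norm (y - x) < s \<longrightarrow> norm (u y - u x - (y - x) *\<^sub>R g' x) \<le> e1 * norm (y - x)"
      if "x \<in> {a..b} - Z'" for x
    proof -
      have "x \<in> {a<..<b} - Z" using that by (auto simp: Z'_def)
      from der[OF this] have "(u has_derivative (\<lambda>h. h *\<^sub>R g' x)) (at x)"
        using that by (simp add: has_vector_derivative_def g'_def)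
      then show ?thesis
        unfolding has_derivative_at_alt using e1(1) by blast
    qed
    then obtain s where s: "\<And>x. x \<in> {a..b} - Z' \<Longrightarrow> s x > 0"
      "\<And>x y. x \<in> {a..b} - Z' \<Longrightarrow> norm (y - x) < s x \<Longrightarrow> norm (u y - u x - (y - x) *\<^sub>R g' x) \<le> e1 * norm (y - x)"
      by metis
    define \<gamma> where "\<gamma> x = (if x \<in> Z' then U else if x \<in> {a..b} then ball x (s x) else UNIV)" for x
    have gauge: "gauge \<gamma>"
      unfolding gauge_def \<gamma>_def using U(1,2) s(1) by auto
    have main: "norm ((\<Sum>(x,K)\<in>p. measure lborel K *\<^sub>R g' x) - (u b - u a)) < e"
      if p: "p tagged_division_of {a..b}" and fine: "\<gamma> fine p" for p
    proof -
      have fin: "finite p" using p by auto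
      have KE: "\<exists>l r. l \<le> r \<and> K = {l..r} \<and> x \<in> {l..r} \<and> {l..r} \<subseteq> {a..b} \<and> {l..r} \<subseteq> \<gamma> x" if "(x, K) \<in> p" for x K
      proof -
        have "x \<in> K" "K \<subseteq> {a..b}" "\<exists>l r. K = cbox l r" "K \<subseteq> \<gamma> x"
          using tagged_division_ofD(2-4)[OF p that] fineD[OF fine that] by auto
        then show ?thesis by (force simp: cbox_interval)
      qed
      \<comment> \<open>Several tags may share a degenerate interval. Passing from tagged intervals
        to intervals is sound for a function that vanishes on all degenerate ones, including the
        empty set, where \<open>Sup\<close> and \<open>Inf\<close> carry no information.\<close>
      define D where "D = (\<lambda>K. if K = {} then 0 else u (Sup K) - u (Inf K))"
      define p1 where "p1 = {(x,K)\<in>p. x \<in> Z'}"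
      have p1p: "p1 \<subseteq> p" by (auto simp: p1_def)
      have tag1: "p1 tagged_division_of \<Union>(snd ` p1)"
      proof -
        have "p tagged_partial_division_of {a..b}" using p by (simp add: tagged_division_of_def)
        then show ?thesis
          by (rule tagged_partial_division_of_Union_self[OF tagged_partial_division_subset[OF _ p1p]])
      qed
      have "(\<Sum>(x,K)\<in>p1. norm (D K)) = (\<Sum>K\<in>snd ` p1. norm (D K))"
        by (rule sum.over_tagged_division_lemma[OF tag1]) (auto simp: D_def content_eq_0)
      also have "\<dots> = (\<Sum>K\<in>snd ` p1. norm (u (Sup K) - u (Inf K)))"
        by (rule sum.cong) (auto simp: D_def p1_def dest: tagged_division_ofD(2)[OF p])
      also have "\<dots> < e / 2"
      proof (rule small[OF division_of_tagged_division[OF tag1]])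
        show "\<Union>(snd ` p1) \<subseteq> {a..b}" using KE p1p by fastforce
        have "\<Union>(snd ` p1) \<subseteq> U" using KE by (fastforce simp: p1_def \<gamma>_def)
        moreover have "\<Union>(snd ` p1) \<in> lmeasurable"
          using division_of_tagged_division[OF tag1] lmeasurable_division by blast
        ultimately show "measure lebesgue (\<Union>(snd ` p1)) < d"
          using measure_mono_fmeasurable[OF _ fmeasurableD Um] mU by (meson le_less_trans)
      qed
      finally have b1: "(\<Sum>(x,K)\<in>p1. norm (D K)) < e / 2" .
      have "(\<Sum>(x,K)\<in>p - p1. norm (measure lborel K *\<^sub>R g' x - D K)) \<le> (\<Sum>(x,K)\<in>p - p1. e1 * measure lborel K)"
      proof (rule sum_mono, clarify)
        fix x K assume xK: "(x, K) \<in> p" "(x, K) \<notin> p1"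
        obtain l r where lr: "l \<le> r" "K = {l..r}" "x \<in> {l..r}" "{l..r} \<subseteq> {a..b}" "{l..r} \<subseteq> \<gamma> x"
          using KE[OF xK(1)] by blast
        have x: "x \<in> {a..b} - Z'" using xK lr(3,4) by (auto simp: p1_def)
        then have "{l..r} \<subseteq> ball x (s x)" using lr(5) by (simp add: \<gamma>_def)
        then have "norm (l - x) < s x" "norm (r - x) < s x"
          using lr(1) by (auto simp: subset_iff dist_norm norm_minus_commute)
        then have l: "norm (u l - u x - (l - x) *\<^sub>R g' x) \<le> e1 * norm (l - x)"
          and r: "norm (u r - u x - (r - x) *\<^sub>R g' x) \<le> e1 * norm (r - x)"
          using s(2)[OF x] by auto
        have "norm (measure lborel K *\<^sub>R g' x - D K)
            = norm ((u l - u x - (l - x) *\<^sub>R g' x) - (u r - u x - (r - x) *\<^sub>R g' x))"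
          using lr by (simp add: D_def algebra_simps)
        also have "\<dots> \<le> e1 * norm (l - x) + e1 * norm (r - x)"
          using norm_triangle_ineq4 l r by (meson add_mono order_trans)
        also have "\<dots> = e1 * measure lborel K"
          using lr by (simp add: algebra_simps)
        finally show "norm (measure lborel K *\<^sub>R g' x - D K) \<le> e1 * measure lborel K" .
      qed
      also have "\<dots> \<le> (\<Sum>(x,K)\<in>p. e1 * measure lborel K)"
        using fin e1(1) by (intro sum_mono2) auto
      also have "\<dots> = e1 * (\<Sum>(x,K)\<in>p. measure lborel K)"
        by (simp add: sum_distrib_left case_prod_beta')
      also have "\<dots> = e1 * (b - a)"
        using additive_content_tagged_division[of p a b] p ab by simp
      finally have b2: "(\<Sum>(x,K)\<in>p - p1. norm (measure lborel K *\<^sub>R g' x - D K)) < e / 2"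
        using e1(2) by simp
      have "(\<Sum>(x,K)\<in>p. measure lborel K *\<^sub>R g' x) - (u b - u a)
          = (\<Sum>(x,K)\<in>p. measure lborel K *\<^sub>R g' x - D K)"
      proof -
        have "(\<Sum>(x,K)\<in>p. D K) = (\<Sum>(x,K)\<in>p. u (Sup K) - u (Inf K))"
          by (rule sum.cong) (auto simp: D_def dest: tagged_division_ofD(2)[OF p])
        then show ?thesis
          using additive_tagged_division_1[OF ab p, of u]
          by (simp add: sum_subtractf case_prod_beta')
      qed
      also have "norm \<dots> \<le> (\<Sum>(x,K)\<in>p. norm (measure lborel K *\<^sub>R g' x - D K))"
        unfolding case_prod_beta' by (rule norm_sum)
      also have "\<dots> = (\<Sum>(x,K)\<in>p - p1. norm (measure lborel K *\<^sub>R g' x - D K)) + (\<Sum>(x,K)\<in>p1. norm (measure lborel K *\<^sub>R g' x - D K))"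
        by (rule sum.subset_diff[OF p1p fin])
      also have "(\<Sum>(x,K)\<in>p1. norm (measure lborel K *\<^sub>R g' x - D K)) = (\<Sum>(x,K)\<in>p1. norm (D K))"
        by (rule sum.cong) (auto simp: p1_def g'_def)
      finally show ?thesis using b1 b2 by simp
    qed
    show "\<exists>\<gamma>. gauge \<gamma> \<and> (\<forall>p. p tagged_division_of {a..b} \<and> \<gamma> fine p \<longrightarrow>
        norm ((\<Sum>(x,K)\<in>p. measure lborel K *\<^sub>R g' x) - (u b - u a)) < e)"
      by (intro exI[of _ \<gamma>] conjI allI impI gauge main) simp_all
  qed
  then show ?thesis
    by (rule has_integral_spike[OF Z', rotated]) (auto simp: g'_def)
qed

section \<open>Paths with square-integrable derivative\<close>

definition L2 :: "real \<Rightarrow> (real \<Rightarrow> 'a::euclidean_space) \<Rightarrow> bool" where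
  "L2 T g \<longleftrightarrow> g \<in> borel_measurable (lebesgue_on {0..T}) \<and>
     integrable (lebesgue_on {0..T}) (\<lambda>t. (norm (g t))\<^sup>2)"

definition L2_sq :: "real \<Rightarrow> (real \<Rightarrow> 'a::euclidean_space) \<Rightarrow> real" where
  "L2_sq T g = integral\<^sup>L (lebesgue_on {0..T}) (\<lambda>t. (norm (g t))\<^sup>2)"

text \<open>The interface through which all paths are handled. The integral clause yields uniform
  bounds and cell averages; the last clause ties \<open>g\<close> to the pointwise derivative in
  \<open>H_norm\<close>. The notion is stable under differences, as distances between paths
  require.\<close>

definition has_L2_derivative :: "real \<Rightarrow> (real \<Rightarrow> 'a::euclidean_space) \<Rightarrow> (real \<Rightarrow> 'a) \<Rightarrow> bool" where
  "has_L2_derivative T \<phi> g \<longleftrightarrow> L2 T g \<and>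
     (\<forall>t\<in>{0..T}. (g has_integral \<phi> t - \<phi> 0) {0..t}) \<and>
     (AE t in lebesgue_on {0..T}. (\<phi> has_vector_derivative g t) (at t within {0..T}))"

lemma L2_sq_nonneg: "L2_sq T g \<ge> 0"
  by (simp add: L2_sq_def)

lemma norm_diff_sq_le: "(norm (a - b))\<^sup>2 \<le> 2 * (norm a)\<^sup>2 + 2 * (norm b)\<^sup>2"
  for a b :: "'a::real_inner"
proof -
  have "(norm (a - b))\<^sup>2 + (norm (a + b))\<^sup>2 = 2 * (norm a)\<^sup>2 + 2 * (norm b)\<^sup>2"
    by (simp add: power2_norm_eq_inner algebra_simps inner_commute)
  then show ?thesis by (smt (verit) zero_le_power2)
qed

lemma finite_measure_lebesgue_on_Icc: "finite_measure (lebesgue_on {a..b::real})"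
  by (simp add: finite_measure_lebesgue_on)

lemma L2_diff:
  assumes "L2 T a" "L2 T b"
  shows "L2 T (\<lambda>t. a t - b t)"
proof -
  have m: "(\<lambda>t. a t - b t) \<in> borel_measurable (lebesgue_on {0..T})"
    using assms by (auto simp: L2_def)
  moreover have "integrable (lebesgue_on {0..T}) (\<lambda>t. (norm (a t - b t))\<^sup>2)"
  proof (rule Bochner_Integration.integrable_bound)
    show "integrable (lebesgue_on {0..T}) (\<lambda>t. 2 * (norm (a t))\<^sup>2 + 2 * (norm (b t))\<^sup>2)"
      using assms by (auto simp: L2_def)
    show "(\<lambda>t. (norm (a t - b t))\<^sup>2) \<in> borel_measurable (lebesgue_on {0..T})"
      using m by simp
  qed (use norm_diff_sq_le[of "a _" "b _"] in auto)
  ultimately show ?thesis by (simp add: L2_def)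
qed

lemma L2_norm_integrable:
  assumes "L2 T g"
  shows "integrable (lebesgue_on {0..T}) (\<lambda>t. norm (g t))"
proof -
  interpret finite_measure "lebesgue_on {0..T}" by (rule finite_measure_lebesgue_on_Icc)
  show ?thesis
  proof (rule Bochner_Integration.integrable_bound)
    show "integrable (lebesgue_on {0..T}) (\<lambda>t. 1 + (norm (g t))\<^sup>2)"
      using assms by (auto simp: L2_def)
    have "norm x \<le> 1 + (norm x)\<^sup>2" for x :: 'a
      using zero_le_power2[of "norm x - 1"] by (simp add: power2_eq_square algebra_simps) (smt (verit) norm_ge_zero)
    then show "AE t in lebesgue_on {0..T}. norm (norm (g t)) \<le> norm (1 + (norm (g t))\<^sup>2)"
      by (auto simp: abs_of_nonneg)
  qed (use assms in \<open>auto simp: L2_def\<close>)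
qed

lemma L2_integrable: "L2 T g \<Longrightarrow> integrable (lebesgue_on {0..T}) g"
  using L2_norm_integrable[of T g] by (subst integrable_norm_iff[symmetric]) (auto simp: L2_def)

lemma L2_absolutely_integrable: "L2 T g \<Longrightarrow> g absolutely_integrable_on {0..T}"
  using L2_norm_integrable[of T g] by (auto simp: absolutely_integrable_measurable L2_def o_def)

lemma AE_lebesgue_on_iff_negligible:
  assumes "S \<in> sets lebesgue"
  shows "(AE t in lebesgue_on S. P t) \<longleftrightarrow> (\<exists>Z. negligible Z \<and> (\<forall>t\<in>S - Z. P t))"
proof -
  have "(AE t in lebesgue_on S. P t) \<longleftrightarrow> (AE t in lebesgue. t \<in> S \<longrightarrow> P t)"
    using assms by (subst AE_restrict_space_iff) auto
  also have "\<dots> \<longleftrightarrow> (\<exists>Z. negligible Z \<and> (\<forall>t\<in>S - Z. P t))"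
    unfolding eventually_ae_filter negligible_iff_null_sets
    by (auto intro: null_sets_completion_subset)
  finally show ?thesis .
qed

text \<open>Lebesgue measure is complete, so even measurability passes to \<open>h\<close>. This
  serves \<open>path_deriv\<close>, which is determined only almost everywhere.\<close>

lemma L2_cong_AE:
  assumes g: "L2 T g" and eq: "AE t in lebesgue_on {0..T}. g t = h t"
  shows "L2 T h" "L2_sq T h = L2_sq T g"
proof -
  let ?M = "lebesgue_on {0..T}"
  have eq': "AE t in lebesgue. indicat_real {0..T} t *\<^sub>R g t = indicat_real {0..T} t *\<^sub>R h t"
    using eq by (subst (asm) AE_restrict_space_iff) (auto elim!: eventually_mono simp: indicator_def)
  have "h \<in> borel_measurable ?M"
    using borel_measurable_AE[OF _ eq'] g by (simp add: L2_def borel_measurable_restrict_space_iff)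
  then have m: "h \<in> borel_measurable ?M" "g \<in> borel_measurable ?M" using g by (auto simp: L2_def)
  have eq2: "AE t in ?M. (norm (g t))\<^sup>2 = (norm (h t))\<^sup>2" using eq by eventually_elim simp
  have "integrable ?M (\<lambda>t. (norm (h t))\<^sup>2) \<longleftrightarrow> integrable ?M (\<lambda>t. (norm (g t))\<^sup>2)"
    using m eq2 by (intro integrable_cong_AE) (auto elim: eventually_mono)
  then show "L2 T h" using g m by (simp add: L2_def)
  show "L2_sq T h = L2_sq T g"
    unfolding L2_sq_def using m eq2 by (intro integral_cong_AE) (auto elim: eventually_mono)
qed

lemma path_deriv_AE_eq:
  assumes T: "T > 0" and p: "has_L2_derivative T \<phi> g"
  shows "AE t in lebesgue_on {0..T}. g t = path_deriv T \<phi> t"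
proof -
  have "AE t in lebesgue_on {0..T}. t \<in> {0..T}"
    by (simp add: AE_lebesgue_on_iff_negligible) (rule exI[of _ "{}"], simp)
  moreover have "AE t in lebesgue_on {0..T}. (\<phi> has_vector_derivative g t) (at t within {0..T})"
    using p by (simp add: has_L2_derivative_def)
  ultimately show ?thesis
  proof eventually_elim
    case (elim t)
    then show ?case
      using vector_derivative_within_cbox[of 0 T t \<phi> "g t"] T by (simp add: path_deriv_def)
  qed
qed

text \<open>Any \<open>g\<close> that represents the derivative computes the norm, in particular the
  step function of slopes of a piecewise linear path.\<close>

lemma H_inner_eq:
  assumes T: "T > 0" and p: "has_L2_derivative T \<phi> g"
  shows "H_inner T \<phi> \<phi> = (norm (\<phi> 0))\<^sup>2 + L2_sq T g"
proof -
  have "L2 T g" using p by (simp add: has_L2_derivative_def)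
  note L2_cong_AE(2)[OF this path_deriv_AE_eq[OF T p]]
  moreover have "(LINT t:{0..T}|lebesgue. path_deriv T \<phi> t \<bullet> path_deriv T \<phi> t) = L2_sq T (path_deriv T \<phi>)"
    by (simp add: L2_sq_def set_lebesgue_integral_def integral_restrict_space power2_norm_eq_inner)
  ultimately show ?thesis by (simp add: H_inner_def power2_norm_eq_inner)
qed

text \<open>Differentiability almost everywhere shows that the choice made in
  \<open>path_deriv\<close> is the derivative off a null set; the fundamental theorem, applied on
  every initial interval, then gives the integral clause.\<close>

lemma H_space_has_L2_derivative:
  assumes T: "T > 0" and \<phi>: "\<phi> \<in> H_space T"
  shows "has_L2_derivative T \<phi> (path_deriv T \<phi>)"
proof -
  have ac: "abs_continuous_on {0..T} \<phi>" using \<phi> by (simp add: H_space_def)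
  have L2: "L2 T (path_deriv T \<phi>)"
    using \<phi> unfolding L2_def H_space_def set_borel_measurable_def set_integrable_def
    by (auto simp: borel_measurable_restrict_space_iff integrable_restrict_space)
  obtain Z where Z: "negligible Z" "\<And>x. x \<in> {0<..<T} - Z \<Longrightarrow> \<exists>c. (\<phi> has_vector_derivative c) (at x)"
    using abs_continuous_on_imp_differentiable[OF ac] by blast
  have der: "(\<phi> has_vector_derivative path_deriv T \<phi> x) (at x)" if x: "x \<in> {0<..<T} - Z" for x
  proof -
    obtain c where c: "(\<phi> has_vector_derivative c) (at x)" using Z(2)[OF x] by blast
    have "path_deriv T \<phi> x = c"
      using vector_derivative_within_cbox[of 0 T x \<phi> c] T x has_vector_derivative_at_within[OF c]
      by (simp add: path_deriv_def)
    then show ?thesis using c by simp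
  qed
  have "(path_deriv T \<phi> has_integral \<phi> t - \<phi> 0) {0..t}" if t: "t \<in> {0..T}" for t
  proof (rule abs_continuous_on_fundamental_theorem[OF _ _ Z(1)])
    show "abs_continuous_on {0..t} \<phi>"
      using abs_continuous_on_subset[OF ac] t by auto
    show "0 \<le> t" using t by simp
    show "(\<phi> has_vector_derivative path_deriv T \<phi> x) (at x)" if "x \<in> {0<..<t} - Z" for x
      using der that t by auto
  qed
  moreover have "AE t in lebesgue_on {0..T}. (\<phi> has_vector_derivative path_deriv T \<phi> t) (at t within {0..T})"
    unfolding AE_lebesgue_on_iff_negligible[OF lmeasurable_cbox[of 0 T, THEN fmeasurableD, unfolded cbox_interval]]
  proof (intro exI conjI ballI)
    show "negligible (Z \<union> {0, T})" using Z(1) by simp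
    fix t assume "t \<in> {0..T} - (Z \<union> {0, T})"
    then have "t \<in> {0<..<T} - Z" by auto
    then show "(\<phi> has_vector_derivative path_deriv T \<phi> t) (at t within {0..T})"
      using der has_vector_derivative_at_within by blast
  qed
  ultimately show ?thesis using L2 by (simp add: has_L2_derivative_def)
qed

lemma has_L2_derivative_diff:
  assumes "has_L2_derivative T \<phi> g" "has_L2_derivative T \<psi> h"
  shows "has_L2_derivative T (\<lambda>t. \<phi> t - \<psi> t) (\<lambda>t. g t - h t)"
  unfolding has_L2_derivative_def
proof (intro conjI ballI)
  show "L2 T (\<lambda>t. g t - h t)" using assms by (auto simp: has_L2_derivative_def intro: L2_diff)
  fix t assume t: "t \<in> {0..T}"
  have "((\<lambda>t. g t - h t) has_integral (\<phi> t - \<phi> 0) - (\<psi> t - \<psi> 0)) {0..t}"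
    using assms t by (intro has_integral_diff) (auto simp: has_L2_derivative_def)
  then show "((\<lambda>t. g t - h t) has_integral \<phi> t - \<psi> t - (\<phi> 0 - \<psi> 0)) {0..t}"
    by (simp add: algebra_simps)
next
  have "AE t in lebesgue_on {0..T}. (\<phi> has_vector_derivative g t) (at t within {0..T})"
       "AE t in lebesgue_on {0..T}. (\<psi> has_vector_derivative h t) (at t within {0..T})"
    using assms by (auto simp: has_L2_derivative_def)
  then show "AE t in lebesgue_on {0..T}. ((\<lambda>t. \<phi> t - \<psi> t) has_vector_derivative g t - h t) (at t within {0..T})"
    by eventually_elim (rule has_vector_derivative_diff)
qed

text \<open>The inequality \<open>norm (g s) \<le> c + (1/c) * (norm (g s))\<^sup>2\<close> is
  integrated with \<open>c\<close> just above the norm \<open>n\<close> of the path. This bounds the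
  increment by \<open>(1 + T) * n\<close>, and the initial value adds another \<open>n\<close>. The
  crude constant suffices for uniform convergence.\<close>

lemma norm_path_le_H_norm:
  assumes T: "T > 0" and p: "has_L2_derivative T \<phi> g" and t: "t \<in> {0..T}"
  shows "norm (\<phi> t) \<le> (2 + T) * H_norm T \<phi>"
proof -
  have L2: "L2 T g" using p by (simp add: has_L2_derivative_def)
  define n where "n = H_norm T \<phi>"
  have n2: "n\<^sup>2 = (norm (\<phi> 0))\<^sup>2 + L2_sq T g"
    using H_inner_eq[OF T p] L2_sq_nonneg[of T g] by (simp add: n_def H_norm_def)
  have n0: "n \<ge> 0" using H_inner_eq[OF T p] L2_sq_nonneg[of T g] by (simp add: n_def H_norm_def)
  have "(norm (\<phi> 0))\<^sup>2 \<le> n\<^sup>2" using n2 L2_sq_nonneg[of T g] by simp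
  then have 0: "norm (\<phi> 0) \<le> n" using n0 by (rule power2_le_imp_le)
  have ai: "g absolutely_integrable_on {0..T}" by (rule L2_absolutely_integrable[OF L2])
  have gi: "(\<lambda>s. norm (g s)) integrable_on {0..T}"
    using ai by (simp add: absolutely_integrable_on_def)
  have sub: "{0..t} \<subseteq> {0..T}" using t by auto
  have "norm (\<phi> t - \<phi> 0) = norm (integral {0..t} g)"
  proof -
    have "(g has_integral \<phi> t - \<phi> 0) {0..t}" using p t by (auto simp: has_L2_derivative_def)
    from integral_unique[OF this] show ?thesis by simp
  qed
  also have "\<dots> \<le> integral {0..t} (\<lambda>s. norm (g s))"
    using absolutely_integrable_on_subinterval[OF ai sub]
    by (intro integral_norm_bound_integral) (auto simp: absolutely_integrable_on_def)
  also have "\<dots> \<le> integral {0..T} (\<lambda>s. norm (g s))"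
    using integrable_on_subinterval[OF gi sub] by (intro integral_subset_le gi sub) auto
  also have "\<dots> = integral\<^sup>L (lebesgue_on {0..T}) (\<lambda>s. norm (g s))"
    by (intro lebesgue_integral_eq_integral[symmetric] L2_norm_integrable[OF L2]) auto
  finally have 1: "norm (\<phi> t - \<phi> 0) \<le> integral\<^sup>L (lebesgue_on {0..T}) (\<lambda>s. norm (g s))" .
  interpret finite_measure "lebesgue_on {0..T}" by (rule finite_measure_lebesgue_on_Icc)
  have mT: "measure (lebesgue_on {0..T}) {0..T} = T"
    using T by (simp add: measure_restrict_space)
  have "norm (\<phi> t - \<phi> 0) \<le> (1 + T) * n"
  proof (rule field_le_epsilon)
    fix e :: real assume e: "e > 0"
    \<comment> \<open>\<open>n\<close> may be 0, so \<open>c\<close> is taken larger; the excess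
      contributes exactly \<open>e\<close> after multiplication by \<open>1 + T\<close>.\<close>
    define c where "c = n + e / (1 + T)"
    have c: "c > 0" using n0 e T by (simp add: c_def add_nonneg_pos)
    have "norm (g s) \<le> c + (1/c) * (norm (g s))\<^sup>2" for s
    proof (cases "norm (g s) \<le> c")
      case False
      then have "norm (g s) * 1 \<le> norm (g s) * (norm (g s) / c)"
        using c by (intro mult_left_mono) auto
      then show ?thesis using c by (simp add: power2_eq_square)
    qed (use c in \<open>simp add: add_increasing2\<close>)
    then have "integral\<^sup>L (lebesgue_on {0..T}) (\<lambda>s. norm (g s))
        \<le> integral\<^sup>L (lebesgue_on {0..T}) (\<lambda>s. c + (1/c) * (norm (g s))\<^sup>2)"
      using L2 by (intro integral_mono L2_norm_integrable) (auto simp: L2_def)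
    also have "\<dots> = c * T + (1/c) * L2_sq T g"
    proof -
      have "integrable (lebesgue_on {0..T}) (\<lambda>s. (norm (g s))\<^sup>2)" using L2 by (simp add: L2_def)
      then show ?thesis using mT by (simp add: L2_sq_def)
    qed
    also have "(1/c) * L2_sq T g \<le> (1/c) * (c * c)"
    proof -
      have "L2_sq T g \<le> n\<^sup>2" using n2 by simp
      also have "\<dots> \<le> c\<^sup>2" using n0 e T by (intro power_mono) (auto simp: c_def)
      finally show ?thesis using c by (intro mult_left_mono) (auto simp: power2_eq_square)
    qed
    also have "c * T + (1/c) * (c * c) = (1 + T) * c" using c by (simp add: algebra_simps)
    also have "\<dots> = (1 + T) * n + e" using T by (simp add: c_def field_simps)
    finally show "norm (\<phi> t - \<phi> 0) \<le> (1 + T) * n + e" using 1 by simp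
  qed
  moreover have "norm (\<phi> t) \<le> norm (\<phi> 0) + norm (\<phi> t - \<phi> 0)"
    using norm_triangle_ineq[of "\<phi> 0" "\<phi> t - \<phi> 0"] by simp
  ultimately show ?thesis using 0 by (simp add: n_def[symmetric] algebra_simps)
qed

section \<open>Step functions and piecewise linear paths\<close>

text \<open>The half-open cells of a partition are disjoint, so at most one summand is nonzero. At
  \<open>T\<close> the value is 0, which no integral sees.\<close>

definition step_fun :: "nat \<Rightarrow> (nat \<Rightarrow> real) \<Rightarrow> (nat \<Rightarrow> 'a::real_vector) \<Rightarrow> real \<Rightarrow> 'a" where
  "step_fun N \<tau> v t = (\<Sum>k<N. indicat_real {\<tau> k..<\<tau> (Suc k)} t *\<^sub>R v k)"

definition slope :: "(nat \<Rightarrow> real) \<Rightarrow> (real \<Rightarrow> 'a::real_vector) \<Rightarrow> nat \<Rightarrow> 'a" where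
  "slope \<tau> \<phi> k = (1 / step \<tau> k) *\<^sub>R (\<phi> (\<tau> (Suc k)) - \<phi> (\<tau> k))"

text \<open>The clamped difference is the time spent in cell \<open>k\<close> up to time
  \<open>t\<close>. As a sum of such ramps the path is evidently continuous. The restriction to
  \<open>{0..T}\<close> makes it extensional, as \<open>pl_space\<close> demands.\<close>

definition interpolant :: "real \<Rightarrow> nat \<Rightarrow> (nat \<Rightarrow> real) \<Rightarrow> (real \<Rightarrow> 'a::real_vector) \<Rightarrow> real \<Rightarrow> 'a" where
  "interpolant T N \<tau> \<phi> = (\<lambda>t\<in>{0..T}. \<phi> 0 +
     (\<Sum>k<N. (min (max t (\<tau> k)) (\<tau> (Suc k)) - \<tau> k) *\<^sub>R slope \<tau> \<phi> k))"

section \<open>Partitions and integrals of step functions\<close>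

lemma partition_mono:
  assumes "is_partition T N \<tau>" "i \<le> j" "j \<le> N"
  shows "\<tau> i \<le> \<tau> j"
  using assms(2,3)
proof (induction rule: dec_induct)
  case (step n)
  then have "\<tau> n < \<tau> (Suc n)" using assms(1) by (simp add: is_partition_def)
  with step show ?case by simp
qed simp

lemma partition_mem:
  assumes "is_partition T N \<tau>" "k \<le> N"
  shows "\<tau> k \<in> {0..T}"
  using partition_mono[OF assms(1), of 0 k] partition_mono[OF assms(1), of k N] assms
  by (auto simp: is_partition_def)

lemma step_pos: "is_partition T N \<tau> \<Longrightarrow> k < N \<Longrightarrow> step \<tau> k > 0"
  by (simp add: is_partition_def step_def)

lemma step_le_mesh: "k < N \<Longrightarrow> step \<tau> k \<le> mesh N \<tau>"
  unfolding mesh_def by (intro Max_ge) auto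

lemma sum_step:
  assumes "is_partition T N \<tau>"
  shows "(\<Sum>k<N. step \<tau> k) = T"
  unfolding step_def using assms by (subst sum_lessThan_telescope) (simp add: is_partition_def)

lemma partition_cover:
  assumes p: "is_partition T N \<tau>" and t: "t \<in> {0..<T}"
  obtains k where "k < N" "t \<in> {\<tau> k..<\<tau> (Suc k)}"
proof -
  have "\<exists>k<n. t \<in> {\<tau> k..<\<tau> (Suc k)}" if "n \<le> N" "t < \<tau> n" for n
    using that
  proof (induction n)
    case 0
    then show ?case using p t by (simp add: is_partition_def)
  next
    case (Suc n)
    show ?case
    proof (cases "t < \<tau> n")
      case True
      then show ?thesis using Suc by (meson less_Suc_eq Suc_leD)
    qed (use Suc in auto)
  qed
  from this[of N] show ?thesis using p t that by (auto simp: is_partition_def)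
qed

lemma step_fun_eq:
  assumes p: "is_partition T N \<tau>" and k: "k < N" and t: "t \<in> {\<tau> k..<\<tau> (Suc k)}"
  shows "step_fun N \<tau> v t = v k"
proof -
  have "t \<notin> {\<tau> l..<\<tau> (Suc l)}" if "l < N" "l \<noteq> k" for l
  proof (cases "l < k")
    case True
    then have "\<tau> (Suc l) \<le> \<tau> k" using k by (intro partition_mono[OF p]) auto
    then show ?thesis using t by auto
  next
    case False
    then have "\<tau> (Suc k) \<le> \<tau> l" using that by (intro partition_mono[OF p]) auto
    then show ?thesis using t by auto
  qed
  then have "step_fun N \<tau> v t = (\<Sum>l<N. if l = k then v k else 0)"
    unfolding step_fun_def using t by (intro sum.cong) auto
  then show ?thesis using k by simp
qed

text \<open>The point \<open>T\<close> lies in no half-open cell: there the left side would be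
  \<open>h 0\<close> and the right side 0. Uses under the integral therefore go through an
  almost-everywhere version.\<close>

lemma step_fun_apply:
  assumes p: "is_partition T N \<tau>" and t: "t \<in> {0..<T}"
  shows "h (step_fun N \<tau> v t) = step_fun N \<tau> (\<lambda>k. h (v k)) t"
  using partition_cover[OF p t] step_fun_eq[OF p] by metis

lemma AE_less_T: "AE t in lebesgue_on {0..T::real}. t \<in> {0..<T}"
  by (subst AE_lebesgue_on_iff_negligible) (auto intro!: exI[of _ "{T}"])

lemma step_fun_integral:
  fixes v :: "nat \<Rightarrow> 'a::euclidean_space"
  assumes p: "is_partition T N \<tau>"
  shows "integrable (lebesgue_on {0..T}) (step_fun N \<tau> v)"
    "integral\<^sup>L (lebesgue_on {0..T}) (step_fun N \<tau> v) = (\<Sum>k<N. step \<tau> k *\<^sub>R v k)"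
proof -
  have *: "has_bochner_integral (lebesgue_on {0..T}) (\<lambda>t. indicat_real {\<tau> k..<\<tau> (Suc k)} t *\<^sub>R v k) (step \<tau> k *\<^sub>R v k)"
    if k: "k < N" for k
  proof -
    have sub: "{\<tau> k..<\<tau> (Suc k)} \<subseteq> {0..T}"
      using partition_mem[OF p, of k] partition_mem[OF p, of "Suc k"] k by auto
    have "emeasure (lebesgue_on {0..T}) {\<tau> k..<\<tau> (Suc k)} = ennreal (step \<tau> k)"
      using sub step_pos[OF p k] by (subst emeasure_restrict_space) (auto simp: step_def)
    then have "has_bochner_integral (lebesgue_on {0..T}) (indicat_real {\<tau> k..<\<tau> (Suc k)}) (step \<tau> k)"
      using has_bochner_integral_real_indicator[of "{\<tau> k..<\<tau> (Suc k)}" "lebesgue_on {0..T}"] sub step_pos[OF p k]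
      by (simp add: sets_restrict_space_iff measure_def)
    then show ?thesis by (rule has_bochner_integral_scaleR_left)
  qed
  have "has_bochner_integral (lebesgue_on {0..T}) (step_fun N \<tau> v) (\<Sum>k<N. step \<tau> k *\<^sub>R v k)"
    unfolding step_fun_def[abs_def] by (rule has_bochner_integral_sum) (use * in auto)
  then show "integrable (lebesgue_on {0..T}) (step_fun N \<tau> v)"
    "integral\<^sup>L (lebesgue_on {0..T}) (step_fun N \<tau> v) = (\<Sum>k<N. step \<tau> k *\<^sub>R v k)"
    by (auto simp: has_bochner_integral_iff)
qed

lemma step_fun_apply_AE:
  assumes "is_partition T N \<tau>"
  shows "AE t in lebesgue_on {0..T}. h (step_fun N \<tau> v t) = step_fun N \<tau> (\<lambda>k. h (v k)) t"
  using AE_less_T by eventually_elim (rule step_fun_apply[OF assms])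

lemma step_fun_L2:
  fixes v :: "nat \<Rightarrow> 'a::euclidean_space"
  assumes p: "is_partition T N \<tau>"
  shows "L2 T (step_fun N \<tau> v)" "L2_sq T (step_fun N \<tau> v) = (\<Sum>k<N. step \<tau> k * (norm (v k))\<^sup>2)"
proof -
  let ?M = "lebesgue_on {0..T}"
  have m: "step_fun N \<tau> v \<in> borel_measurable ?M"
    using step_fun_integral(1)[OF p, of v] by (rule borel_measurable_integrable)
  have m2: "step_fun N \<tau> (\<lambda>k. (norm (v k))\<^sup>2) \<in> borel_measurable ?M"
    using step_fun_integral(1)[OF p, of "\<lambda>k. (norm (v k))\<^sup>2"] by (rule borel_measurable_integrable)
  have eq: "AE t in ?M. (norm (step_fun N \<tau> v t))\<^sup>2 = step_fun N \<tau> (\<lambda>k. (norm (v k))\<^sup>2) t"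
    by (rule step_fun_apply_AE[OF p])
  have "integrable ?M (\<lambda>t. (norm (step_fun N \<tau> v t))\<^sup>2)"
    using eq m m2 step_fun_integral(1)[OF p, of "\<lambda>k. (norm (v k))\<^sup>2"]
    by (subst integrable_cong_AE[OF _ _ eq]) auto
  then show "L2 T (step_fun N \<tau> v)" using m by (simp add: L2_def)
  have "L2_sq T (step_fun N \<tau> v) = integral\<^sup>L ?M (step_fun N \<tau> (\<lambda>k. (norm (v k))\<^sup>2))"
    unfolding L2_sq_def using m m2 by (intro integral_cong_AE eq) auto
  then show "L2_sq T (step_fun N \<tau> v) = (\<Sum>k<N. step \<tau> k * (norm (v k))\<^sup>2)"
    using step_fun_integral(2)[OF p, of "\<lambda>k. (norm (v k))\<^sup>2"] by simp
qed

text \<open>A continuous path that is differentiable off the finitely many nodes is the integral of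
  its derivative, and on each open cell this derivative is the slope.\<close>

lemma pl_space_has_L2_derivative:
  fixes \<phi> :: "real \<Rightarrow> 'a::euclidean_space"
  assumes p: "is_partition T N \<tau>" and \<phi>: "\<phi> \<in> pl_space T N \<tau>"
  shows "has_L2_derivative T \<phi> (step_fun N \<tau> (slope \<tau> \<phi>))"
proof -
  have der: "(\<phi> has_vector_derivative step_fun N \<tau> (slope \<tau> \<phi>) t) (at t)"
    if t: "t \<in> {0<..<T} - \<tau> ` {..N}" for t
  proof -
    have "t \<in> {0..<T}" using t by auto
    from partition_cover[OF p this] obtain k where k: "k < N" "t \<in> {\<tau> k..<\<tau> (Suc k)}" by blast
    then have "t \<noteq> \<tau> k" using t by auto
    then have tk: "t \<in> {\<tau> k<..<\<tau> (Suc k)}" using k by auto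
    obtain a b where ab: "\<And>s. s \<in> {\<tau> k..\<tau> (Suc k)} \<Longrightarrow> \<phi> s = a + s *\<^sub>R b"
      using \<phi> k(1) unfolding pl_space_def by blast
    have "\<phi> (\<tau> (Suc k)) - \<phi> (\<tau> k) = step \<tau> k *\<^sub>R b"
      using ab[of "\<tau> k"] ab[of "\<tau> (Suc k)"] step_pos[OF p k(1)]
      by (simp add: step_def algebra_simps)
    then have "slope \<tau> \<phi> k = b" using step_pos[OF p k(1)] by (simp add: slope_def)
    then have v: "step_fun N \<tau> (slope \<tau> \<phi>) t = b" using step_fun_eq[OF p k] by metis
    have "((\<lambda>s. a + s *\<^sub>R b) has_vector_derivative b) (at t)"
      by (auto intro!: derivative_eq_intros)
    then have "(\<phi> has_vector_derivative b) (at t)"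
      by (rule has_vector_derivative_transform_within_open[where S = "{\<tau> k<..<\<tau> (Suc k)}"])
         (use tk ab in auto)
    then show ?thesis by (simp add: v)
  qed
  have "(step_fun N \<tau> (slope \<tau> \<phi>) has_integral \<phi> t - \<phi> 0) {0..t}" if t: "t \<in> {0..T}" for t
  proof (rule fundamental_theorem_of_calculus_interior_strong[of "\<tau> ` {..N}"])
    show "continuous_on {0..t} \<phi>"
      using \<phi> t by (auto simp: pl_space_def intro: continuous_on_subset)
  qed (use der t in auto)
  moreover have "AE t in lebesgue_on {0..T}. (\<phi> has_vector_derivative step_fun N \<tau> (slope \<tau> \<phi>) t) (at t within {0..T})"
    unfolding AE_lebesgue_on_iff_negligible[OF lmeasurable_cbox[of 0 T, THEN fmeasurableD, unfolded cbox_interval]]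
  proof (intro exI conjI ballI)
    show "negligible (\<tau> ` {..N} \<union> {0, T})" by (intro negligible_finite) auto
    fix t assume "t \<in> {0..T} - (\<tau> ` {..N} \<union> {0, T})"
    then have "t \<in> {0<..<T} - \<tau> ` {..N}" by auto
    then show "(\<phi> has_vector_derivative step_fun N \<tau> (slope \<tau> \<phi>) t) (at t within {0..T})"
      using der has_vector_derivative_at_within by blast
  qed
  ultimately show ?thesis using step_fun_L2(1)[OF p] by (auto simp: has_L2_derivative_def)
qed

text \<open>Cells before the \<open>k\<close>-th contribute their full increments, which telescope,
  and later cells contribute nothing. With the closed cell the formula covers both of its
  nodes.\<close>

lemma interpolant_eq:
  assumes p: "is_partition T N \<tau>" and k: "k < N" and t: "t \<in> {\<tau> k..\<tau> (Suc k)}"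
  shows "interpolant T N \<tau> \<phi> t = \<phi> (\<tau> k) + (t - \<tau> k) *\<^sub>R slope \<tau> \<phi> k"
proof -
  let ?s = "\<lambda>l. (min (max t (\<tau> l)) (\<tau> (Suc l)) - \<tau> l) *\<^sub>R slope \<tau> \<phi> l"
  have t0T: "t \<in> {0..T}" using t partition_mem[OF p, of k] partition_mem[OF p, of "Suc k"] k by auto
  have lt: "?s l = \<phi> (\<tau> (Suc l)) - \<phi> (\<tau> l)" if l: "l < k" for l
  proof -
    have "\<tau> (Suc l) \<le> \<tau> k" using l k by (intro partition_mono[OF p]) auto
    moreover have s: "step \<tau> l > 0" using step_pos[OF p] l k by auto
    ultimately have "min (max t (\<tau> l)) (\<tau> (Suc l)) - \<tau> l = step \<tau> l" using t by (auto simp: step_def)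
    then have "?s l = step \<tau> l *\<^sub>R slope \<tau> \<phi> l" by (simp only:)
    then show ?thesis using s by (simp add: slope_def)
  qed
  have gt: "?s l = 0" if l: "k < l" "l < N" for l
  proof -
    have "\<tau> (Suc k) \<le> \<tau> l" "\<tau> l \<le> \<tau> (Suc l)" using l by (auto intro!: partition_mono[OF p])
    then have "min (max t (\<tau> l)) (\<tau> (Suc l)) = \<tau> l" using t by auto
    then show ?thesis by simp
  qed
  have "(\<Sum>l<N. ?s l) = (\<Sum>l<Suc k. ?s l)"
    by (rule sum.mono_neutral_right) (use k gt in \<open>auto simp: less_Suc_eq_le\<close>)
  also have "\<dots> = (\<Sum>l<k. \<phi> (\<tau> (Suc l)) - \<phi> (\<tau> l)) + ?s k"
    using lt by simp
  also have "(\<Sum>l<k. \<phi> (\<tau> (Suc l)) - \<phi> (\<tau> l)) = \<phi> (\<tau> k) - \<phi> 0"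
    using p by (subst sum_lessThan_telescope) (simp add: is_partition_def)
  also have "?s k = (t - \<tau> k) *\<^sub>R slope \<tau> \<phi> k" using t by (simp add: min_def max_def)
  finally show ?thesis using t0T by (simp add: interpolant_def)
qed

lemma interpolant_node:
  assumes p: "is_partition T N \<tau>" and T: "T > 0" and k: "k \<le> N"
  shows "interpolant T N \<tau> \<phi> (\<tau> k) = \<phi> (\<tau> k)"
proof (cases "k < N")
  case True
  then show ?thesis using interpolant_eq[OF p True, of "\<tau> k" \<phi>] step_pos[OF p True] by (simp add: step_def)
next
  case False
  \<comment> \<open>The last node starts no cell. It is reached as the right end of the last cell,
    which exists because \<open>T > 0\<close>.\<close>
  then have "k = N" using k by simp
  moreover have "N \<noteq> 0" using p T by (metis is_partition_def less_irrefl)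
  ultimately obtain l where l: "k = Suc l" "l < N" by (cases k) auto
  have s: "step \<tau> l > 0" by (rule step_pos[OF p l(2)])
  then show ?thesis
    using interpolant_eq[OF p l(2), of "\<tau> k" \<phi>] l by (simp add: slope_def step_def)
qed

lemma slope_interpolant:
  assumes "is_partition T N \<tau>" "T > 0" "k < N"
  shows "slope \<tau> (interpolant T N \<tau> \<phi>) k = slope \<tau> \<phi> k"
  unfolding slope_def
  using interpolant_node[OF assms(1,2), of k \<phi>] interpolant_node[OF assms(1,2), of "Suc k" \<phi>] assms(3)
  by simp

lemma interpolant_pl_space:
  assumes p: "is_partition T N \<tau>"
  shows "interpolant T N \<tau> \<phi> \<in> pl_space T N \<tau>"
  unfolding pl_space_def
proof (intro CollectI conjI allI impI)
  show "interpolant T N \<tau> \<phi> \<in> extensional {0..T}" by (simp add: interpolant_def)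
  have "continuous_on {0..T} (\<lambda>t. \<phi> 0 + (\<Sum>k<N. (min (max t (\<tau> k)) (\<tau> (Suc k)) - \<tau> k) *\<^sub>R slope \<tau> \<phi> k))"
    by (intro continuous_intros)
  then show "continuous_on {0..T} (interpolant T N \<tau> \<phi>)"
    by (rule continuous_on_eq) (simp add: interpolant_def)
  fix k assume k: "k < N"
  show "\<exists>a b. \<forall>t\<in>{\<tau> k..\<tau> (Suc k)}. interpolant T N \<tau> \<phi> t = a + t *\<^sub>R b"
    by (rule exI[of _ "\<phi> (\<tau> k) - \<tau> k *\<^sub>R slope \<tau> \<phi> k"], rule exI[of _ "slope \<tau> \<phi> k"])
       (simp add: interpolant_eq[OF p k] algebra_simps)
qed

section \<open>The slopes as averages of the derivative\<close>

lemma has_L2_derivative_integral_subinterval: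
  assumes p: "has_L2_derivative T \<phi> g" and ab: "0 \<le> a" "a \<le> b" "b \<le> T"
  shows "integral\<^sup>L (lebesgue_on {0..T}) (\<lambda>t. indicat_real {a..<b} t *\<^sub>R g t) = \<phi> b - \<phi> a"
proof -
  have L2: "L2 T g" using p by (simp add: has_L2_derivative_def)
  have ai: "g absolutely_integrable_on {0..T}" by (rule L2_absolutely_integrable[OF L2])
  have aab: "g absolutely_integrable_on {a..b}"
    by (rule absolutely_integrable_on_subinterval[OF ai]) (use ab in auto)
  have gm: "(\<lambda>t. indicat_real {0..T} t *\<^sub>R g t) \<in> borel_measurable lebesgue"
    using L2 by (simp add: L2_def borel_measurable_restrict_space_iff)
  have "integral\<^sup>L (lebesgue_on {0..T}) (\<lambda>t. indicat_real {a..<b} t *\<^sub>R g t)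
      = (LINT t|lebesgue. indicat_real {0..T} t *\<^sub>R indicat_real {a..<b} t *\<^sub>R g t)"
    by (subst integral_restrict_space) auto
  also have "\<dots> = (LINT t|lebesgue. indicat_real {a..b} t *\<^sub>R g t)"
  proof (rule integral_cong_AE)
    have "(\<lambda>t. indicat_real {a..<b} t *\<^sub>R indicat_real {0..T} t *\<^sub>R g t) \<in> borel_measurable lebesgue"
      by (intro borel_measurable_scaleR gm borel_measurable_indicator) auto
    then show "(\<lambda>t. indicat_real {0..T} t *\<^sub>R indicat_real {a..<b} t *\<^sub>R g t) \<in> borel_measurable lebesgue"
      by (simp add: mult.commute)
    show "(\<lambda>t. indicat_real {a..b} t *\<^sub>R g t) \<in> borel_measurable lebesgue"
      using aab by (simp add: set_integrable_def borel_measurable_integrable)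
    have "AE t in lebesgue. t \<notin> {b}" by (intro AE_not_in) (metis negligible_iff_null_sets negligible_sing)
    then show "AE t in lebesgue. indicat_real {0..T} t *\<^sub>R indicat_real {a..<b} t *\<^sub>R g t = indicat_real {a..b} t *\<^sub>R g t"
      by eventually_elim (use ab in \<open>auto simp: indicator_def\<close>)
  qed
  also have "\<dots> = integral {a..b} g"
    using set_lebesgue_integral_eq_integral(2)[OF aab] by (simp add: set_lebesgue_integral_def)
  also have "\<dots> = integral {0..b} g - integral {0..a} g"
  proof -
    have "g integrable_on {0..b}"
      using absolutely_integrable_on_subinterval[OF ai, of 0 b] ab
      by (auto simp: absolutely_integrable_on_def)
    from Henstock_Kurzweil_Integration.integral_combine[OF ab(1,2) this] show ?thesis by (simp add: algebra_simps)
  qed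
  also have "\<dots> = (\<phi> b - \<phi> 0) - (\<phi> a - \<phi> 0)"
  proof -
    have "integral {0..s} g = \<phi> s - \<phi> 0" if "s \<in> {0..T}" for s
      using p that by (intro integral_unique) (simp add: has_L2_derivative_def)
    then show ?thesis using ab by simp
  qed
  finally show ?thesis by simp
qed

text \<open>The cell around \<open>t\<close> shrinks to \<open>t\<close> but need not be centred.
  Since its ends lie on either side of \<open>t\<close>, the first-order errors add up to
  \<open>e/2\<close> times the cell length, which the division by that length turns into
  \<open>e/2\<close>.\<close>

lemma step_slopes_tendsto:
  fixes \<phi> :: "real \<Rightarrow> 'a::euclidean_space"
  assumes p: "\<And>i. is_partition T (N i) (\<tau> i)" and mesh: "(\<lambda>i. mesh (N i) (\<tau> i)) \<longlonglongrightarrow> 0"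
    and t: "t \<in> {0..<T}" and der: "(\<phi> has_vector_derivative c) (at t within {0..T})"
  shows "(\<lambda>i. step_fun (N i) (\<tau> i) (slope (\<tau> i) \<phi>) t) \<longlonglongrightarrow> c"
proof (rule LIMSEQ_I)
  fix e :: real assume e: "e > 0"
  then have "e / 2 > 0" by simp
  with der obtain d where d: "d > 0" and
    D: "\<And>s. s \<in> {0..T} \<Longrightarrow> norm (s - t) < d \<Longrightarrow> norm (\<phi> s - \<phi> t - (s - t) *\<^sub>R c) \<le> e/2 * norm (s - t)"
    unfolding has_vector_derivative_def has_derivative_within_alt by blast
  obtain i0 where i0: "\<And>i. i \<ge> i0 \<Longrightarrow> norm (mesh (N i) (\<tau> i) - 0) < d"
    using LIMSEQ_D[OF mesh d] by blast
  show "\<exists>n0. \<forall>i\<ge>n0. norm (step_fun (N i) (\<tau> i) (slope (\<tau> i) \<phi>) t - c) < e"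
  proof (intro exI[of _ i0] allI impI)
    fix i assume i: "i \<ge> i0"
    obtain k where k: "k < N i" "t \<in> {\<tau> i k..<\<tau> i (Suc k)}" using partition_cover[OF p t] by blast
    define l r where "l = \<tau> i k" and "r = \<tau> i (Suc k)"
    have st: "step (\<tau> i) k = r - l" by (simp add: step_def l_def r_def)
    have lr: "l \<le> t" "t < r" using k by (auto simp: l_def r_def)
    have "r - l < d" using step_le_mesh[OF k(1), of "\<tau> i"] i0[OF i] by (simp add: st)
    then have L: "norm (\<phi> l - \<phi> t - (l - t) *\<^sub>R c) \<le> e/2 * (t - l)"
      and R: "norm (\<phi> r - \<phi> t - (r - t) *\<^sub>R c) \<le> e/2 * (r - t)"
      using D[of l] D[of r] lr partition_mem[OF p, of k i] partition_mem[OF p, of "Suc k" i] k(1)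
      by (auto simp: l_def r_def)
    have "norm (\<phi> r - \<phi> l - (r - l) *\<^sub>R c)
        = norm ((\<phi> r - \<phi> t - (r - t) *\<^sub>R c) - (\<phi> l - \<phi> t - (l - t) *\<^sub>R c))"
      by (simp add: algebra_simps)
    also have "\<dots> \<le> e/2 * (r - t) + e/2 * (t - l)"
      using norm_triangle_ineq4 L R by (meson add_mono order_trans)
    also have "\<dots> = e/2 * (r - l)" by (simp add: field_simps)
    finally have *: "norm (\<phi> r - \<phi> l - (r - l) *\<^sub>R c) \<le> e/2 * (r - l)" .
    have "slope (\<tau> i) \<phi> k - c = (1 / (r - l)) *\<^sub>R (\<phi> r - \<phi> l - (r - l) *\<^sub>R c)"
      using lr by (simp add: slope_def st[symmetric] l_def[symmetric] r_def[symmetric] scaleR_diff_right)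
         (simp add: st)
    then have "norm (slope (\<tau> i) \<phi> k - c) = norm (\<phi> r - \<phi> l - (r - l) *\<^sub>R c) / (r - l)"
      using lr by simp
    also have "\<dots> \<le> e / 2" using * lr by (simp add: pos_divide_le_eq)
    finally show "norm (step_fun (N i) (\<tau> i) (slope (\<tau> i) \<phi>) t - c) < e"
      using step_fun_eq[OF p k, of "slope (\<tau> i) \<phi>"] e by simp
  qed
qed

text \<open>The slopes are the orthogonal projection of the derivative onto step functions; convergence
  of the norms follows from Fatou's lemma.\<close>

lemma L2_sq_slopes_diff:
  fixes \<phi> :: "real \<Rightarrow> 'a::euclidean_space"
  assumes p: "is_partition T N \<tau>" and \<phi>: "has_L2_derivative T \<phi> g"
  shows "L2_sq T (\<lambda>t. step_fun N \<tau> (slope \<tau> \<phi>) t - g t) = L2_sq T g - L2_sq T (step_fun N \<tau> (slope \<tau> \<phi>))"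
proof -
  let ?M = "lebesgue_on {0..T}" and ?s = "step_fun N \<tau> (slope \<tau> \<phi>)"
  have L2: "L2 T g" using \<phi> by (simp add: has_L2_derivative_def)
  have gi: "integrable ?M g" by (rule L2_integrable[OF L2])
  have ind: "integrable ?M (\<lambda>t. indicat_real {\<tau> k..<\<tau> (Suc k)} t *\<^sub>R g t)" if "k < N" for k
  proof (rule integrable_mult_indicator[OF _ gi])
    have "{\<tau> k..<\<tau> (Suc k)} \<subseteq> {0..T}"
      using partition_mem[OF p, of k] partition_mem[OF p, of "Suc k"] that by auto
    then show "{\<tau> k..<\<tau> (Suc k)} \<in> sets ?M" by (simp add: sets_restrict_space_iff)
  qed
  have eq: "g t \<bullet> ?s t = (\<Sum>k<N. (indicat_real {\<tau> k..<\<tau> (Suc k)} t *\<^sub>R g t) \<bullet> slope \<tau> \<phi> k)" for t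
    by (simp add: step_fun_def inner_sum_right)
  have int: "integrable ?M (\<lambda>t. g t \<bullet> ?s t)"
    unfolding eq using ind by (intro Bochner_Integration.integrable_sum integrable_inner_left) auto
  have "integral\<^sup>L ?M (\<lambda>t. g t \<bullet> ?s t)
      = (\<Sum>k<N. integral\<^sup>L ?M (\<lambda>t. indicat_real {\<tau> k..<\<tau> (Suc k)} t *\<^sub>R g t) \<bullet> slope \<tau> \<phi> k)"
    unfolding eq using ind
    by (subst Bochner_Integration.integral_sum)
       (auto intro!: sum.cong integrable_inner_left simp del: inner_scaleR_left)
  also have "\<dots> = (\<Sum>k<N. step \<tau> k * (norm (slope \<tau> \<phi> k))\<^sup>2)"
  proof (rule sum.cong[OF refl])
    fix k assume k: "k \<in> {..<N}"
    then have s: "step \<tau> k > 0" using step_pos[OF p] by simp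
    \<comment> \<open>The integral of the derivative over a cell is the increment of the path, that
      is, the slope times the step.\<close>
    have "integral\<^sup>L ?M (\<lambda>t. indicat_real {\<tau> k..<\<tau> (Suc k)} t *\<^sub>R g t) = \<phi> (\<tau> (Suc k)) - \<phi> (\<tau> k)"
      using partition_mem[OF p, of k] partition_mem[OF p, of "Suc k"] k s
      by (intro has_L2_derivative_integral_subinterval[OF \<phi>]) (auto simp: step_def)
    also have "\<dots> = step \<tau> k *\<^sub>R slope \<tau> \<phi> k" using s by (simp add: slope_def)
    finally show "integral\<^sup>L ?M (\<lambda>t. indicat_real {\<tau> k..<\<tau> (Suc k)} t *\<^sub>R g t) \<bullet> slope \<tau> \<phi> k
        = step \<tau> k * (norm (slope \<tau> \<phi> k))\<^sup>2" by (simp add: power2_norm_eq_inner)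
  qed
  also have "\<dots> = L2_sq T ?s" by (rule step_fun_L2(2)[OF p, symmetric])
  \<comment> \<open>Orthogonality: the inner product of the derivative with its projection is the
    squared norm of the projection. Expanding the square thus leaves the difference of the squared
    norms.\<close>
  finally have cross: "integral\<^sup>L ?M (\<lambda>t. g t \<bullet> ?s t) = L2_sq T ?s" .
  have "(norm (?s t - g t))\<^sup>2 = ((norm (?s t))\<^sup>2 + (norm (g t))\<^sup>2) - 2 * (g t \<bullet> ?s t)" for t
    by (simp add: power2_norm_eq_inner algebra_simps inner_commute)
  then have "L2_sq T (\<lambda>t. ?s t - g t) = integral\<^sup>L ?M (\<lambda>t. ((norm (?s t))\<^sup>2 + (norm (g t))\<^sup>2) - 2 * (g t \<bullet> ?s t))"
    by (simp add: L2_sq_def)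
  also have "\<dots> = (L2_sq T ?s + L2_sq T g) - 2 * L2_sq T ?s"
    using int L2 step_fun_L2(1)[OF p, of "slope \<tau> \<phi>"] cross by (simp add: L2_def L2_sq_def)
  finally show ?thesis by simp
qed

lemma slopes_tendsto_L2:
  fixes \<phi> :: "real \<Rightarrow> 'a::euclidean_space"
  assumes p: "\<And>i. is_partition T (N i) (\<tau> i)" and mesh: "(\<lambda>i. mesh (N i) (\<tau> i)) \<longlonglongrightarrow> 0"
    and \<phi>: "has_L2_derivative T \<phi> g"
  shows "(\<lambda>i. L2_sq T (\<lambda>t. step_fun (N i) (\<tau> i) (slope (\<tau> i) \<phi>) t - g t)) \<longlonglongrightarrow> 0"
proof -
  let ?M = "lebesgue_on {0..T}"
  define s where "s i = step_fun (N i) (\<tau> i) (slope (\<tau> i) \<phi>)" for i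
  have L2: "L2 T g" using \<phi> by (simp add: has_L2_derivative_def)
  have L2s: "L2 T (s i)" for i unfolding s_def by (rule step_fun_L2(1)[OF p])
  have nn: "(\<integral>\<^sup>+t. ennreal ((norm (h t))\<^sup>2) \<partial>?M) = ennreal (L2_sq T h)" if "L2 T h" for h :: "real \<Rightarrow> 'a"
    using that unfolding L2_def L2_sq_def by (intro nn_integral_eq_integral) auto
  \<comment> \<open>Bessel's inequality. It bounds the limsup of the norms, while Fatou's lemma and
    pointwise convergence bound the liminf.\<close>
  have le: "L2_sq T (s i) \<le> L2_sq T g" for i
    using L2_sq_slopes_diff[OF p \<phi>, of i] L2_sq_nonneg[of T "\<lambda>t. s i t - g t"] by (simp add: s_def)
  have "AE t in ?M. (\<phi> has_vector_derivative g t) (at t within {0..T})"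
    using \<phi> by (simp add: has_L2_derivative_def)
  with AE_less_T have "AE t in ?M. ennreal ((norm (g t))\<^sup>2) = liminf (\<lambda>i. ennreal ((norm (s i t))\<^sup>2))"
  proof eventually_elim
    case (elim t)
    have "(\<lambda>i. s i t) \<longlonglongrightarrow> g t" unfolding s_def by (rule step_slopes_tendsto[OF p mesh elim])
    then have "(\<lambda>i. ennreal ((norm (s i t))\<^sup>2)) \<longlonglongrightarrow> ennreal ((norm (g t))\<^sup>2)"
      by (intro tendsto_ennrealI tendsto_intros)
    then show ?case by (rule lim_imp_Liminf[OF sequentially_bot, symmetric])
  qed
  then have "ennreal (L2_sq T g) = (\<integral>\<^sup>+t. liminf (\<lambda>i. ennreal ((norm (s i t))\<^sup>2)) \<partial>?M)"
    unfolding nn[OF L2, symmetric] by (rule nn_integral_cong_AE)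
  also have "\<dots> \<le> liminf (\<lambda>i. \<integral>\<^sup>+t. ennreal ((norm (s i t))\<^sup>2) \<partial>?M)"
    using L2s by (intro nn_integral_liminf) (auto simp: L2_def)
  finally have inf: "ennreal (L2_sq T g) \<le> liminf (\<lambda>i. ennreal (L2_sq T (s i)))"
    by (simp add: nn[OF L2s])
  have sup: "limsup (\<lambda>i. ennreal (L2_sq T (s i))) \<le> ennreal (L2_sq T g)"
    by (intro Limsup_bounded always_eventually allI ennreal_leI le)
  have "(\<lambda>i. ennreal (L2_sq T (s i))) \<longlonglongrightarrow> ennreal (L2_sq T g)"
    using inf sup Liminf_le_Limsup[of sequentially "\<lambda>i. ennreal (L2_sq T (s i))"]
    by (intro Liminf_eq_Limsup) auto
  then have "(\<lambda>i. L2_sq T (s i)) \<longlonglongrightarrow> L2_sq T g"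
    by (rule tendsto_ennrealD) (auto simp: L2_sq_nonneg)
  then have "(\<lambda>i. L2_sq T g - L2_sq T (s i)) \<longlonglongrightarrow> L2_sq T g - L2_sq T g"
    by (intro tendsto_intros)
  then show ?thesis
    unfolding s_def by (simp add: L2_sq_slopes_diff[OF p \<phi>])
qed

section \<open>Log-determinant and divergence\<close>

text \<open>One more factor \<open>1 - s * a x\<close> produces the new term
  \<open>s\<^sup>2 * (a x * Q)\<close> and multiplies the old error by at most \<open>1 + B\<close>.
  \<open>C\<close> is chosen before \<open>a\<close> and \<open>s\<close>, so that one constant
  serves all matrices with entries bounded by \<open>B\<close>.\<close>

lemma prod_one_minus_bound:
  fixes B :: real
  assumes "finite S" "B \<ge> 0"
  shows "\<exists>C\<ge>0. \<forall>(a :: 'i \<Rightarrow> real) s. 0 \<le> s \<longrightarrow> s \<le> 1 \<longrightarrow> (\<forall>i. \<bar>a i\<bar> \<le> B) \<longrightarrow>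
    \<bar>(\<Prod>i\<in>S. 1 - s * a i) - (1 - s * (\<Sum>i\<in>S. a i))\<bar> \<le> C * s\<^sup>2"
  using assms(1)
proof induction
  case empty
  show ?case by (intro exI[of _ 0]) auto
next
  case (insert x S)
  then obtain C where C: "C \<ge> 0" and *: "\<And>(a :: 'i \<Rightarrow> real) s. 0 \<le> s \<Longrightarrow> s \<le> 1 \<Longrightarrow> (\<forall>i. \<bar>a i\<bar> \<le> B) \<Longrightarrow>
    \<bar>(\<Prod>i\<in>S. 1 - s * a i) - (1 - s * (\<Sum>i\<in>S. a i))\<bar> \<le> C * s\<^sup>2"
    by blast
  show ?case
  proof (intro exI[of _ "B * (real (card S) * B) + (1 + B) * C"] conjI allI impI)
    show "0 \<le> B * (real (card S) * B) + (1 + B) * C" using C assms(2) by simp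
    fix a :: "'i \<Rightarrow> real" and s :: real
    assume s: "0 \<le> s" "s \<le> 1" and a: "\<forall>i. \<bar>a i\<bar> \<le> B"
    define P Q where "P = (\<Prod>i\<in>S. 1 - s * a i)" and "Q = (\<Sum>i\<in>S. a i)"
    have PQ: "\<bar>P - (1 - s * Q)\<bar> \<le> C * s\<^sup>2" using *[OF s a] by (simp add: P_def Q_def)
    have "\<bar>Q\<bar> \<le> (\<Sum>i\<in>S. \<bar>a i\<bar>)" unfolding Q_def by (rule sum_abs)
    also have "\<dots> \<le> real (card S) * B" using a by (intro sum_bounded_above) auto
    finally have Q: "\<bar>a x * Q\<bar> \<le> B * (real (card S) * B)"
      using a assms(2) by (auto simp: abs_mult intro!: mult_mono)
    have "\<bar>1 - s * a x\<bar> \<le> 1 + \<bar>s * a x\<bar>" by linarith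
    also have "\<bar>s * a x\<bar> \<le> 1 * B" unfolding abs_mult using a s assms(2) by (intro mult_mono) auto
    finally have "\<bar>(1 - s * a x) * (P - (1 - s * Q))\<bar> \<le> (1 + B) * (C * s\<^sup>2)"
      unfolding abs_mult using PQ assms(2) by (intro mult_mono) auto
    moreover have "\<bar>s\<^sup>2 * (a x * Q)\<bar> \<le> s\<^sup>2 * (B * (real (card S) * B))"
      unfolding abs_mult[of "s\<^sup>2"] using Q by (simp add: mult_left_mono)
    moreover have "(1 - s * a x) * P - (1 - s * (a x + Q)) = s\<^sup>2 * (a x * Q) + (1 - s * a x) * (P - (1 - s * Q))"
      by (simp add: algebra_simps power2_eq_square)
    ultimately have "\<bar>(1 - s * a x) * P - (1 - s * (a x + Q))\<bar> \<le> s\<^sup>2 * (B * (real (card S) * B)) + (1 + B) * (C * s\<^sup>2)"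
      by linarith
    then show "\<bar>(\<Prod>i\<in>insert x S. 1 - s * a i) - (1 - s * (\<Sum>i\<in>insert x S. a i))\<bar>
        \<le> (B * (real (card S) * B) + (1 + B) * C) * s\<^sup>2"
      using insert.hyps by (simp add: P_def Q_def algebra_simps)
  qed
qed

text \<open>In the Leibniz formula the identity contributes the product of the diagonal. Every other
  permutation picks at least two off-diagonal entries, each at most \<open>s * (1 + B)\<close>, and
  so contributes at order \<open>s\<^sup>2\<close>.\<close>

lemma det_one_minus_bound:
  fixes B :: real
  assumes B: "B \<ge> 0"
  shows "\<exists>C\<ge>0. \<forall>(A :: real^'n^'n) s. 0 \<le> s \<longrightarrow> s \<le> 1 \<longrightarrow> (\<forall>i j. \<bar>A $ i $ j\<bar> \<le> B) \<longrightarrow>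
    \<bar>det (mat 1 - s *\<^sub>R A) - (1 - s * trace A)\<bar> \<le> C * s\<^sup>2"
proof -
  let ?P = "{p :: 'n \<Rightarrow> 'n. p permutes UNIV}"
  obtain C where C: "C \<ge> 0" and *: "\<And>(a :: 'n \<Rightarrow> real) s. 0 \<le> s \<Longrightarrow> s \<le> 1 \<Longrightarrow> (\<forall>i. \<bar>a i\<bar> \<le> B) \<Longrightarrow>
    \<bar>(\<Prod>i\<in>UNIV. 1 - s * a i) - (1 - s * (\<Sum>i\<in>UNIV. a i))\<bar> \<le> C * s\<^sup>2"
    using prod_one_minus_bound[of "UNIV :: 'n set" B] B by auto
  define K where "K = (1 + B) ^ CARD('n)"
  have finP: "finite ?P" by (rule finite_permutations) simp
  show ?thesis
  proof (intro exI[of _ "C + real (card ?P) * K"] conjI allI impI)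
    show "0 \<le> C + real (card ?P) * K" using C B by (simp add: K_def)
    fix A :: "real^'n^'n" and s :: real
    assume s: "0 \<le> s" "s \<le> 1" and A: "\<forall>i j. \<bar>A $ i $ j\<bar> \<le> B"
    define M where "M = mat 1 - s *\<^sub>R A"
    define trm where "trm p = of_int (sign p) * (\<Prod>i\<in>UNIV. M $ i $ p i)" for p
    have off: "\<bar>M $ i $ j\<bar> \<le> s * (1 + B)" if "i \<noteq> j" for i j
    proof -
      have "\<bar>M $ i $ j\<bar> = s * \<bar>A $ i $ j\<bar>" using that s by (simp add: M_def mat_def abs_mult)
      also have "\<dots> \<le> s * (1 + B)" using A s by (intro mult_left_mono) (auto intro: order_trans[of _ B])
      finally show ?thesis .
    qed
    have any: "\<bar>M $ i $ j\<bar> \<le> 1 + B" for i j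
    proof (cases "i = j")
      case False
      have "s * (1 + B) \<le> 1 * (1 + B)" using s B by (intro mult_right_mono) auto
      then show ?thesis using off[OF False] by simp
    next
      case True
      have "\<bar>s * A $ i $ j\<bar> \<le> 1 * B" unfolding abs_mult using A s B by (intro mult_mono) auto
      then show ?thesis using True by (simp add: M_def mat_def)
    qed
    have nonid: "\<bar>trm p\<bar> \<le> K * s\<^sup>2" if p: "p \<in> ?P" "p \<noteq> id" for p
    proof -
      \<comment> \<open>Along with \<open>i\<close> its image \<open>j\<close> is moved, by
        injectivity; these rows supply the two off-diagonal factors.\<close>
      obtain i where i: "p i \<noteq> i" using p(2) by (auto simp: fun_eq_iff)
      define j where "j = p i"
      have inj: "inj p" using p(1) by (auto simp: permutes_inj)
      have j: "j \<noteq> i" "p j \<noteq> j" using i inj by (auto simp: j_def inj_def)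
      have "\<bar>trm p\<bar> = (\<Prod>k\<in>UNIV. \<bar>M $ k $ p k\<bar>)"
        by (simp add: trm_def abs_mult abs_prod sign_def)
      also have "\<dots> = \<bar>M $ i $ p i\<bar> * (\<bar>M $ j $ p j\<bar> * (\<Prod>k\<in>UNIV - {i} - {j}. \<bar>M $ k $ p k\<bar>))"
        using j(1) by (subst prod.remove[of UNIV i], simp, simp) (subst prod.remove[of "UNIV - {i}" j], auto)
      also have "\<dots> \<le> (s * (1 + B)) * ((s * (1 + B)) * (\<Prod>k\<in>UNIV - {i} - {j}. 1 + B))"
        using off[OF i[symmetric]] off[OF j(2)[symmetric]] any B s
        by (intro mult_mono prod_mono) (auto intro!: prod_nonneg mult_nonneg_nonneg)
      also have "(\<Prod>k\<in>UNIV - {i} - {j}. 1 + B) = (1 + B) ^ (CARD('n) - 2)"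
        using j(1) by (simp add: card_Diff_singleton numeral_2_eq_2)
      also have "(s * (1 + B)) * ((s * (1 + B)) * (1 + B) ^ (CARD('n) - 2)) = K * s\<^sup>2"
      proof -
        have "card {i, j} \<le> CARD('n)" by (intro card_mono) auto
        then have "CARD('n) = Suc (Suc (CARD('n) - 2))" using j(1) by simp
        then have "K = (1 + B) * ((1 + B) * (1 + B) ^ (CARD('n) - 2))"
          unfolding K_def by (metis power_Suc)
        then show ?thesis by (simp add: power2_eq_square)
      qed
      finally show ?thesis .
    qed
    have "id \<in> ?P" by (simp add: permutes_id)
    then have "det M = trm id + (\<Sum>p\<in>?P - {id}. trm p)"
      unfolding det_def trm_def using finP by (subst sum.remove[of ?P id]) auto
    moreover have "trm id = (\<Prod>i\<in>UNIV. 1 - s * A $ i $ i)"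
      by (simp add: trm_def M_def mat_def sign_id)
    moreover have "\<bar>(\<Prod>i\<in>UNIV. 1 - s * A $ i $ i) - (1 - s * trace A)\<bar> \<le> C * s\<^sup>2"
      using *[OF s, of "\<lambda>i. A $ i $ i"] A by (simp add: trace_def)
    moreover have "\<bar>\<Sum>p\<in>?P - {id}. trm p\<bar> \<le> real (card ?P) * K * s\<^sup>2"
    proof -
      have "\<bar>\<Sum>p\<in>?P - {id}. trm p\<bar> \<le> (\<Sum>p\<in>?P - {id}. \<bar>trm p\<bar>)" by (rule sum_abs)
      also have "\<dots> \<le> (\<Sum>p\<in>?P - {id}. K * s\<^sup>2)" using nonid by (intro sum_mono) auto
      also have "\<dots> \<le> (\<Sum>p\<in>?P. K * s\<^sup>2)" using finP B by (intro sum_mono2) (auto simp: K_def)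
      finally show ?thesis by simp
    qed
    ultimately show "\<bar>det (mat 1 - s *\<^sub>R A) - (1 - s * trace A)\<bar> \<le> (C + real (card ?P) * K) * s\<^sup>2"
      unfolding M_def[symmetric] by (simp add: distrib_right)
  qed
qed

text \<open>Let \<open>z\<close> be the determinant minus 1, a quantity of order \<open>s\<close>.
  For \<open>\<bar>z\<bar> \<le> 1/2\<close> the logarithm of \<open>1 + z\<close> differs from
  \<open>z\<close> by at most \<open>2 * z\<^sup>2\<close>. The threshold \<open>s0\<close> secures
  this bound on \<open>z\<close>, and with it a positive determinant.\<close>

lemma ln_det_one_minus_bound:
  fixes B :: real
  assumes B: "B \<ge> 0"
  shows "\<exists>C s0. s0 > 0 \<and> (\<forall>(A :: real^'n^'n) s. 0 \<le> s \<longrightarrow> s \<le> s0 \<longrightarrow> (\<forall>i j. \<bar>A $ i $ j\<bar> \<le> B) \<longrightarrow>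
    \<bar>ln (det (mat 1 - s *\<^sub>R A)) + s * trace A\<bar> \<le> C * s\<^sup>2)"
proof -
  obtain C where C: "C \<ge> 0" and *: "\<And>(A :: real^'n^'n) s. 0 \<le> s \<Longrightarrow> s \<le> 1 \<Longrightarrow> (\<forall>i j. \<bar>A $ i $ j\<bar> \<le> B) \<Longrightarrow>
    \<bar>det (mat 1 - s *\<^sub>R A) - (1 - s * trace A)\<bar> \<le> C * s\<^sup>2"
    using det_one_minus_bound[OF B] by blast
  \<comment> \<open>Designed for \<open>\<bar>z\<bar> \<le> s * D\<close>: the first summand bounds
    the trace and \<open>C\<close> the remainder. The 1 forces \<open>1 / (2 * D) \<le> 1\<close>,
    the range of the determinant estimate.\<close>
  define D where "D = real CARD('n) * B + C + 1"
  have D: "D \<ge> 1" using B C by (simp add: D_def)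
  show ?thesis
  proof (rule exI[of _ "C + 2 * D\<^sup>2"], rule exI[of _ "1 / (2 * D)"], intro conjI allI impI)
    show "1 / (2 * D) > 0" using D by simp
    fix A :: "real^'n^'n" and s :: real
    assume s: "0 \<le> s" "s \<le> 1 / (2 * D)" and A: "\<forall>i j. \<bar>A $ i $ j\<bar> \<le> B"
    have "1 / (2 * D) \<le> 1" using D by simp
    then have s1: "s \<le> 1" using s by linarith
    define z where "z = det (mat 1 - s *\<^sub>R A) - 1"
    have z1: "\<bar>z + s * trace A\<bar> \<le> C * s\<^sup>2" using *[OF s(1) s1 A] by (simp add: z_def algebra_simps)
    have "\<bar>trace A\<bar> \<le> (\<Sum>i\<in>UNIV. \<bar>A $ i $ i\<bar>)" unfolding trace_def by (rule sum_abs)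
    also have "\<dots> \<le> real CARD('n) * B" using A by (intro sum_bounded_above) auto
    finally have "\<bar>s * trace A\<bar> \<le> s * (real CARD('n) * B)"
      using s by (simp add: abs_mult mult_left_mono)
    moreover have "C * s\<^sup>2 \<le> C * s"
      using C s(1) s1 by (intro mult_left_mono) (auto simp: power2_eq_square mult_left_le)
    ultimately have "\<bar>z\<bar> \<le> s * (real CARD('n) * B) + C * s" using z1 by linarith
    also have "\<dots> \<le> s * D" using s by (simp add: D_def algebra_simps)
    finally have zD: "\<bar>z\<bar> \<le> s * D" .
    have "s * D \<le> 1 / (2 * D) * D" using s D by (intro mult_right_mono) auto
    then have "\<bar>z\<bar> \<le> 1/2" using zD D by simp
    then have "\<bar>ln (1 + z) - z\<bar> \<le> 2 * z\<^sup>2" by (rule abs_ln_one_plus_x_minus_x_bound)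
    also have "z\<^sup>2 \<le> (s * D)\<^sup>2" using zD by (metis abs_ge_zero power2_abs power_mono)
    finally have "\<bar>ln (1 + z) - z\<bar> \<le> 2 * (s * D)\<^sup>2" by simp
    with z1 have "\<bar>ln (1 + z) + s * trace A\<bar> \<le> C * s\<^sup>2 + 2 * (s * D)\<^sup>2" by linarith
    then show "\<bar>ln (det (mat 1 - s *\<^sub>R A)) + s * trace A\<bar> \<le> (C + 2 * D\<^sup>2) * s\<^sup>2"
      by (simp add: z_def algebra_simps power_mult_distrib)
  qed
qed

section \<open>Bounds and continuity for the Jacobian of the drift\<close>

lemma Jac_entry:
  assumes "(f t has_derivative f') (at x)"
  shows "Jac f t x $ i $ j = f' (axis j 1) $ i"
proof -
  have "f' = frechet_derivative (f t) (at x)" using assms by (rule frechet_derivative_at)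
  then show ?thesis by (simp add: Jac_def jacobian_def matrix_def)
qed

lemma C2b_uniform_Jac_bounded:
  fixes f :: "real \<Rightarrow> real^'n \<Rightarrow> real^'n"
  assumes "C2b_uniform f"
  obtains B where "B \<ge> 0" "\<And>t x i j. \<bar>Jac f t x $ i $ j\<bar> \<le> B"
proof -
  obtain f' f'' B where *: "\<forall>t. (\<forall>x. (f t has_derivative blinfun_apply (f' t x)) (at x)) \<and>
            (\<forall>x. (f' t has_derivative blinfun_apply (f'' t x)) (at x)) \<and>
            continuous_on UNIV (f'' t) \<and>
            (\<forall>x. norm (f t x) \<le> B \<and> norm (f' t x) \<le> B \<and> norm (f'' t x) \<le> B)"
    using assms unfolding C2b_uniform_def by (elim exE) (rule that)
  show ?thesis
  proof (rule that)
    show "B \<ge> 0" using * norm_ge_zero order_trans by blast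
    fix t x i j
    have "\<bar>Jac f t x $ i $ j\<bar> = \<bar>blinfun_apply (f' t x) (axis j 1) $ i\<bar>"
      using * by (subst Jac_entry) auto
    also have "\<dots> \<le> norm (blinfun_apply (f' t x) (axis j 1))" by (rule component_le_norm_cart)
    also have "\<dots> \<le> norm (f' t x) * norm (axis j (1::real))" by (rule norm_blinfun)
    also have "\<dots> \<le> B" using * by (simp add: norm_axis_1)
    finally show "\<bar>Jac f t x $ i $ j\<bar> \<le> B" .
  qed
qed

text \<open>Joint continuity of the Jacobian, assumed only for \<open>f\<close> itself: by the bound on the second
  derivative the difference quotients converge uniformly.\<close>

lemma C2b_uniform_divg_continuous:
  fixes f :: "real \<Rightarrow> real^'n \<Rightarrow> real^'n"
  assumes C2b: "C2b_uniform f" and cont: "continuous_on UNIV (\<lambda>(t, x). f t x)"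
  shows "continuous_on UNIV (\<lambda>(t, x). divg f t x)"
proof -
  obtain f' f'' B where *: "\<forall>t. (\<forall>x. (f t has_derivative blinfun_apply (f' t x)) (at x)) \<and>
            (\<forall>x. (f' t has_derivative blinfun_apply (f'' t x)) (at x)) \<and>
            continuous_on UNIV (f'' t) \<and>
            (\<forall>x. norm (f t x) \<le> B \<and> norm (f' t x) \<le> B \<and> norm (f'' t x) \<le> B)"
    using C2b unfolding C2b_uniform_def by (elim exE) (rule that)
  have B: "B \<ge> 0" using * norm_ge_zero order_trans by blast
  have d1: "(f t has_derivative blinfun_apply (f' t x)) (at x)" for t x using * by blast
  have lip: "norm (f' t y - f' t x) \<le> B * norm (y - x)" for t x y
  proof (rule differentiable_bound[of UNIV "f' t" "\<lambda>x. blinfun_apply (f'' t x)"])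
    show "onorm (blinfun_apply (f'' t x)) \<le> B" for x using * by (simp add: norm_blinfun.rep_eq[symmetric])
  qed (use * in auto)
  \<comment> \<open>A Taylor remainder whose constant depends on neither \<open>t\<close> nor
    \<open>x\<close>; this makes the convergence of the difference quotients uniform.\<close>
  have rem: "norm (f t (x + h) - f t x - blinfun_apply (f' t x) h) \<le> B * norm h * norm h" for t x h
  proof -
    have "norm (f t (x + h) - f t x - blinfun_apply (f' t x) (x + h - x)) \<le> norm (x + h - x) * (B * norm h)"
    proof (rule differentiable_bound_linearization[of x "x + h" "cball x (norm h)" "f t" "\<lambda>x. blinfun_apply (f' t x)" x])
      show "x + s *\<^sub>R (x + h - x) \<in> cball x (norm h)" if "s \<in> {0..1}" for s
        using that by (auto simp: dist_norm intro: mult_left_le_one_le)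
      show "(f t has_derivative blinfun_apply (f' t y)) (at y within cball x (norm h))" for y
        using d1 by (rule has_derivative_at_withinI)
      fix y assume y: "y \<in> cball x (norm h)"
      have "norm (f' t y - f' t x) \<le> B * norm (y - x)" by (rule lip)
      also have "\<dots> \<le> B * norm h"
        using B y by (intro mult_left_mono) (auto simp: dist_norm norm_minus_commute)
      finally show "onorm (blinfun_apply (f' t y) - blinfun_apply (f' t x)) \<le> B * norm h"
        by (simp add: norm_blinfun.rep_eq minus_blinfun.rep_eq fun_diff_def)
    qed simp
    then show ?thesis by (simp add: mult_ac)
  qed
  have dir: "continuous_on UNIV (\<lambda>(t, x). blinfun_apply (f' t x) v)" for v
  proof (rule uniform_limit_theorem)
    let ?q = "\<lambda>n p. real (Suc n) *\<^sub>R (f (fst p) (snd p + (1 / real (Suc n)) *\<^sub>R v) - f (fst p) (snd p))"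
    have cf: "continuous_on UNIV (\<lambda>p. f (fst p) (snd p + w))" for w
      by (rule continuous_on_compose2[OF cont, of UNIV "\<lambda>p. (fst p, snd p + w)", simplified])
         (intro continuous_intros)
    show "\<forall>\<^sub>F n in sequentially. continuous_on UNIV (?q n)"
      using cf[of 0] by (intro always_eventually allI continuous_intros cf) simp
    show "uniform_limit UNIV ?q (\<lambda>(t, x). blinfun_apply (f' t x) v) sequentially"
    proof (rule uniform_limitI)
      fix e :: real assume e: "e > 0"
      obtain n0 where n0: "B * norm v * norm v / e < real n0" using reals_Archimedean2 by blast
      show "\<forall>\<^sub>F n in sequentially. \<forall>p\<in>UNIV. dist (?q n p) ((\<lambda>(t, x). blinfun_apply (f' t x) v) p) < e"
        unfolding eventually_sequentially
      proof (intro exI[of _ n0] allI impI ballI)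
        fix n and p :: "real \<times> (real^'n)" assume n: "n \<ge> n0"
        obtain t x where p: "p = (t, x)" by (cases p)
        define m where "m = real (Suc n)"
        have m: "m > 0" by (simp add: m_def)
        have "?q n p = m *\<^sub>R (f t (x + (1/m) *\<^sub>R v) - f t x)" unfolding p m_def by simp
        then have "?q n p - blinfun_apply (f' t x) v = m *\<^sub>R (f t (x + (1/m) *\<^sub>R v) - f t x - blinfun_apply (f' t x) ((1/m) *\<^sub>R v))"
          using m by (simp only: blinfun.scaleR_right scaleR_diff_right) simp
        then have "norm (?q n p - blinfun_apply (f' t x) v) = m * norm (f t (x + (1/m) *\<^sub>R v) - f t x - blinfun_apply (f' t x) ((1/m) *\<^sub>R v))"
          using m by simp
        also have "\<dots> \<le> m * (B * norm ((1/m) *\<^sub>R v) * norm ((1/m) *\<^sub>R v))"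
          using m by (intro mult_left_mono rem) auto
        also have "\<dots> = B * norm v * norm v / m" using m by (simp add: field_simps)
        also have "\<dots> < e"
        proof -
          have "B * norm v * norm v / e < m" using n0 n by (simp add: m_def)
          then show ?thesis using m e by (simp add: field_simps)
        qed
        finally show "dist (?q n p) ((\<lambda>(t, x). blinfun_apply (f' t x) v) p) < e"
          by (simp add: p dist_norm)
      qed
    qed
  qed simp
  \<comment> \<open>The trace is the sum of components of directional derivatives along the axes,
    each of which is jointly continuous by \<open>dir\<close>.\<close>
  have eq: "(\<lambda>(t, x). divg f t x) = (\<lambda>p. \<Sum>i\<in>UNIV. (\<lambda>(t, x). blinfun_apply (f' t x) (axis i 1)) p $ i)"
    using Jac_entry[OF d1] by (auto simp: fun_eq_iff divg_def trace_def)
  show ?thesis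
    unfolding eq by (intro continuous_on_sum continuous_on_component dir)
qed

section \<open>Convergence of the discretized merits\<close>

lemma continuous_L2:
  fixes u :: "real \<Rightarrow> 'a::euclidean_space"
  assumes "continuous_on {0..T} u"
  shows "L2 T u"
proof -
  have "continuous_on {0..T} (\<lambda>t. (norm (u t))\<^sup>2)" by (intro continuous_intros assms)
  then have "integrable (lebesgue_on {0..T}) (\<lambda>t. (norm (u t))\<^sup>2)"
    by (intro absolutely_integrable_imp_integrable absolutely_integrable_continuous_real) auto
  moreover have "u \<in> borel_measurable (lebesgue_on {0..T})"
    by (intro continuous_imp_measurable_on_sets_lebesgue assms) auto
  ultimately show ?thesis by (simp add: L2_def)
qed

text \<open>The real \<open>sqrt\<close> is odd, so the square of \<open>sqrt a\<close> is
  \<open>\<bar>a\<bar>\<close> for every real \<open>a\<close>.\<close>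

lemma Qnorm_sq: "(Qnorm G x)\<^sup>2 = \<bar>x \<bullet> (Qmat G *v x)\<bar>"
  by (simp add: Qnorm_def power2_eq_square)

text \<open>With \<open>d = x - y\<close>, the mixed terms of the quadratic form are split by
  Young's inequality with weight \<open>e\<close>. A small \<open>e\<close> tames the term in the
  fixed \<open>y\<close>; the large factor \<open>1/e\<close> meets the square of
  \<open>x - y\<close>, whose integral will tend to 0.\<close>

lemma Qnorm_sq_diff_bound:
  fixes G :: "real^'n^'n"
  obtains C where "C \<ge> 0" "\<And>x. (Qnorm G x)\<^sup>2 \<le> C * (norm x)\<^sup>2"
    "\<And>x y e. e > 0 \<Longrightarrow> \<bar>(Qnorm G x)\<^sup>2 - (Qnorm G y)\<^sup>2\<bar>
        \<le> C * ((1 + 1/e) * (norm (x - y))\<^sup>2 + e * (norm y)\<^sup>2)"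
proof -
  let ?A = "Qmat G"
  obtain K where K: "\<And>x. norm (?A *v x) \<le> norm x * K" "K > 0"
    using bounded_linear.pos_bounded[OF matrix_vector_mul_bounded_linear[of ?A]] by auto
  have ip: "\<bar>x \<bullet> (?A *v y)\<bar> \<le> K * (norm x * norm y)" for x y
  proof -
    have "\<bar>x \<bullet> (?A *v y)\<bar> \<le> norm x * norm (?A *v y)" by (rule Cauchy_Schwarz_ineq2)
    also have "\<dots> \<le> norm x * (norm y * K)" by (intro mult_left_mono K) auto
    finally show ?thesis by (simp add: mult_ac)
  qed
  show ?thesis
  proof (rule that)
    show "K \<ge> 0" using K(2) by simp
    show "(Qnorm G x)\<^sup>2 \<le> K * (norm x)\<^sup>2" for x
      using ip[of x x] unfolding Qnorm_sq by (simp add: power2_eq_square)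
    fix x y :: "real^'n" and e :: real assume e: "e > 0"
    define d where "d = x - y"
    have x: "x = y + d" by (simp add: d_def)
    have "x \<bullet> (?A *v x) - y \<bullet> (?A *v y) = d \<bullet> (?A *v d) + d \<bullet> (?A *v y) + y \<bullet> (?A *v d)"
      by (simp add: x matrix_vector_right_distrib algebra_simps)
    then have "\<bar>(Qnorm G x)\<^sup>2 - (Qnorm G y)\<^sup>2\<bar> \<le> K * (norm d * norm d) + K * (norm d * norm y) + K * (norm y * norm d)"
      unfolding Qnorm_sq using ip[of d d] ip[of d y] ip[of y d] by linarith
    also have "\<dots> = K * ((norm d)\<^sup>2 + 2 * norm d * norm y)"
      by (simp add: power2_eq_square algebra_simps)
    also have "\<dots> \<le> K * ((1 + 1/e) * (norm d)\<^sup>2 + e * (norm y)\<^sup>2)"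
    proof -
      have "0 \<le> (norm d - e * norm y)\<^sup>2 / e" using e by simp
      also have "\<dots> = (1/e) * (norm d)\<^sup>2 - 2 * norm d * norm y + e * (norm y)\<^sup>2"
        using e by (simp add: power2_eq_square field_simps)
      finally show ?thesis using K(2) by (intro mult_left_mono) (auto simp: algebra_simps)
    qed
    finally show "\<bar>(Qnorm G x)\<^sup>2 - (Qnorm G y)\<^sup>2\<bar> \<le> K * ((1 + 1/e) * (norm (x - y))\<^sup>2 + e * (norm y)\<^sup>2)"
      by (simp add: d_def)
  qed
qed

lemma Qnorm_sq_measurable:
  "a \<in> borel_measurable M \<Longrightarrow> (\<lambda>t. (Qnorm G (a t))\<^sup>2) \<in> borel_measurable M"
  unfolding Qnorm_sq
  by (rule borel_measurable_continuous_on[of "\<lambda>x. \<bar>x \<bullet> (Qmat G *v x)\<bar>"])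
     (intro continuous_intros linear_continuous_on matrix_vector_mul_bounded_linear)

lemma Qnorm_sq_integrable:
  assumes a: "L2 T a"
  shows "integrable (lebesgue_on {0..T}) (\<lambda>t. (Qnorm G (a t))\<^sup>2)"
proof -
  obtain C where C: "C \<ge> 0" "\<And>x. (Qnorm G x)\<^sup>2 \<le> C * (norm x)\<^sup>2"
    using Qnorm_sq_diff_bound[of G] by metis
  show ?thesis
  proof (rule Bochner_Integration.integrable_bound)
    show "integrable (lebesgue_on {0..T}) (\<lambda>t. C * (norm (a t))\<^sup>2)" using a by (simp add: L2_def)
    show "(\<lambda>t. (Qnorm G (a t))\<^sup>2) \<in> borel_measurable (lebesgue_on {0..T})"
      using a by (intro Qnorm_sq_measurable) (simp add: L2_def)
  qed (use C in auto)
qed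

lemma Qnorm_sq_integral_tendsto:
  assumes a: "L2 T a" and b: "\<And>j. L2 T (b j)"
    and lim: "(\<lambda>j. L2_sq T (\<lambda>t. b j t - a t)) \<longlonglongrightarrow> 0"
  shows "(\<lambda>j. integral\<^sup>L (lebesgue_on {0..T}) (\<lambda>t. (Qnorm G (b j t))\<^sup>2))
      \<longlonglongrightarrow> integral\<^sup>L (lebesgue_on {0..T}) (\<lambda>t. (Qnorm G (a t))\<^sup>2)"
proof (rule LIMSEQ_I)
  let ?M = "lebesgue_on {0..T}"
  fix e :: real assume e: "e > 0"
  obtain C where C: "C \<ge> 0" and
    Cd: "\<And>x y e. e > 0 \<Longrightarrow> \<bar>(Qnorm G x)\<^sup>2 - (Qnorm G y)\<^sup>2\<bar>
        \<le> C * ((1 + 1/e) * (norm (x - y))\<^sup>2 + e * (norm y)\<^sup>2)"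
    using Qnorm_sq_diff_bound[of G] by metis
  define S where "S = C * L2_sq T a + 1"
  have S: "S > 0" using C L2_sq_nonneg[of T a] by (simp add: S_def add_nonneg_pos)
  \<comment> \<open>The order of choices matters: \<open>c\<close> makes the term with the fixed
    \<open>a\<close> at most \<open>e/2\<close>; then \<open>K\<close>, which grows with
    \<open>1/c\<close>, determines how close \<open>b j\<close> must be to \<open>a\<close>. The
    ones added in \<open>S\<close> and \<open>K\<close> ensure positivity.\<close>
  define c where "c = e / (2 * S)"
  have c: "c > 0" using e S by (simp add: c_def)
  define K where "K = C * (1 + 1/c) + 1"
  have K: "K > 0" using C c by (simp add: K_def add_nonneg_pos)
  obtain n0 where n0: "\<And>j. j \<ge> n0 \<Longrightarrow> norm (L2_sq T (\<lambda>t. b j t - a t) - 0) < e / (2 * K)"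
    using LIMSEQ_D[OF lim, of "e / (2 * K)"] e K by auto
  show "\<exists>n0. \<forall>j\<ge>n0. norm (integral\<^sup>L ?M (\<lambda>t. (Qnorm G (b j t))\<^sup>2) - integral\<^sup>L ?M (\<lambda>t. (Qnorm G (a t))\<^sup>2)) < e"
  proof (intro exI[of _ n0] allI impI)
    fix j assume j: "j \<ge> n0"
    have L2d: "L2 T (\<lambda>t. b j t - a t)" by (rule L2_diff[OF b a])
    have ib: "integrable ?M (\<lambda>t. (Qnorm G (b j t))\<^sup>2)" and ia: "integrable ?M (\<lambda>t. (Qnorm G (a t))\<^sup>2)"
      by (rule Qnorm_sq_integrable[OF b], rule Qnorm_sq_integrable[OF a])
    have i1: "integrable ?M (\<lambda>t. (norm (b j t - a t))\<^sup>2)" and i2: "integrable ?M (\<lambda>t. (norm (a t))\<^sup>2)"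
      using L2d a by (auto simp: L2_def)
    have "norm (integral\<^sup>L ?M (\<lambda>t. (Qnorm G (b j t))\<^sup>2) - integral\<^sup>L ?M (\<lambda>t. (Qnorm G (a t))\<^sup>2))
        = norm (integral\<^sup>L ?M (\<lambda>t. (Qnorm G (b j t))\<^sup>2 - (Qnorm G (a t))\<^sup>2))"
      using ib ia by simp
    also have "\<dots> \<le> integral\<^sup>L ?M (\<lambda>t. norm ((Qnorm G (b j t))\<^sup>2 - (Qnorm G (a t))\<^sup>2))"
      by (rule integral_norm_bound)
    also have "\<dots> \<le> integral\<^sup>L ?M (\<lambda>t. C * ((1 + 1/c) * (norm (b j t - a t))\<^sup>2 + c * (norm (a t))\<^sup>2))"
      using ib ia i1 i2 Cd[OF c] by (intro integral_mono) auto
    also have "\<dots> = C * ((1 + 1/c) * L2_sq T (\<lambda>t. b j t - a t) + c * L2_sq T a)"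
      using i1 i2 by (simp add: L2_sq_def)
    also have "\<dots> = (C * (1 + 1/c)) * L2_sq T (\<lambda>t. b j t - a t) + c * (C * L2_sq T a)"
      by (simp add: algebra_simps)
    also have "\<dots> \<le> K * L2_sq T (\<lambda>t. b j t - a t) + c * S"
      using c L2_sq_nonneg[of T "\<lambda>t. b j t - a t"] by (intro add_mono mult_right_mono mult_left_mono) (auto simp: K_def S_def)
    also have "\<dots> < e / 2 + e / 2"
    proof (rule add_less_le_mono)
      show "K * L2_sq T (\<lambda>t. b j t - a t) < e / 2"
        using n0[OF j] K L2_sq_nonneg[of T "\<lambda>t. b j t - a t"] by (simp add: field_simps)
      show "c * S \<le> e / 2" using S by (simp add: c_def)
    qed
    finally show "norm (integral\<^sup>L ?M (\<lambda>t. (Qnorm G (b j t))\<^sup>2) - integral\<^sup>L ?M (\<lambda>t. (Qnorm G (a t))\<^sup>2)) < e"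
      by simp
  qed
qed

text \<open>Cell values approximate \<open>u\<close> uniformly on whole cells. This single notion
  feeds both the mean-square limits of step functions and the limits of Riemann sums; closed cells
  admit samples at either end.\<close>

definition cellwise_limit ::
  "(nat \<Rightarrow> nat) \<Rightarrow> (nat \<Rightarrow> nat \<Rightarrow> real) \<Rightarrow> (nat \<Rightarrow> nat \<Rightarrow> 'b::real_normed_vector) \<Rightarrow> (real \<Rightarrow> 'b) \<Rightarrow> bool" where
  "cellwise_limit N \<tau> v u \<longleftrightarrow> (\<forall>e>0. \<forall>\<^sub>F i in sequentially.
     \<forall>k<N i. \<forall>t\<in>{\<tau> i k..\<tau> i (Suc k)}. norm (v i k - u t) \<le> e)"

text \<open>Eventually all the graphs lie in one compact set, on which \<open>h\<close> is uniformly
  continuous. The distance of the arguments splits into a time difference bounded by the mesh, the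
  modulus of continuity of \<phi>, and the uniform distance of the paths, a third of
  \<open>d\<close> each. The sampling points \<open>s i k\<close> are left free: the schemes use
  left and right nodes.\<close>

lemma cellwise_limit_nodes:
  fixes \<phi> :: "real \<Rightarrow> 'a::euclidean_space" and h :: "real \<times> 'a \<Rightarrow> 'b::real_normed_vector"
  assumes p: "\<And>i. is_partition T (N i) (\<tau> i)" and mesh: "(\<lambda>i. mesh (N i) (\<tau> i)) \<longlonglongrightarrow> 0"
    and cont: "continuous_on {0..T} \<phi>" and h: "continuous_on UNIV h"
    and conv: "uniform_limit {0..T} \<phi>s \<phi> sequentially"
    and s: "\<And>i k. k < N i \<Longrightarrow> s i k \<in> {\<tau> i k..\<tau> i (Suc k)}"
  shows "cellwise_limit N \<tau> (\<lambda>i k. h (s i k, \<phi>s i (s i k))) (\<lambda>t. h (t, \<phi> t))"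
  unfolding cellwise_limit_def
proof (intro allI impI)
  fix e :: real assume e: "e > 0"
  obtain R where R: "\<And>t. t \<in> {0..T} \<Longrightarrow> norm (\<phi> t) \<le> R"
    using compact_imp_bounded[OF compact_continuous_image[OF cont compact_Icc]]
    unfolding bounded_iff by (metis imageI)
  \<comment> \<open>The radius \<open>R + 1\<close> holds the limit path and every path within
    distance 1 of it.\<close>
  let ?K = "{0..T} \<times> cball 0 (R + 1)"
  have "uniformly_continuous_on ?K h"
    by (intro compact_uniformly_continuous continuous_on_subset[OF h] compact_Times) auto
  then obtain d where d: "d > 0" and
    D: "\<And>z z'. z \<in> ?K \<Longrightarrow> z' \<in> ?K \<Longrightarrow> dist z' z < d \<Longrightarrow> dist (h z') (h z) < e"
    unfolding uniformly_continuous_on_def using e by metis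
  have "uniformly_continuous_on {0..T} \<phi>"
    by (intro compact_uniformly_continuous cont) auto
  then obtain d1 where d1: "d1 > 0" and
    D1: "\<And>t t'. t \<in> {0..T} \<Longrightarrow> t' \<in> {0..T} \<Longrightarrow> dist t' t < d1 \<Longrightarrow> dist (\<phi> t') (\<phi> t) < d / 3"
    unfolding uniformly_continuous_on_def using d by (metis divide_pos_pos zero_less_numeral)
  have ev1: "\<forall>\<^sub>F i in sequentially. norm (mesh (N i) (\<tau> i)) < min d1 (d/3)"
    using tendstoD[OF mesh, of "min d1 (d/3)"] d d1 by simp
  have ev2: "\<forall>\<^sub>F i in sequentially. \<forall>t\<in>{0..T}. dist (\<phi>s i t) (\<phi> t) < min 1 (d/3)"
    using uniform_limitD[OF conv, of "min 1 (d/3)"] d by simp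
  show "\<forall>\<^sub>F i in sequentially. \<forall>k<N i. \<forall>t\<in>{\<tau> i k..\<tau> i (Suc k)}.
      norm (h (s i k, \<phi>s i (s i k)) - h (t, \<phi> t)) \<le> e"
    using ev1 ev2
  proof eventually_elim
    case (elim i)
    show ?case
    proof (intro allI impI ballI)
      fix k t assume k: "k < N i" and t: "t \<in> {\<tau> i k..\<tau> i (Suc k)}"
      define r where "r = s i k"
      have sub: "{\<tau> i k..\<tau> i (Suc k)} \<subseteq> {0..T}"
        using partition_mem[OF p, of k i] partition_mem[OF p, of "Suc k" i] k by auto
      have r: "r \<in> {\<tau> i k..\<tau> i (Suc k)}" using s[OF k] by (simp add: r_def)
      have r0: "r \<in> {0..T}" and t0: "t \<in> {0..T}" using r t sub by auto
      have "\<bar>r - t\<bar> \<le> step (\<tau> i) k" using r t by (auto simp: step_def)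
      then have rt: "\<bar>r - t\<bar> < min d1 (d/3)" using step_le_mesh[OF k, of "\<tau> i"] elim(1) by simp
      have a: "dist (\<phi>s i r) (\<phi> r) < min 1 (d/3)" using elim(2) r0 by blast
      have "norm (\<phi>s i r) \<le> R + 1"
        using a R[OF r0] norm_triangle_sub[of "\<phi>s i r" "\<phi> r"] by (simp add: dist_norm)
      then have m1: "(r, \<phi>s i r) \<in> ?K" using r0 by simp
      have m2: "(t, \<phi> t) \<in> ?K" using t0 R[OF t0] by simp
      have b: "dist (\<phi> r) (\<phi> t) < d/3" using D1[OF t0 r0] rt by (simp add: dist_real_def)
      have "dist (r, \<phi>s i r) (t, \<phi> t) \<le> dist r t + dist (\<phi>s i r) (\<phi> t)"
        unfolding dist_Pair_Pair by (rule sqrt_sum_squares_le_sum) auto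
      also have "\<dots> < d"
        using dist_triangle[of "\<phi>s i r" "\<phi> t" "\<phi> r"] a b rt by (simp add: dist_real_def)
      finally have "dist (h (r, \<phi>s i r)) (h (t, \<phi> t)) < e" by (rule D[OF m2 m1])
      then show "norm (h (s i k, \<phi>s i (s i k)) - h (t, \<phi> t)) \<le> e" by (simp add: dist_norm r_def)
    qed
  qed
qed

lemma cellwise_limit_L2_sq:
  fixes u :: "real \<Rightarrow> 'a::euclidean_space"
  assumes p: "\<And>i. is_partition T (N i) (\<tau> i)" and T: "T > 0"
    and u: "L2 T u" and v: "cellwise_limit N \<tau> v u"
  shows "(\<lambda>i. L2_sq T (\<lambda>t. step_fun (N i) (\<tau> i) (v i) t - u t)) \<longlonglongrightarrow> 0"
proof (rule LIMSEQ_I)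
  fix e :: real assume e: "e > 0"
  \<comment> \<open>Gives \<open>c\<^sup>2 * T = e / 2\<close>.\<close>
  define c where "c = sqrt (e / (2 * T))"
  have c: "c > 0" using e T by (simp add: c_def)
  interpret finite_measure "lebesgue_on {0..T}" by (rule finite_measure_lebesgue_on_Icc)
  have mT: "measure (lebesgue_on {0..T}) {0..T} = T"
    using T by (simp add: measure_restrict_space)
  obtain i0 where i0: "\<And>i k t. i \<ge> i0 \<Longrightarrow> k < N i \<Longrightarrow> t \<in> {\<tau> i k..\<tau> i (Suc k)} \<Longrightarrow> norm (v i k - u t) \<le> c"
    using v c unfolding cellwise_limit_def eventually_sequentially by metis
  show "\<exists>n0. \<forall>i\<ge>n0. norm (L2_sq T (\<lambda>t. step_fun (N i) (\<tau> i) (v i) t - u t) - 0) < e"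
  proof (intro exI[of _ i0] allI impI)
    fix i assume i: "i \<ge> i0"
    have L2d: "L2 T (\<lambda>t. step_fun (N i) (\<tau> i) (v i) t - u t)" by (rule L2_diff[OF step_fun_L2(1)[OF p] u])
    have "AE t in lebesgue_on {0..T}. (norm (step_fun (N i) (\<tau> i) (v i) t - u t))\<^sup>2 \<le> c\<^sup>2"
      using AE_less_T
    proof eventually_elim
      case (elim t)
      from partition_cover[OF p elim] obtain k where k: "k < N i" "t \<in> {\<tau> i k..<\<tau> i (Suc k)}" by blast
      have "norm (v i k - u t) \<le> c" using i0[OF i k(1)] k(2) by simp
      then show ?case using step_fun_eq[OF p k, of "v i"] by (simp add: power_mono)
    qed
    then have "L2_sq T (\<lambda>t. step_fun (N i) (\<tau> i) (v i) t - u t) \<le> integral\<^sup>L (lebesgue_on {0..T}) (\<lambda>t. c\<^sup>2)"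
      unfolding L2_sq_def using L2d by (intro integral_mono_AE) (auto simp: L2_def)
    also have "\<dots> = e / 2" using mT T e by (simp add: c_def)
    also have "\<dots> < e" using e by simp
    finally show "norm (L2_sq T (\<lambda>t. step_fun (N i) (\<tau> i) (v i) t - u t) - 0) < e"
      using L2_sq_nonneg[of T "\<lambda>t. step_fun (N i) (\<tau> i) (v i) t - u t"] by simp
  qed
qed

lemma cellwise_limit_Riemann_sum:
  fixes u :: "real \<Rightarrow> real"
  assumes p: "\<And>i. is_partition T (N i) (\<tau> i)" and T: "T > 0"
    and u: "L2 T u" and v: "cellwise_limit N \<tau> v u"
  shows "(\<lambda>i. \<Sum>k<N i. step (\<tau> i) k * v i k) \<longlonglongrightarrow> integral\<^sup>L (lebesgue_on {0..T}) u"
proof (rule LIMSEQ_I)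
  fix e :: real assume e: "e > 0"
  let ?M = "lebesgue_on {0..T}"
  define c where "c = e / (2 * T)"
  have c: "c > 0" using e T by (simp add: c_def)
  interpret finite_measure ?M by (rule finite_measure_lebesgue_on_Icc)
  have mT: "measure ?M {0..T} = T"
    using T by (simp add: measure_restrict_space)
  obtain i0 where i0: "\<And>i k t. i \<ge> i0 \<Longrightarrow> k < N i \<Longrightarrow> t \<in> {\<tau> i k..\<tau> i (Suc k)} \<Longrightarrow> norm (v i k - u t) \<le> c"
    using v c unfolding cellwise_limit_def eventually_sequentially by metis
  show "\<exists>n0. \<forall>i\<ge>n0. norm ((\<Sum>k<N i. step (\<tau> i) k * v i k) - integral\<^sup>L ?M u) < e"
  proof (intro exI[of _ i0] allI impI)
    fix i assume i: "i \<ge> i0"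
    have ist: "integrable ?M (step_fun (N i) (\<tau> i) (v i))" by (rule step_fun_integral(1)[OF p])
    have iu: "integrable ?M u" by (rule L2_integrable[OF u])
    have ae: "AE t in ?M. norm (step_fun (N i) (\<tau> i) (v i) t - u t) \<le> c"
      using AE_less_T
    proof eventually_elim
      case (elim t)
      from partition_cover[OF p elim] obtain k where k: "k < N i" "t \<in> {\<tau> i k..<\<tau> i (Suc k)}" by blast
      have "norm (v i k - u t) \<le> c" using i0[OF i k(1)] k(2) by simp
      then show ?case using step_fun_eq[OF p k, of "v i"] by simp
    qed
    have "(\<Sum>k<N i. step (\<tau> i) k * v i k) - integral\<^sup>L ?M u = integral\<^sup>L ?M (\<lambda>t. step_fun (N i) (\<tau> i) (v i) t - u t)"
      using ist iu step_fun_integral(2)[OF p, of i "v i"] by simp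
    also have "norm \<dots> \<le> integral\<^sup>L ?M (\<lambda>t. norm (step_fun (N i) (\<tau> i) (v i) t - u t))"
      by (rule integral_norm_bound)
    also have "\<dots> \<le> integral\<^sup>L ?M (\<lambda>t. c)"
      using ist iu ae by (intro integral_mono_AE) auto
    also have "\<dots> = e / 2" using mT T by (simp add: c_def)
    also have "\<dots> < e" using e by simp
    finally show "norm ((\<Sum>k<N i. step (\<tau> i) k * v i k) - integral\<^sup>L ?M u) < e" .
  qed
qed

section \<open>Limits of the Euler and trapezoidal merits\<close>

lemma H_norm_pl_diff:
  assumes T: "T > 0" and p: "is_partition T N \<tau>" and \<phi>: "has_L2_derivative T \<phi> g"
    and \<psi>: "\<psi> \<in> pl_space T N \<tau>"
  shows "has_L2_derivative T (\<lambda>t. \<psi> t - \<phi> t) (\<lambda>t. step_fun N \<tau> (slope \<tau> \<psi>) t - g t)"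
    "(H_norm T (\<lambda>t. \<psi> t - \<phi> t))\<^sup>2 = (norm (\<psi> 0 - \<phi> 0))\<^sup>2 + L2_sq T (\<lambda>t. step_fun N \<tau> (slope \<tau> \<psi>) t - g t)"
proof -
  show 1: "has_L2_derivative T (\<lambda>t. \<psi> t - \<phi> t) (\<lambda>t. step_fun N \<tau> (slope \<tau> \<psi>) t - g t)"
    by (rule has_L2_derivative_diff[OF pl_space_has_L2_derivative[OF p \<psi>] \<phi>])
  show "(H_norm T (\<lambda>t. \<psi> t - \<phi> t))\<^sup>2 = (norm (\<psi> 0 - \<phi> 0))\<^sup>2 + L2_sq T (\<lambda>t. step_fun N \<tau> (slope \<tau> \<psi>) t - g t)"
    using H_inner_eq[OF T 1] L2_sq_nonneg[of T "\<lambda>t. step_fun N \<tau> (slope \<tau> \<psi>) t - g t"]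
    by (simp add: H_norm_def)
qed

lemma H_norm_pl_tendsto:
  assumes T: "T > 0" and p: "\<And>i. is_partition T (N i) (\<tau> i)"
    and \<phi>: "has_L2_derivative T \<phi> g" and pl: "\<And>i. \<phi>s i \<in> pl_space T (N i) (\<tau> i)"
    and lim: "(\<lambda>i. H_norm T (\<lambda>t. \<phi>s i t - \<phi> t)) \<longlonglongrightarrow> 0"
  shows "uniform_limit {0..T} \<phi>s \<phi> sequentially"
    "(\<lambda>i. L2_sq T (\<lambda>t. step_fun (N i) (\<tau> i) (slope (\<tau> i) (\<phi>s i)) t - g t)) \<longlonglongrightarrow> 0"
proof -
  show "uniform_limit {0..T} \<phi>s \<phi> sequentially"
  proof (rule uniform_limitI)
    fix e :: real assume e: "e > 0"
    have "(\<lambda>i. (2 + T) * H_norm T (\<lambda>t. \<phi>s i t - \<phi> t)) \<longlonglongrightarrow> (2 + T) * 0"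
      by (intro tendsto_intros lim)
    then have "\<forall>\<^sub>F i in sequentially. (2 + T) * H_norm T (\<lambda>t. \<phi>s i t - \<phi> t) < e"
      using e by (intro order_tendstoD(2)) auto
    then show "\<forall>\<^sub>F i in sequentially. \<forall>t\<in>{0..T}. dist (\<phi>s i t) (\<phi> t) < e"
    proof eventually_elim
      case (elim i)
      show ?case
      proof
        fix t assume "t \<in> {0..T}"
        from norm_path_le_H_norm[OF T H_norm_pl_diff(1)[OF T p \<phi> pl[of i]] this] elim
        show "dist (\<phi>s i t) (\<phi> t) < e" by (simp add: dist_norm)
      qed
    qed
  qed
  show "(\<lambda>i. L2_sq T (\<lambda>t. step_fun (N i) (\<tau> i) (slope (\<tau> i) (\<phi>s i)) t - g t)) \<longlonglongrightarrow> 0"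
  proof (rule tendsto_sandwich)
    show "\<forall>\<^sub>F i in sequentially. 0 \<le> L2_sq T (\<lambda>t. step_fun (N i) (\<tau> i) (slope (\<tau> i) (\<phi>s i)) t - g t)"
      by (simp add: L2_sq_nonneg)
    show "\<forall>\<^sub>F i in sequentially. L2_sq T (\<lambda>t. step_fun (N i) (\<tau> i) (slope (\<tau> i) (\<phi>s i)) t - g t)
        \<le> (H_norm T (\<lambda>t. \<phi>s i t - \<phi> t))\<^sup>2"
      by (simp add: H_norm_pl_diff(2)[OF T p \<phi> pl])
    show "(\<lambda>i. (H_norm T (\<lambda>t. \<phi>s i t - \<phi> t))\<^sup>2) \<longlonglongrightarrow> 0"
      using tendsto_power[OF lim, of 2] by simp
  qed simp
qed

text \<open>The sum is the integral of the squared \<open>Qnorm\<close> of one step function with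
  values \<open>s i k - w i k\<close>, so mean-square convergence of slopes and of drift values
  suffices. Left node values as \<open>w\<close> give the Euler scheme, means of both ends the
  trapezoidal one.\<close>

lemma discrete_energy_tendsto:
  assumes T: "T > 0" and p: "\<And>i. is_partition T (N i) (\<tau> i)"
    and g: "L2 T g" and F: "L2 T F"
    and slopes: "(\<lambda>i. L2_sq T (\<lambda>t. step_fun (N i) (\<tau> i) (s i) t - g t)) \<longlonglongrightarrow> 0"
    and w: "cellwise_limit N \<tau> w F"
  shows "(\<lambda>i. \<Sum>k<N i. step (\<tau> i) k * (Qnorm G (s i k - w i k))\<^sup>2)
    \<longlonglongrightarrow> integral\<^sup>L (lebesgue_on {0..T}) (\<lambda>t. (Qnorm G (g t - F t))\<^sup>2)"
proof -
  let ?M = "lebesgue_on {0..T}"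
  define b where "b i = step_fun (N i) (\<tau> i) (\<lambda>k. s i k - w i k)" for i
  have L2b: "L2 T (b i)" for i unfolding b_def by (rule step_fun_L2(1)[OF p])
  have L2a: "L2 T (\<lambda>t. g t - F t)" by (rule L2_diff[OF g F])
  have b: "b i t = step_fun (N i) (\<tau> i) (s i) t - step_fun (N i) (\<tau> i) (w i) t" for i t
    by (simp add: b_def step_fun_def scaleR_diff_right sum_subtractf)
  have "(\<lambda>i. L2_sq T (\<lambda>t. b i t - (g t - F t))) \<longlonglongrightarrow> 0"
  proof (rule tendsto_sandwich)
    show "\<forall>\<^sub>F i in sequentially. 0 \<le> L2_sq T (\<lambda>t. b i t - (g t - F t))"
      by (simp add: L2_sq_nonneg)
    show "\<forall>\<^sub>F i in sequentially. L2_sq T (\<lambda>t. b i t - (g t - F t))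
      \<le> 2 * L2_sq T (\<lambda>t. step_fun (N i) (\<tau> i) (s i) t - g t) + 2 * L2_sq T (\<lambda>t. step_fun (N i) (\<tau> i) (w i) t - F t)"
    proof (intro always_eventually allI)
      fix i
      have 1: "L2 T (\<lambda>t. step_fun (N i) (\<tau> i) (s i) t - g t)" "L2 T (\<lambda>t. step_fun (N i) (\<tau> i) (w i) t - F t)"
        by (intro L2_diff step_fun_L2(1)[OF p] g F)+
      have 2: "L2 T (\<lambda>t. b i t - (g t - F t))" by (rule L2_diff[OF L2b L2a])
      have "L2_sq T (\<lambda>t. b i t - (g t - F t)) \<le> integral\<^sup>L ?M (\<lambda>t.
          2 * (norm (step_fun (N i) (\<tau> i) (s i) t - g t))\<^sup>2 + 2 * (norm (step_fun (N i) (\<tau> i) (w i) t - F t))\<^sup>2)"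
        unfolding L2_sq_def
      proof (rule integral_mono)
        fix t
        have "b i t - (g t - F t) = (step_fun (N i) (\<tau> i) (s i) t - g t) - (step_fun (N i) (\<tau> i) (w i) t - F t)"
          by (simp add: b)
        then show "(norm (b i t - (g t - F t)))\<^sup>2 \<le>
          2 * (norm (step_fun (N i) (\<tau> i) (s i) t - g t))\<^sup>2 + 2 * (norm (step_fun (N i) (\<tau> i) (w i) t - F t))\<^sup>2"
          by (simp only: norm_diff_sq_le)
      qed (use 1 2 in \<open>auto simp: L2_def\<close>)
      then show "L2_sq T (\<lambda>t. b i t - (g t - F t))
        \<le> 2 * L2_sq T (\<lambda>t. step_fun (N i) (\<tau> i) (s i) t - g t) + 2 * L2_sq T (\<lambda>t. step_fun (N i) (\<tau> i) (w i) t - F t)"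
        using 1 by (simp add: L2_def L2_sq_def)
    qed
    have "(\<lambda>i. 2 * L2_sq T (\<lambda>t. step_fun (N i) (\<tau> i) (s i) t - g t) + 2 * L2_sq T (\<lambda>t. step_fun (N i) (\<tau> i) (w i) t - F t))
      \<longlonglongrightarrow> 2 * 0 + 2 * 0"
      by (intro tendsto_intros slopes cellwise_limit_L2_sq[OF p T F w])
    then show "(\<lambda>i. 2 * L2_sq T (\<lambda>t. step_fun (N i) (\<tau> i) (s i) t - g t) + 2 * L2_sq T (\<lambda>t. step_fun (N i) (\<tau> i) (w i) t - F t))
      \<longlonglongrightarrow> 0" by simp
  qed simp
  from Qnorm_sq_integral_tendsto[OF L2a L2b this]
  have lim: "(\<lambda>i. integral\<^sup>L ?M (\<lambda>t. (Qnorm G (b i t))\<^sup>2)) \<longlonglongrightarrow> integral\<^sup>L ?M (\<lambda>t. (Qnorm G (g t - F t))\<^sup>2)" .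
  have "integral\<^sup>L ?M (\<lambda>t. (Qnorm G (b i t))\<^sup>2) = (\<Sum>k<N i. step (\<tau> i) k * (Qnorm G (s i k - w i k))\<^sup>2)" for i
  proof -
    have int: "integrable ?M (step_fun (N i) (\<tau> i) (\<lambda>k. (Qnorm G (s i k - w i k))\<^sup>2))"
      by (rule step_fun_integral(1)[OF p])
    have "integral\<^sup>L ?M (\<lambda>t. (Qnorm G (b i t))\<^sup>2)
        = integral\<^sup>L ?M (step_fun (N i) (\<tau> i) (\<lambda>k. (Qnorm G (s i k - w i k))\<^sup>2))"
      unfolding b_def
    proof (rule integral_cong_AE)
      show "(\<lambda>t. (Qnorm G (step_fun (N i) (\<tau> i) (\<lambda>k. s i k - w i k) t))\<^sup>2) \<in> borel_measurable ?M"
        using L2b[of i] by (intro Qnorm_sq_measurable) (simp add: L2_def b_def)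
      show "step_fun (N i) (\<tau> i) (\<lambda>k. (Qnorm G (s i k - w i k))\<^sup>2) \<in> borel_measurable ?M"
        using int by (rule borel_measurable_integrable)
    qed (rule step_fun_apply_AE[OF p])
    then show ?thesis by (simp add: step_fun_integral(2)[OF p])
  qed
  with lim show ?thesis by simp
qed

lemma continuous_along_path:
  assumes "continuous_on UNIV h" "continuous_on S \<phi>"
  shows "continuous_on S (\<lambda>t. h (t, \<phi> t))"
  by (rule continuous_on_compose2[OF assms(1)]) (auto intro!: continuous_intros assms(2))

lemma LINT_Icc_eq: "(LINT t:{a..b}|lebesgue. h t) = integral\<^sup>L (lebesgue_on {a..b}) h"
  for h :: "real \<Rightarrow> real"
  unfolding set_lebesgue_integral_def by (subst integral_restrict_space) auto

lemma R_merit_tendsto: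
  fixes f :: "real \<Rightarrow> real^'n \<Rightarrow> real^'n"
  assumes T: "T > 0" and p: "\<And>i. is_partition T (N i) (\<tau> i)" and mesh: "(\<lambda>i. mesh (N i) (\<tau> i)) \<longlonglongrightarrow> 0"
    and f: "continuous_on UNIV (\<lambda>(t, x). f t x)"
    and \<phi>: "\<phi> \<in> H_space T" and pl: "\<And>i. \<phi>s i \<in> pl_space T (N i) (\<tau> i)"
    and lim: "(\<lambda>i. H_norm T (\<lambda>t. \<phi>s i t - \<phi> t)) \<longlonglongrightarrow> 0"
  shows "(\<lambda>i. R_merit f G (N i) (\<tau> i) (\<phi>s i)) \<longlonglongrightarrow> Je_merit T f G \<phi>"
proof -
  have d: "has_L2_derivative T \<phi> (path_deriv T \<phi>)" by (rule H_space_has_L2_derivative[OF T \<phi>])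
  note lims = H_norm_pl_tendsto[OF T p d pl lim]
  have c: "continuous_on {0..T} \<phi>"
    using \<phi> abs_continuous_on_imp_continuous_on by (auto simp: H_space_def)
  have F: "L2 T (\<lambda>t. f t (\<phi> t))" using continuous_L2[OF continuous_along_path[OF f c]] by simp
  have w: "cellwise_limit N \<tau> (\<lambda>i k. f (\<tau> i k) (\<phi>s i (\<tau> i k))) (\<lambda>t. f t (\<phi> t))"
    using cellwise_limit_nodes[OF p mesh c f lims(1), of "\<lambda>i k. \<tau> i k"] step_pos[OF p]
    by (simp add: step_def less_imp_le)
  have "L2 T (path_deriv T \<phi>)" using d by (simp add: has_L2_derivative_def)
  from tendsto_mult[OF tendsto_const[of "- (1/2)"] discrete_energy_tendsto[OF T p this F lims(2) w, of G]]
  show ?thesis by (simp add: R_merit_def Je_merit_def LINT_Icc_eq slope_def)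
qed

text \<open>Each cell is expanded with \<open>s\<close> equal to half its step. The error of a cell
  is at most a constant times mesh times step, hence the total is of the order of the mesh; what
  remains is \<open>- (1/2)\<close> times a Riemann sum of the divergence. The uniform bound on the
  Jacobian makes the points \<open>x i k\<close> immaterial to the error.\<close>

lemma log_det_sum_tendsto:
  fixes f :: "real \<Rightarrow> real^'n \<Rightarrow> real^'n"
  assumes T: "T > 0" and p: "\<And>i. is_partition T (N i) (\<tau> i)" and mesh: "(\<lambda>i. mesh (N i) (\<tau> i)) \<longlonglongrightarrow> 0"
    and C2b: "C2b_uniform f" and u: "L2 T u"
    and lim: "cellwise_limit N \<tau> (\<lambda>i k. divg f (t i k) (x i k)) u"
  shows "(\<lambda>i. \<Sum>k<N i. ln (det (mat 1 - (1/2 * step (\<tau> i) k) *\<^sub>R Jac f (t i k) (x i k))))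
    \<longlonglongrightarrow> - (1/2) * integral\<^sup>L (lebesgue_on {0..T}) u"
proof -
  obtain B where B: "B \<ge> 0" "\<And>t x i j. \<bar>Jac f t x $ i $ j\<bar> \<le> B"
    using C2b_uniform_Jac_bounded[OF C2b] by metis
  obtain C0 s0 where s0: "s0 > 0" and C0: "\<And>(A :: real^'n^'n) s. 0 \<le> s \<Longrightarrow> s \<le> s0 \<Longrightarrow> (\<forall>i j. \<bar>A $ i $ j\<bar> \<le> B)
     \<Longrightarrow> \<bar>ln (det (mat 1 - s *\<^sub>R A)) + s * trace A\<bar> \<le> C0 * s\<^sup>2"
    using ln_det_one_minus_bound[OF B(1)] by blast
  \<comment> \<open>\<open>C0\<close> comes without a sign, and the estimates below multiply
    inequalities by it.\<close>
  define C where "C = \<bar>C0\<bar>"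
  define L where "L i k = ln (det (mat 1 - (1/2 * step (\<tau> i) k) *\<^sub>R Jac f (t i k) (x i k)))" for i k
  define D where "D i = (\<Sum>k<N i. L i k) - (- (1/2)) * (\<Sum>k<N i. step (\<tau> i) k * divg f (t i k) (x i k))" for i
  have "D \<longlonglongrightarrow> 0"
  proof (rule Lim_null_comparison)
    show "\<forall>\<^sub>F i in sequentially. norm (D i) \<le> C * T * mesh (N i) (\<tau> i)"
      using order_tendstoD(2)[OF mesh s0]
    proof eventually_elim
      case (elim i)
      have "D i = (\<Sum>k<N i. L i k + (1/2 * step (\<tau> i) k) * trace (Jac f (t i k) (x i k)))"
        by (simp add: D_def sum.distrib sum_distrib_left divg_def mult.assoc sum_negf)
      also have "norm \<dots> \<le> (\<Sum>k<N i. C * mesh (N i) (\<tau> i) * step (\<tau> i) k)"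
      proof (rule sum_norm_le)
        fix k assume "k \<in> {..<N i}"
        then have k: "k < N i" by simp
        have s: "0 < step (\<tau> i) k" "step (\<tau> i) k \<le> mesh (N i) (\<tau> i)"
          using step_pos[OF p k] step_le_mesh[OF k] by auto
        have "norm (L i k + (1/2 * step (\<tau> i) k) * trace (Jac f (t i k) (x i k))) \<le> C0 * (1/2 * step (\<tau> i) k)\<^sup>2"
          unfolding L_def real_norm_def by (rule C0) (use s elim B(2) in auto)
        also have "\<dots> \<le> C * (1/2 * step (\<tau> i) k)\<^sup>2"
          by (intro mult_right_mono) (auto simp: C_def)
        also have "\<dots> \<le> C * (mesh (N i) (\<tau> i) * step (\<tau> i) k)"
        proof (intro mult_left_mono)
          have "(1/2 * step (\<tau> i) k)\<^sup>2 = (1/4 * step (\<tau> i) k) * step (\<tau> i) k" by (simp add: power2_eq_square)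
          also have "\<dots> \<le> mesh (N i) (\<tau> i) * step (\<tau> i) k" using s by (intro mult_right_mono) auto
          finally show "(1/2 * step (\<tau> i) k)\<^sup>2 \<le> mesh (N i) (\<tau> i) * step (\<tau> i) k" .
        qed (simp add: C_def)
        finally show "norm (L i k + (1/2 * step (\<tau> i) k) * trace (Jac f (t i k) (x i k))) \<le> C * mesh (N i) (\<tau> i) * step (\<tau> i) k"
          by (simp add: mult.assoc)
      qed
      also have "\<dots> = C * T * mesh (N i) (\<tau> i)"
        using sum_step[OF p, of i] by (simp add: sum_distrib_left[symmetric])
      finally show ?case .
    qed
    show "(\<lambda>i. C * T * mesh (N i) (\<tau> i)) \<longlonglongrightarrow> 0"
      using tendsto_mult[OF tendsto_const[of "C * T"] mesh] by simp
  qed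
  moreover have "(\<lambda>i. - (1/2) * (\<Sum>k<N i. step (\<tau> i) k * divg f (t i k) (x i k)))
      \<longlonglongrightarrow> - (1/2) * integral\<^sup>L (lebesgue_on {0..T}) u"
    by (intro tendsto_intros cellwise_limit_Riemann_sum[OF p T u lim])
  ultimately have "(\<lambda>i. D i + - (1/2) * (\<Sum>k<N i. step (\<tau> i) k * divg f (t i k) (x i k)))
      \<longlonglongrightarrow> 0 + - (1/2) * integral\<^sup>L (lebesgue_on {0..T}) u"
    by (rule tendsto_add)
  then show ?thesis by (simp add: D_def L_def)
qed

lemma U_merit_tendsto:
  fixes f :: "real \<Rightarrow> real^'n \<Rightarrow> real^'n"
  assumes T: "T > 0" and p: "\<And>i. is_partition T (N i) (\<tau> i)" and mesh: "(\<lambda>i. mesh (N i) (\<tau> i)) \<longlonglongrightarrow> 0"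
    and f: "continuous_on UNIV (\<lambda>(t, x). f t x)" and C2b: "C2b_uniform f"
    and \<phi>: "\<phi> \<in> H_space T" and pl: "\<And>i. \<phi>s i \<in> pl_space T (N i) (\<tau> i)"
    and lim: "(\<lambda>i. H_norm T (\<lambda>t. \<phi>s i t - \<phi> t)) \<longlonglongrightarrow> 0"
  shows "(\<lambda>i. U_merit f G (N i) (\<tau> i) (\<phi>s i)) \<longlonglongrightarrow> J_merit T f G \<phi>"
proof -
  let ?M = "lebesgue_on {0..T}"
  have d: "has_L2_derivative T \<phi> (path_deriv T \<phi>)" by (rule H_space_has_L2_derivative[OF T \<phi>])
  note lims = H_norm_pl_tendsto[OF T p d pl lim]
  have c: "continuous_on {0..T} \<phi>"
    using \<phi> abs_continuous_on_imp_continuous_on by (auto simp: H_space_def)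
  have F: "L2 T (\<lambda>t. f t (\<phi> t))" using continuous_L2[OF continuous_along_path[OF f c]] by simp
  note div = C2b_uniform_divg_continuous[OF C2b f]
  have dF: "L2 T (\<lambda>t. divg f t (\<phi> t))" using continuous_L2[OF continuous_along_path[OF div c]] by simp
  have le: "\<tau> i k \<le> \<tau> i (Suc k)" if "k < N i" for i k using step_pos[OF p that] by (simp add: step_def)
  have w0: "cellwise_limit N \<tau> (\<lambda>i k. f (\<tau> i k) (\<phi>s i (\<tau> i k))) (\<lambda>t. f t (\<phi> t))"
    using cellwise_limit_nodes[OF p mesh c f lims(1), of "\<lambda>i k. \<tau> i k"] le by simp
  have w1: "cellwise_limit N \<tau> (\<lambda>i k. f (\<tau> i (Suc k)) (\<phi>s i (\<tau> i (Suc k)))) (\<lambda>t. f t (\<phi> t))"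
    using cellwise_limit_nodes[OF p mesh c f lims(1), of "\<lambda>i k. \<tau> i (Suc k)"] le by simp
  have dw: "cellwise_limit N \<tau> (\<lambda>i k. divg f (\<tau> i (Suc k)) (\<phi>s i (\<tau> i (Suc k)))) (\<lambda>t. divg f t (\<phi> t))"
    using cellwise_limit_nodes[OF p mesh c div lims(1), of "\<lambda>i k. \<tau> i (Suc k)"] le by simp
  \<comment> \<open>Both nodal drift values lie within \<open>e\<close> of the limit on the whole
    cell, hence so does their mean.\<close>
  have w: "cellwise_limit N \<tau> (\<lambda>i k. (1/2) *\<^sub>R (f (\<tau> i k) (\<phi>s i (\<tau> i k)) + f (\<tau> i (Suc k)) (\<phi>s i (\<tau> i (Suc k))))) (\<lambda>t. f t (\<phi> t))"
    unfolding cellwise_limit_def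
  proof (intro allI impI)
    fix e :: real assume e: "e > 0"
    show "\<forall>\<^sub>F i in sequentially. \<forall>k<N i. \<forall>t\<in>{\<tau> i k..\<tau> i (Suc k)}.
      norm ((1/2) *\<^sub>R (f (\<tau> i k) (\<phi>s i (\<tau> i k)) + f (\<tau> i (Suc k)) (\<phi>s i (\<tau> i (Suc k)))) - f t (\<phi> t)) \<le> e"
      using w0[unfolded cellwise_limit_def, rule_format, OF e] w1[unfolded cellwise_limit_def, rule_format, OF e]
    proof eventually_elim
      case (elim i)
      show ?case
      proof (intro allI impI ballI)
        fix k t assume k: "k < N i" "t \<in> {\<tau> i k..\<tau> i (Suc k)}"
        define a b z where "a = f (\<tau> i k) (\<phi>s i (\<tau> i k))" and "b = f (\<tau> i (Suc k)) (\<phi>s i (\<tau> i (Suc k)))"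
          and "z = f t (\<phi> t)"
        have "norm (a - z) \<le> e" "norm (b - z) \<le> e" using elim k by (auto simp: a_def b_def z_def)
        moreover have "(1/2) *\<^sub>R (a + b) - z = (1/2) *\<^sub>R ((a - z) + (b - z))"
          by (simp add: vec_eq_iff field_simps)
        ultimately show "norm ((1/2) *\<^sub>R (f (\<tau> i k) (\<phi>s i (\<tau> i k)) + f (\<tau> i (Suc k)) (\<phi>s i (\<tau> i (Suc k)))) - f t (\<phi> t)) \<le> e"
          unfolding a_def[symmetric] b_def[symmetric] z_def[symmetric]
          using norm_triangle_ineq[of "a - z" "b - z"] by simp
      qed
    qed
  qed
  have g: "L2 T (path_deriv T \<phi>)" using d by (simp add: has_L2_derivative_def)
  have "(\<lambda>i. U_merit f G (N i) (\<tau> i) (\<phi>s i)) \<longlonglongrightarrow>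
      - (1/2) * integral\<^sup>L ?M (\<lambda>t. divg f t (\<phi> t)) - (1/2) * integral\<^sup>L ?M (\<lambda>t. (Qnorm G (path_deriv T \<phi> t - f t (\<phi> t)))\<^sup>2)"
    unfolding U_merit_def slope_def[symmetric]
    by (intro tendsto_diff log_det_sum_tendsto[OF T p mesh C2b dF dw] tendsto_mult tendsto_const
        discrete_energy_tendsto[OF T p g F lims(2) w])
  moreover have "J_merit T f G \<phi> = - (1/2) * (integral\<^sup>L ?M (\<lambda>t. (Qnorm G (path_deriv T \<phi> t - f t (\<phi> t)))\<^sup>2) + integral\<^sup>L ?M (\<lambda>t. divg f t (\<phi> t)))"
    unfolding J_merit_def LINT_Icc_eq
    using Qnorm_sq_integrable[OF L2_diff[OF g F]] L2_integrable[OF dF]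
    by (subst Bochner_Integration.integral_add) auto
  then have "J_merit T f G \<phi> = - (1/2) * integral\<^sup>L ?M (\<lambda>t. divg f t (\<phi> t)) - (1/2) * integral\<^sup>L ?M (\<lambda>t. (Qnorm G (path_deriv T \<phi> t - f t (\<phi> t)))\<^sup>2)"
    by (simp add: field_simps)
  ultimately show ?thesis by (simp only:)
qed

section \<open>The data term in the extended reals\<close>

lemma eln_mult: "0 \<le> a \<Longrightarrow> 0 \<le> b \<Longrightarrow> eln a + eln b = eln (a * b)"
  by (auto simp: eln_def ln_mult zero_less_mult_iff)

lemma eln_prod:
  assumes "finite S" "\<And>t. t \<in> S \<Longrightarrow> 0 \<le> q t"
  shows "(\<Sum>t\<in>S. eln (q t)) = eln (\<Prod>t\<in>S. q t)"
  using assms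
proof (induction S)
  case empty
  show ?case by (simp add: eln_def zero_ereal_def)
next
  case (insert t S)
  then show ?case by (simp add: eln_mult prod_nonneg)
qed

text \<open>At a positive limit this is continuity of \<open>ln\<close>. At limit 0 the values fall
  below every real \<open>r\<close> as soon as \<open>q j < exp r\<close>, including the indices
  where \<open>q j\<close> is 0 and \<open>eln\<close> is already
  \<open>-\<infinity>\<close>.\<close>

lemma eln_tendsto:
  assumes lim: "(q \<longlongrightarrow> p) F" and nn: "\<And>j. 0 \<le> q j" and p: "0 \<le> p"
  shows "((\<lambda>j. eln (q j)) \<longlongrightarrow> eln p) F"
proof (cases "p = 0")
  case False
  with p have p: "p > 0" by simp
  have "((\<lambda>j. ereal (ln (q j))) \<longlongrightarrow> ereal (ln p)) F"
    using p by (intro tendsto_intros lim) auto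
  moreover have "\<forall>\<^sub>F j in F. ereal (ln (q j)) = eln (q j)"
    using order_tendstoD(1)[OF lim p] by eventually_elim (simp add: eln_def)
  ultimately have "((\<lambda>j. eln (q j)) \<longlongrightarrow> ereal (ln p)) F" by (rule Lim_transform_eventually)
  then show ?thesis using p by (simp add: eln_def[of p])
next
  case True
  have "\<forall>\<^sub>F j in F. eln (q j) < ereal r" for r
  proof -
    have "\<forall>\<^sub>F j in F. q j < exp r" using order_tendstoD(2)[OF lim, of "exp r"] True by simp
    then show ?thesis
    proof eventually_elim
      case (elim j)
      then show ?case using ln_less_cancel_iff[of "q j" "exp r"] by (auto simp: eln_def)
    qed
  qed
  then show ?thesis using True by (simp add: eln_def tendsto_MInfty)
qed

text \<open>All summands merge into one \<open>eln\<close> of a product of nonnegative factors, so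
  that a single limit covers also the case of several summands tending to
  \<open>-\<infinity>\<close>.\<close>

lemma data_merit_tendsto:
  fixes \<phi>s :: "nat \<Rightarrow> real \<Rightarrow> real^'n"
  assumes fin: "finite Tm" and \<nu>: "continuous_on UNIV \<nu>" "\<And>x. 0 \<le> \<nu> x"
    and \<psi>: "\<And>t. t \<in> Tm \<Longrightarrow> continuous_on UNIV (\<psi> t (y t))" "\<And>t x. t \<in> Tm \<Longrightarrow> 0 \<le> \<psi> t (y t) x"
    and lim: "\<And>t. t \<in> insert 0 Tm \<Longrightarrow> (\<lambda>j. \<phi>s j t) \<longlonglongrightarrow> \<phi> t"
  shows "(\<lambda>j. data_merit \<nu> Tm \<psi> y (\<phi>s j)) \<longlonglongrightarrow> data_merit \<nu> Tm \<psi> y \<phi>"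
proof -
  have eq: "data_merit \<nu> Tm \<psi> y \<theta> = eln (\<nu> (\<theta> 0) * (\<Prod>t\<in>Tm. \<psi> t (y t) (\<theta> t)))" for \<theta>
    using \<nu>(2) \<psi>(2) fin by (simp add: data_merit_def eln_prod eln_mult prod_nonneg)
  show ?thesis
    unfolding eq
  proof (intro eln_tendsto tendsto_mult tendsto_prod mult_nonneg_nonneg prod_nonneg \<nu>(2) \<psi>(2))
    show "(\<lambda>j. \<nu> (\<phi>s j 0)) \<longlonglongrightarrow> \<nu> (\<phi> 0)"
      using \<nu>(1) lim[of 0] by (auto intro: continuous_on_tendsto_compose)
    show "(\<lambda>j. \<psi> t (y t) (\<phi>s j t)) \<longlonglongrightarrow> \<psi> t (y t) (\<phi> t)" if "t \<in> Tm" for t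
      using \<psi>(1)[OF that] lim[of t] that by (auto intro: continuous_on_tendsto_compose)
  qed
qed

lemma data_merit_not_PInf: "finite Tm \<Longrightarrow> data_merit \<nu> Tm \<psi> y \<phi> \<noteq> \<infinity>"
  by (auto simp: data_merit_def eln_def sum_Pinfty)

section \<open>Hypo-convergence\<close>

text \<open>The interpolant shares with \<phi> the initial value and the slopes between nodes, so
  its distance to \<phi> is exactly the mean-square distance between these slopes and the
  derivative.\<close>

lemma H_norm_interpolant_tendsto:
  assumes T: "T > 0" and p: "\<And>i. is_partition T (N i) (\<tau> i)" and mesh: "(\<lambda>i. mesh (N i) (\<tau> i)) \<longlonglongrightarrow> 0"
    and \<phi>: "\<phi> \<in> H_space T"
  shows "(\<lambda>i. H_norm T (\<lambda>t. interpolant T (N i) (\<tau> i) \<phi> t - \<phi> t)) \<longlonglongrightarrow> 0"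
proof -
  have d: "has_L2_derivative T \<phi> (path_deriv T \<phi>)" by (rule H_space_has_L2_derivative[OF T \<phi>])
  let ?I = "\<lambda>i. interpolant T (N i) (\<tau> i) \<phi>"
  have "(H_norm T (\<lambda>t. ?I i t - \<phi> t))\<^sup>2 = L2_sq T (\<lambda>t. step_fun (N i) (\<tau> i) (slope (\<tau> i) \<phi>) t - path_deriv T \<phi> t)" for i
  proof -
    have 0: "\<tau> i 0 = 0" using p by (simp add: is_partition_def)
    have "?I i 0 = \<phi> 0"
      using interpolant_node[OF p T, of 0 i \<phi>] by (simp add: 0)
    moreover have "step_fun (N i) (\<tau> i) (slope (\<tau> i) (?I i)) = step_fun (N i) (\<tau> i) (slope (\<tau> i) \<phi>)"
      by (auto simp: step_fun_def fun_eq_iff slope_interpolant[OF p T])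
    ultimately show ?thesis
      using H_norm_pl_diff(2)[OF T p d interpolant_pl_space[OF p]] by simp
  qed
  then have "(\<lambda>i. (H_norm T (\<lambda>t. ?I i t - \<phi> t))\<^sup>2) \<longlonglongrightarrow> 0"
    using slopes_tendsto_L2[OF p mesh d] by simp
  then show ?thesis by simp
qed

text \<open>Both schemes are instances. \<open>conv\<close> asks for continuous convergence of the
  real-valued parts along subsequences \<open>r\<close>: the identity serves the recovery sequence,
  a general \<open>r\<close> the cluster points.\<close>

lemma hypo_converges_if_continuous_convergence:
  fixes D :: "nat \<Rightarrow> (real \<Rightarrow> real^'n) \<Rightarrow> real"
  assumes T: "T > 0" and p: "\<And>i. is_partition T (N i) (\<tau> i)" and mesh: "(\<lambda>i. mesh (N i) (\<tau> i)) \<longlonglongrightarrow> 0"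
    and Tm: "finite Tm" "Tm \<subseteq> {0..T}" "\<And>i. Tm \<subseteq> part_points (N i) (\<tau> i)"
    and \<nu>: "continuous_on UNIV \<nu>" "\<And>x. 0 \<le> \<nu> x"
    and \<psi>: "\<And>t. t \<in> Tm \<Longrightarrow> continuous_on UNIV (\<psi> t (y t))" "\<And>t x. t \<in> Tm \<Longrightarrow> 0 \<le> \<psi> t (y t) x"
    and conv: "\<And>r \<phi>s \<phi>. \<lbrakk>strict_mono r; \<And>j. \<phi>s j \<in> pl_space T (N (r j)) (\<tau> (r j)); \<phi> \<in> H_space T;
        (\<lambda>j. H_norm T (\<lambda>t. \<phi>s j t - \<phi> t)) \<longlonglongrightarrow> 0\<rbrakk> \<Longrightarrow> (\<lambda>j. D (r j) (\<phi>s j)) \<longlonglongrightarrow> L \<phi>"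
  shows "hypo_converges T (\<lambda>i. pl_space T (N i) (\<tau> i)) (\<lambda>i \<phi>. ereal (D i \<phi>) + data_merit \<nu> Tm \<psi> y \<phi>)
    (\<lambda>\<phi>. ereal (L \<phi>) + data_merit \<nu> Tm \<psi> y \<phi>)"
  unfolding hypo_converges_def PK_converges_def
proof (intro conjI ballI allI impI)
  fix z :: "(real \<Rightarrow> real^'n) \<times> real"
  assume "z \<in> hypograph (H_space T) (\<lambda>\<phi>. ereal (L \<phi>) + data_merit \<nu> Tm \<psi> y \<phi>)"
  then obtain \<phi> s where z: "z = (\<phi>, s)" and \<phi>: "\<phi> \<in> H_space T" and s: "ereal s \<le> ereal (L \<phi>) + data_merit \<nu> Tm \<psi> y \<phi>"
    by (auto simp: hypograph_def)
  let ?I = "\<lambda>i. interpolant T (N i) (\<tau> i) \<phi>"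
  \<comment> \<open>A real \<open>s\<close> below the merit excludes \<open>-\<infinity>\<close>, so
    the data term at \<phi> is finite.\<close>
  obtain c where c: "data_merit \<nu> Tm \<psi> y \<phi> = ereal c"
    using s data_merit_not_PInf[OF Tm(1), of \<nu> \<psi> y \<phi>] by (cases "data_merit \<nu> Tm \<psi> y \<phi>") auto
  have node: "?I i t = \<phi> t" if "t \<in> insert 0 Tm" for i t
  proof -
    have "0 = \<tau> i 0" using p by (simp add: is_partition_def)
    then have "0 \<in> part_points (N i) (\<tau> i)" unfolding part_points_def by blast
    then have "t \<in> part_points (N i) (\<tau> i)" using that Tm(3) by blast
    then obtain k where "k \<le> N i" "t = \<tau> i k" by (auto simp: part_points_def)
    then show ?thesis using interpolant_node[OF p T] by simp
  qed
  have data: "data_merit \<nu> Tm \<psi> y (?I i) = ereal c" for i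
    unfolding c[symmetric] data_merit_def by (simp add: node)
  have Hn: "(\<lambda>i. H_norm T (\<lambda>t. ?I i t - \<phi> t)) \<longlonglongrightarrow> 0"
    by (rule H_norm_interpolant_tendsto[OF T p mesh \<phi>])
  have pl: "?I i \<in> pl_space T (N i) (\<tau> i)" for i by (rule interpolant_pl_space[OF p])
  have lim: "(\<lambda>i. D i (?I i)) \<longlonglongrightarrow> L \<phi>"
    using conv[of id ?I \<phi>] pl \<phi> Hn by (simp add: strict_mono_def)
  \<comment> \<open>The minimum keeps the point in the hypograph, and it tends to \<open>s\<close>
    because \<open>s \<le> L \<phi> + c\<close>.\<close>
  define q where "q i = (?I i, min s (D i (?I i) + c))" for i
  show "\<exists>q. (\<forall>i. q i \<in> hypograph (pl_space T (N i) (\<tau> i)) (\<lambda>\<phi>. ereal (D i \<phi>) + data_merit \<nu> Tm \<psi> y \<phi>)) \<and>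
      (\<lambda>i. HR_dist T (q i) z) \<longlonglongrightarrow> 0"
  proof (intro exI[of _ q] conjI allI)
    show "q i \<in> hypograph (pl_space T (N i) (\<tau> i)) (\<lambda>\<phi>. ereal (D i \<phi>) + data_merit \<nu> Tm \<psi> y \<phi>)" for i
      by (simp add: hypograph_def q_def data pl)
    have "s \<le> L \<phi> + c" using s by (simp add: c)
    then have "(\<lambda>i. min s (D i (?I i) + c)) \<longlonglongrightarrow> s"
      using tendsto_min[OF tendsto_const[of s] tendsto_add[OF lim tendsto_const[of c]]] by simp
    then have "(\<lambda>i. min s (D i (?I i) + c) - s) \<longlonglongrightarrow> 0" by (simp add: LIM_zero)
    from tendsto_real_sqrt[OF tendsto_add[OF tendsto_power[OF Hn, of 2] tendsto_power[OF this, of 2]]]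
    show "(\<lambda>i. HR_dist T (q i) z) \<longlonglongrightarrow> 0"
      by (simp add: HR_dist_def q_def z)
  qed
next
  fix q :: "nat \<Rightarrow> (real \<Rightarrow> real^'n) \<times> real" and r :: "nat \<Rightarrow> nat" and z :: "(real \<Rightarrow> real^'n) \<times> real"
  assume zH: "z \<in> H_space T \<times> UNIV" and A: "strict_mono r \<and>
      (\<forall>j. q j \<in> hypograph (pl_space T (N (r j)) (\<tau> (r j))) (\<lambda>\<phi>. ereal (D (r j) \<phi>) + data_merit \<nu> Tm \<psi> y \<phi>)) \<and>
      (\<lambda>j. HR_dist T (q j) z) \<longlonglongrightarrow> 0"
  obtain \<phi> s where z: "z = (\<phi>, s)" by (cases z)
  have \<phi>: "\<phi> \<in> H_space T" using zH z by simp
  define \<phi>s ss where "\<phi>s j = fst (q j)" and "ss j = snd (q j)" for j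
  have r: "strict_mono r" and pl: "\<phi>s j \<in> pl_space T (N (r j)) (\<tau> (r j))"
    and le: "ereal (ss j) \<le> ereal (D (r j) (\<phi>s j)) + data_merit \<nu> Tm \<psi> y (\<phi>s j)" for j
    using A by (auto simp: hypograph_def \<phi>s_def ss_def split_beta)
  have HR: "(\<lambda>j. HR_dist T (q j) z) \<longlonglongrightarrow> 0" using A by blast
  have "\<bar>H_norm T (\<lambda>t. \<phi>s j t - \<phi> t)\<bar> \<le> HR_dist T (q j) z" "\<bar>ss j - s\<bar> \<le> HR_dist T (q j) z" for j
    unfolding HR_dist_def by (auto simp: \<phi>s_def ss_def z intro!: real_le_rsqrt)
  then have Hn: "(\<lambda>j. H_norm T (\<lambda>t. \<phi>s j t - \<phi> t)) \<longlonglongrightarrow> 0" and "(\<lambda>j. ss j - s) \<longlonglongrightarrow> 0"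
    by (auto intro!: Lim_null_comparison[OF _ HR])
  then have ss: "ss \<longlonglongrightarrow> s" by (simp add: LIM_zero_iff)
  have mesh': "(\<lambda>j. mesh (N (r j)) (\<tau> (r j))) \<longlonglongrightarrow> 0"
    using LIMSEQ_subseq_LIMSEQ[OF mesh r] by (simp add: o_def)
  have unif: "uniform_limit {0..T} \<phi>s \<phi> sequentially"
    by (rule H_norm_pl_tendsto(1)[OF T p H_space_has_L2_derivative[OF T \<phi>] pl Hn])
  have "(\<lambda>j. data_merit \<nu> Tm \<psi> y (\<phi>s j)) \<longlonglongrightarrow> data_merit \<nu> Tm \<psi> y \<phi>"
  proof (rule data_merit_tendsto[where \<psi> = \<psi> and y = y, OF Tm(1) \<nu> \<psi>])
    fix t assume "t \<in> insert 0 Tm"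
    then have "t \<in> {0..T}" using Tm(2) T by auto
    then show "(\<lambda>j. \<phi>s j t) \<longlonglongrightarrow> \<phi> t" by (rule tendsto_uniform_limitI[OF unif])
  qed
  moreover have "(\<lambda>j. ereal (D (r j) (\<phi>s j))) \<longlonglongrightarrow> ereal (L \<phi>)"
    using conv[OF r pl \<phi> Hn] by simp
  \<comment> \<open>The sum of the limits is legitimate because the first one is finite, even when
    the data term tends to \<open>-\<infinity>\<close>.\<close>
  ultimately have "(\<lambda>j. ereal (D (r j) (\<phi>s j)) + data_merit \<nu> Tm \<psi> y (\<phi>s j)) \<longlonglongrightarrow> ereal (L \<phi>) + data_merit \<nu> Tm \<psi> y \<phi>"
    by (intro tendsto_add_ereal_general2) auto
  moreover have "(\<lambda>j. ereal (ss j)) \<longlonglongrightarrow> ereal s" using ss by simp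
  ultimately have "ereal s \<le> ereal (L \<phi>) + data_merit \<nu> Tm \<psi> y \<phi>"
    by (rule tendsto_le[OF sequentially_bot]) (simp add: le)
  then show "z \<in> hypograph (H_space T) (\<lambda>\<phi>. ereal (L \<phi>) + data_merit \<nu> Tm \<psi> y \<phi>)"
    using \<phi> by (simp add: hypograph_def z)
qed

theorem theorem18:
  fixes T c\<^sub>3 :: real
    and f :: "real \<Rightarrow> real^'n \<Rightarrow> real^'n"
    and G :: "real^'n^'n"
    and \<nu> :: "real^'n \<Rightarrow> real"
    and Tm :: "real set"
    and m :: "real \<Rightarrow> nat"
    and y :: "real \<Rightarrow> nat \<Rightarrow> real"
    and \<psi> :: "real \<Rightarrow> (nat \<Rightarrow> real) \<Rightarrow> real^'n \<Rightarrow> real"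
    and M :: "'w measure"
    and W X :: "real \<Rightarrow> 'w \<Rightarrow> real^'n"
    and N :: "nat \<Rightarrow> nat"
    and \<tau> :: "nat \<Rightarrow> nat \<Rightarrow> real"
  assumes T_pos: "T > 0"
    and f_cont: "continuous_on UNIV (\<lambda>(t, x). f t x)"
    and f_C2b: "C2b_uniform f"
    and G_rank: "rank G = CARD('n)"
    and \<nu>_density: "prob_density lborel \<nu>"
    and \<nu>_bounded: "bounded (range \<nu>)"
    and \<nu>_cont: "continuous_on UNIV \<nu>"
    and Tm: "finite Tm" "Tm \<subseteq> {0..T}"
    and y: "\<forall>t\<in>Tm. y t \<in> space (lborel_nat (m t))"
    and \<psi>_density: "\<forall>t\<in>Tm. \<forall>x. prob_density (lborel_nat (m t)) (\<lambda>\<eta>. \<psi> t \<eta> x)"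
    and \<psi>_bounded: "\<forall>t\<in>Tm. \<forall>\<eta>\<in>space (lborel_nat (m t)). bounded (range (\<psi> t \<eta>))"
    and \<psi>_cont: "\<forall>t\<in>Tm. \<forall>\<eta>\<in>space (lborel_nat (m t)). continuous_on UNIV (\<psi> t \<eta>)"
    and prob: "prob_space M"
    and W: "wiener_process M T W"
    and X: "sde_solution M T f G \<nu> W X"
    and likelihood_pos: "\<forall>t\<in>Tm. (\<integral>\<omega>. \<psi> t (y t) (X t \<omega>) \<partial>M) > 0"
    and partition: "\<forall>i. is_partition T (N i) (\<tau> i)"
    and Tm_sub: "\<forall>i. Tm \<subseteq> part_points (N i) (\<tau> i)"
    and nested: "\<forall>i. part_points (N i) (\<tau> i) \<subseteq> part_points (N (Suc i)) (\<tau> (Suc i))"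
    and mesh_lim: "(\<lambda>i. mesh (N i) (\<tau> i)) \<longlonglongrightarrow> 0"
    and c3: "c\<^sub>3 > 0" "\<forall>i. mesh (N i) (\<tau> i) * real (N i) < c\<^sub>3"
    and contraction: "\<forall>i. 1/2 * mesh (N i) (\<tau> i) *
      (SUP p\<in>{0..T} \<times> UNIV. onorm (\<lambda>v. Jac f (fst p) (snd p) *v v)) < 1"
  shows "hypo_converges T (\<lambda>i. pl_space T (N i) (\<tau> i))
           (\<lambda>i. V_merit f G \<nu> Tm \<psi> y (N i) (\<tau> i)) (H_merit T f G \<nu> Tm \<psi> y) \<and>
         hypo_converges T (\<lambda>i. pl_space T (N i) (\<tau> i))
           (\<lambda>i. S_merit f G \<nu> Tm \<psi> y (N i) (\<tau> i)) (He_merit T f G \<nu> Tm \<psi> y)"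
proof -
  have p: "\<And>i. is_partition T (N i) (\<tau> i)" and Tms: "\<And>i. Tm \<subseteq> part_points (N i) (\<tau> i)"
    using partition Tm_sub by auto
  have \<nu>0: "\<And>x. 0 \<le> \<nu> x"
    using \<nu>_density by (simp add: prob_density_def)
  have \<psi>c: "\<And>t. t \<in> Tm \<Longrightarrow> continuous_on UNIV (\<psi> t (y t))" using \<psi>_cont y by blast
  have \<psi>0: "\<And>t x. t \<in> Tm \<Longrightarrow> 0 \<le> \<psi> t (y t) x"
    using \<psi>_density y unfolding prob_density_def by blast
  \<comment> \<open>The limits of the merits are used with the subsequence of partitions picked by
    \<open>r\<close> in place of the whole sequence, for which only the vanishing mesh has to be
    carried over.\<close>
  have meshr: "(\<lambda>j. mesh (N (r j)) (\<tau> (r j))) \<longlonglongrightarrow> 0" if "strict_mono r" for r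
    using LIMSEQ_subseq_LIMSEQ[OF mesh_lim that] by (simp add: o_def)
  note hypo = hypo_converges_if_continuous_convergence[where \<psi> = \<psi> and y = y, OF T_pos p mesh_lim Tm Tms \<nu>_cont \<nu>0 \<psi>c \<psi>0]
  have "hypo_converges T (\<lambda>i. pl_space T (N i) (\<tau> i))
      (\<lambda>i \<phi>. ereal (U_merit f G (N i) (\<tau> i) \<phi>) + data_merit \<nu> Tm \<psi> y \<phi>)
      (\<lambda>\<phi>. ereal (J_merit T f G \<phi>) + data_merit \<nu> Tm \<psi> y \<phi>)"
    by (rule hypo, assumption+, rule U_merit_tendsto[OF T_pos p meshr f_cont f_C2b], assumption+)
  moreover have "hypo_converges T (\<lambda>i. pl_space T (N i) (\<tau> i))
      (\<lambda>i \<phi>. ereal (R_merit f G (N i) (\<tau> i) \<phi>) + data_merit \<nu> Tm \<psi> y \<phi>)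
      (\<lambda>\<phi>. ereal (Je_merit T f G \<phi>) + data_merit \<nu> Tm \<psi> y \<phi>)"
    by (rule hypo, assumption+, rule R_merit_tendsto[OF T_pos p meshr f_cont], assumption+)
  ultimately show ?thesis
    unfolding V_merit_def[abs_def] S_merit_def[abs_def] H_merit_def[abs_def] He_merit_def[abs_def] by simp
qed

end
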